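(* Fix Borel maps $S_n:\mathrm{SB}\to C(2^{\mathbb{N}})$ ($n\in\mathbb{N}$) such that for every $X\in\mathrm{SB}$ with $X\ne\{0\}$ we have $S_n(X)\in S_X$ for all $n$ and $(S_n(X))_n$ is norm dense in the unit sphere $S_X$ (such maps exist). For $X\neq\{0\}$ let $E_X$, $(e_n^X)$, $Q_X$ be as defined in the context with $x_n=S_n(X)$, and for $X=\{0\}$ let $E_X=c_0$. Then for every $X\in\mathrm{SB}$: (i) $(e^X_n)$ is a normalized monotone Schauder basis of $E_X$; (ii) $Q_X:E_X\to X$ is a norm-one linear operator onto $X$ (for $X\neq\{0\}$); (iii) if $Y$ is an infinite-dimensional closed subspace of $E_X$ such that the restriction $Q_X|_Y:Y\to X$ is strictly singular, then $Y$ contains an isomorphic copy of $c_0$; (iv) for every normalized basic sequence $(w_k)$ in $X$ there is a subsequence $(e^X_{n_k})$ of $(e^X_n)$ equivalent to $(w_k)$; (v) the set $\mathcal{E}=\{(X,Y)\in\mathrm{SB}\times\mathrm{SB}: Y\text{ is isometric to }E_X\}$ is analytic; (vi) $E_X^*$ is separable if and only if $X^*$ is separable.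
   Context: $\mathrm{SB}$ denotes the standard Borel space of separable Banach spaces: the set of all closed linear subspaces of $C(2^{\mathbb{N}})$ with the relative Effros–Borel $\sigma$-algebra (generated by $\{F: F\cap U\neq\emptyset\}$, $U$ open). A subset of a standard Borel space is analytic if it is the image of a Borel map from $\mathbb{N}^{\mathbb{N}}$. Construction of $E_X$: given a separable Banach space $X\neq\{0\}$ and a sequence $(x_n)$ (repetitions allowed) in the unit sphere of $X$ which is norm dense in the unit sphere, $E_X$ is the completion of $c_{00}(\mathbb{N})$ (finitely supported real sequences) under the norm $\|z\|_{E_X}=\sup_{m\in\mathbb{N}}\|\sum_{n=0}^m z(n)x_n\|_X$; $(e^X_n)$ is the standard unit vector (Hamel) basis of $c_{00}(\mathbb{N})$ viewed in $E_X$; and $Q_X:E_X\to X$ is the unique bounded linear operator with $Q_X(e^X_n)=x_n$ for all $n$. An operator is strictly singular if its restriction to no infinite-dimensional closed subspace is an isomorphism onto its image. *)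

theory Defs
  imports "HOL-Analysis.Analysis"
begin

text \<open>The Cantor set 2^N is the type nat => bool with the product topology
  (Function_Topology; bool carries the discrete topology).  Every continuous real
  function on the compact space 2^N is bounded, so C(2^N) with the sup norm is the
  type of bounded continuous functions.\<close>

type_synonym C2N = "(nat \<Rightarrow> bool) \<Rightarrow>\<^sub>C real"

definition SB :: "C2N set set" where
  "SB = {F. closed F \<and> subspace F}"

definition SB_M :: "C2N set measure" where
  "SB_M = sigma SB {{F \<in> SB. F \<inter> U \<noteq> {}} | U. open U}"

definition analytic_in :: "'a measure \<Rightarrow> 'a set \<Rightarrow> bool" where
  "analytic_in M A \<longleftrightarrow> A \<subseteq> space M \<and>
     (A = {} \<or> (\<exists>f. f \<in> measurable (borel :: (nat \<Rightarrow> nat) measure) M \<and> range f = A))"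

definition unit_sphere :: "'a::real_normed_vector set \<Rightarrow> 'a set" where
  "unit_sphere X = {x \<in> X. norm x = 1}"

definition c00 :: "(nat \<Rightarrow> real) set" where
  "c00 = {z. finite {n. z n \<noteq> 0}}"

definition unitvec :: "nat \<Rightarrow> nat \<Rightarrow> real" where
  "unitvec n = (\<lambda>k. if k = n then 1 else 0)"

text \<open>The vectors x_n = S_n(X) used in the construction (for X = {0} we put x_n = 0,
  so that Q_X is the zero operator in that degenerate case).\<close>
definition xseq :: "(nat \<Rightarrow> C2N set \<Rightarrow> C2N) \<Rightarrow> C2N set \<Rightarrow> nat \<Rightarrow> C2N" where
  "xseq S X n = (if X = {0} then 0 else S n X)"

text \<open>The norm on c00 whose completion is E_X: for X /= {0} it is
  sup_m || sum_{n<=m} z(n) x_n ||; for X = {0} it is the sup norm (completion c_0).\<close>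
definition EX_norm :: "(nat \<Rightarrow> C2N set \<Rightarrow> C2N) \<Rightarrow> C2N set \<Rightarrow> (nat \<Rightarrow> real) \<Rightarrow> real" where
  "EX_norm S X z = (if X = {0} then (SUP n. \<bar>z n\<bar>)
                    else (SUP m. norm (\<Sum>n\<le>m. z n *\<^sub>R S n X)))"

text \<open>j realises E as a completion of (c00, N): j is linear on c00, isometric for N,
  and E is the closure of its image (a closed subset of a Banach space, hence complete).\<close>
definition is_completion ::
  "((nat \<Rightarrow> real) \<Rightarrow> real) \<Rightarrow> ((nat \<Rightarrow> real) \<Rightarrow> 'e::real_normed_vector) \<Rightarrow> 'e set \<Rightarrow> bool" where
  "is_completion N j E \<longleftrightarrow>
     (\<forall>z\<in>c00. \<forall>w\<in>c00. \<forall>a b. j (\<lambda>n. a * z n + b * w n) = a *\<^sub>R j z + b *\<^sub>R j w) \<and>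
     (\<forall>z\<in>c00. norm (j z) = N z) \<and>
     closure (j ` c00) = E"

definition closed_subspace :: "'a::real_normed_vector set \<Rightarrow> bool" where
  "closed_subspace Y \<longleftrightarrow> closed Y \<and> subspace Y"

definition infinite_dimensional :: "'a::real_normed_vector set \<Rightarrow> bool" where
  "infinite_dimensional Y \<longleftrightarrow> \<not> (\<exists>B. finite B \<and> Y \<subseteq> span B)"

definition schauder_basis :: "(nat \<Rightarrow> 'a::real_normed_vector) \<Rightarrow> 'a set \<Rightarrow> bool" where
  "schauder_basis e E \<longleftrightarrow> (\<forall>n. e n \<in> E) \<and>
     (\<forall>x\<in>E. \<exists>!a. (\<lambda>n. a n *\<^sub>R e n) sums x)"

definition monotone_seq :: "(nat \<Rightarrow> 'a::real_normed_vector) \<Rightarrow> bool" where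
  "monotone_seq e \<longleftrightarrow> (\<forall>a m k. m \<le> k \<longrightarrow>
      norm (\<Sum>n<m. a n *\<^sub>R e n) \<le> norm (\<Sum>n<k. a n *\<^sub>R e n))"

definition normalized :: "(nat \<Rightarrow> 'a::real_normed_vector) \<Rightarrow> bool" where
  "normalized e \<longleftrightarrow> (\<forall>n. norm (e n) = 1)"

definition basic_sequence :: "(nat \<Rightarrow> 'a::real_normed_vector) \<Rightarrow> bool" where
  "basic_sequence w \<longleftrightarrow> schauder_basis w (closure (span (range w)))"

definition equivalent_seqs ::
  "(nat \<Rightarrow> 'a::real_normed_vector) \<Rightarrow> (nat \<Rightarrow> 'b::real_normed_vector) \<Rightarrow> bool" where
  "equivalent_seqs u w \<longleftrightarrow> (\<forall>a::nat \<Rightarrow> real.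
      summable (\<lambda>n. a n *\<^sub>R u n) \<longleftrightarrow> summable (\<lambda>n. a n *\<^sub>R w n))"

text \<open>T restricted to Y is an isomorphism onto its image (T bounded linear):
  T is bounded below on Y.\<close>
definition iso_on :: "('a::real_normed_vector \<Rightarrow> 'b::real_normed_vector) \<Rightarrow> 'a set \<Rightarrow> bool" where
  "iso_on T Y \<longleftrightarrow> (\<exists>c>0. \<forall>y\<in>Y. c * norm y \<le> norm (T y))"

definition strictly_singular_on ::
  "('a::real_normed_vector \<Rightarrow> 'b::real_normed_vector) \<Rightarrow> 'a set \<Rightarrow> bool" where
  "strictly_singular_on T Y \<longleftrightarrow>
     (\<forall>Z. Z \<subseteq> Y \<longrightarrow> closed_subspace Z \<longrightarrow> infinite_dimensional Z \<longrightarrow> \<not> iso_on T Z)"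

definition c0 :: "(nat \<Rightarrow> real) set" where
  "c0 = {a. a \<longlonglongrightarrow> 0}"

definition supnorm :: "(nat \<Rightarrow> real) \<Rightarrow> real" where
  "supnorm a = (SUP n. \<bar>a n\<bar>)"

definition contains_c0 :: "'a::real_normed_vector set \<Rightarrow> bool" where
  "contains_c0 Y \<longleftrightarrow> (\<exists>T::(nat \<Rightarrow> real) \<Rightarrow> 'a. (\<forall>a\<in>c0. T a \<in> Y) \<and>
     (\<forall>a\<in>c0. \<forall>b\<in>c0. \<forall>s t. T (\<lambda>n. s * a n + t * b n) = s *\<^sub>R T a + t *\<^sub>R T b) \<and>
     (\<exists>c C. 0 < c \<and> (\<forall>a\<in>c0. c * supnorm a \<le> norm (T a) \<and> norm (T a) \<le> C * supnorm a)))"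

definition bdd_functional :: "'a::real_normed_vector set \<Rightarrow> ('a \<Rightarrow> real) \<Rightarrow> bool" where
  "bdd_functional X f \<longleftrightarrow>
     (\<forall>x\<in>X. \<forall>y\<in>X. \<forall>a b. f (a *\<^sub>R x + b *\<^sub>R y) = a * f x + b * f y) \<and>
     (\<exists>C. \<forall>x\<in>X. \<bar>f x\<bar> \<le> C * norm x)"

definition dual_separable :: "'a::real_normed_vector set \<Rightarrow> bool" where
  "dual_separable X \<longleftrightarrow> (\<exists>D. countable D \<and> (\<forall>d\<in>D. bdd_functional X d) \<and>
     (\<forall>f. bdd_functional X f \<longrightarrow>
        (\<forall>\<epsilon>>0. \<exists>d\<in>D. \<forall>x\<in>X. \<bar>f x - d x\<bar> \<le> \<epsilon> * norm x)))"

end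

theory Submission
  imports Defs
begin

text \<open>Let \<open>R\<^sub>m z = \<Sum>n\<le>m. z(n) x\<^sub>n\<close>, so that \<open>\<parallel>z\<parallel> = sup\<^sub>m \<parallel>R\<^sub>m z\<parallel>\<close> and \<open>R\<^sub>m z \<longlonglongrightarrow> Q z\<close>: the space
  \<open>E\<close> embeds isometrically into the convergent sequences in \<open>X\<close>.  (If \<open>X = {0}\<close>, take the
  coordinate functionals for \<open>R\<^sub>m\<close>.)

  Surjectivity of \<open>Q\<close> comes from successive approximation by multiples of the \<open>x\<^sub>n\<close>.  For (iii),
  if \<open>u\<close> is supported before \<open>v\<close> then \<open>\<parallel>u + v\<parallel> \<le> max \<parallel>u\<parallel> (\<parallel>Q u\<parallel> + \<parallel>v\<parallel>)\<close>; hence normalized blocks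
  with summable \<open>\<parallel>Q u\<^sub>k\<parallel>\<close> span \<open>c\<^sub>0\<close>, and strict singularity provides such blocks arbitrarily
  close to \<open>Y\<close>.  For (iv), choose \<open>x\<^bsub>\<nu>(k)\<^esub>\<close> with \<open>\<parallel>x\<^bsub>\<nu>(k)\<^esub> - w\<^sub>k\<parallel> < 2\<^sup>-\<^sup>k\<close>; a series in the
  \<open>e\<^bsub>\<nu>(k)\<^esub>\<close> is Cauchy iff the same series in the \<open>x\<^bsub>\<nu>(k)\<^esub>\<close> is.  For (v), both spaces are
  closed spans of sequences in \<open>C(2\<^sup>\<nat>)\<close>, which the Baire space parametrizes continuously; in these
  parameters the isometry condition is Borel, since it may be tested on rational vectors.  For
  (vi), the Hahn-Banach theorem extends functionals from \<open>E\<close> to the sequence space, whose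
  functionals are norm limits of finite combinations of \<open>d \<circ> R\<^sub>m\<close> and \<open>d \<circ> Q\<close> with \<open>d \<in> X\<^sup>*\<close>.\<close>

section \<open>The Hahn-Banach theorem\<close>

lemma hahn_banach_sublinear:
  fixes p :: "'a::real_vector \<Rightarrow> real"
  assumes sub: "\<And>x y. p (x + y) \<le> p x + p y"
    and hom: "\<And>c x. 0 \<le> c \<Longrightarrow> p (c *\<^sub>R x) = c * p x"
    and V: "subspace V"
    and lin: "\<And>x y a b. x \<in> V \<Longrightarrow> y \<in> V \<Longrightarrow> f (a *\<^sub>R x + b *\<^sub>R y) = a * f x + b * f y"
    and le: "\<And>x. x \<in> V \<Longrightarrow> f x \<le> p x"
  shows "\<exists>F. linear F \<and> (\<forall>x\<in>V. F x = f x) \<and> (\<forall>x. F x \<le> p x)"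
proof -
  define G0 where "G0 = (\<lambda>x. (x, f x)) ` V"
  define \<G> where "\<G> = {G. subspace G \<and> G0 \<subseteq> G \<and> (\<forall>x t. (x, t) \<in> G \<longrightarrow> t \<le> p x)}"
  have f0: "f 0 = 0"
    using lin[of 0 0 0 0] V by (simp add: subspace_0)
  have "subspace G0"
    unfolding subspace_def
  proof (intro conjI ballI allI)
    show "0 \<in> G0"
      unfolding G0_def zero_prod_def using f0 V by (metis image_eqI subspace_0)
  next
    fix u v assume "u \<in> G0" "v \<in> G0"
    then obtain x y where x: "x \<in> V" "u = (x, f x)" and y: "y \<in> V" "v = (y, f y)"
      by (auto simp: G0_def)
    show "u + v \<in> G0"
      unfolding G0_def using lin[OF x(1) y(1), of 1 1] V x y
      by (intro image_eqI[of _ _ "x + y"]) (auto simp: subspace_add)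
  next
    fix c u assume "u \<in> G0"
    then obtain x where x: "x \<in> V" "u = (x, f x)"
      by (auto simp: G0_def)
    show "c *\<^sub>R u \<in> G0"
      unfolding G0_def using lin[OF x(1) x(1), of c 0] V x
      by (intro image_eqI[of _ _ "c *\<^sub>R x"]) (auto simp: subspace_scale)
  qed
  then have "G0 \<in> \<G>"
    using le by (auto simp: \<G>_def G0_def)
  have "\<exists>M\<in>\<G>. \<forall>N\<in>\<G>. M \<subseteq> N \<longrightarrow> N = M"
  proof (rule subset_Zorn_nonempty)
    show "\<G> \<noteq> {}" using \<open>G0 \<in> \<G>\<close> by blast
    fix C assume "C \<noteq> {}" and C: "subset.chain \<G> C"
    then have mem: "\<And>G. G \<in> C \<Longrightarrow> subspace G \<and> G0 \<subseteq> G \<and> (\<forall>x t. (x, t) \<in> G \<longrightarrow> t \<le> p x)"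
      by (auto simp: subset.chain_def \<G>_def)
    have "subspace (\<Union>C)"
      unfolding subspace_def
    proof (intro conjI ballI allI)
      show "0 \<in> \<Union>C" using \<open>C \<noteq> {}\<close> mem subspace_0 by blast
    next
      fix u v assume "u \<in> \<Union>C" "v \<in> \<Union>C"
      then obtain A B where "A \<in> C" "B \<in> C" "u \<in> A" "v \<in> B" by blast
      moreover from this C have "A \<subseteq> B \<or> B \<subseteq> A"
        by (auto simp: subset.chain_def)
      ultimately show "u + v \<in> \<Union>C"
        using mem subspace_add by (metis UnionI subsetD)
    next
      fix c u assume "u \<in> \<Union>C"
      then show "c *\<^sub>R u \<in> \<Union>C" using mem subspace_scale by blast
    qed
    then show "\<Union>C \<in> \<G>"
      using mem \<open>C \<noteq> {}\<close> unfolding \<G>_def by blast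
  qed
  then obtain M where M: "M \<in> \<G>" and max: "\<And>N. N \<in> \<G> \<Longrightarrow> M \<subseteq> N \<Longrightarrow> N = M"
    by blast
  have sM: "subspace M" and GM: "G0 \<subseteq> M" and Mle: "\<And>x t. (x, t) \<in> M \<Longrightarrow> t \<le> p x"
    using M by (auto simp: \<G>_def)
  have uniq: "s = t" if "(x, s) \<in> M" "(x, t) \<in> M" for x s t
  proof -
    have p0: "p 0 = 0" using hom[of 0 0] by simp
    have "(0, s - t) \<in> M" "(0, t - s) \<in> M"
      using subspace_diff[OF sM that] subspace_diff[OF sM that(2,1)] by auto
    from Mle[OF this(1)] Mle[OF this(2)] show ?thesis using p0 by simp
  qed
  have total: "\<exists>t. (x0, t) \<in> M" for x0
  proof -
    define L where "L = {t - p (x - x0) | x t. (x, t) \<in> M}"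
    have LU: "t - p (x - x0) \<le> p (x' + x0) - t'" if "(x, t) \<in> M" "(x', t') \<in> M" for x t x' t'
    proof -
      have "t + t' \<le> p (x + x')"
        using subspace_add[OF sM that] Mle by auto
      also have "\<dots> \<le> p (x - x0) + p (x' + x0)"
        using sub[of "x - x0" "x' + x0"] by simp
      finally show ?thesis by simp
    qed
    have zero: "(0, 0) \<in> M" using subspace_0[OF sM] by (simp add: zero_prod_def)
    define c where "c = Sup L"
    have "bdd_above L"
      unfolding bdd_above_def L_def using LU[OF _ zero] by blast
    then have low: "t - p (x - x0) \<le> c" if "(x, t) \<in> M" for x t
      unfolding c_def using that by (intro cSup_upper) (auto simp: L_def)
    have up: "c \<le> p (x + x0) - t" if "(x, t) \<in> M" for x t
      unfolding c_def using that zero LU by (intro cSup_least) (auto simp: L_def)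
    have "t \<le> p x" if xt: "(x, t) \<in> span (insert (x0, c) M)" for x t
    proof -
      obtain s where "(x, t) - s *\<^sub>R (x0, c) \<in> M"
        using xt by (auto simp: span_breakdown_eq span_eq_iff[THEN iffD2, OF sM])
      then have s: "(x - s *\<^sub>R x0, t - s * c) \<in> M" by simp
      have sc: "((1 / r) *\<^sub>R (x - s *\<^sub>R x0), (t - s * c) / r) \<in> M" for r
        using subspace_scale[OF sM s, of "1 / r"] by simp
      consider "s = 0" | "s > 0" | "s < 0" by linarith
      then show ?thesis
      proof cases
        case 1
        then show ?thesis using Mle s by simp
      next
        case 2
        have "c + (t - s * c) / s \<le> p ((1 / s) *\<^sub>R (x - s *\<^sub>R x0) + x0)"
          using up[OF sc[of s]] by simp
        also have "(1 / s) *\<^sub>R (x - s *\<^sub>R x0) + x0 = (1 / s) *\<^sub>R x"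
          using 2 by (simp add: scaleR_diff_right)
        also have "p \<dots> = p x / s" using hom[of "1 / s" x] 2 by simp
        finally show ?thesis using 2 by (simp add: field_simps)
      next
        case 3
        have "(t - s * c) / (- s) - c \<le> p ((1 / (- s)) *\<^sub>R (x - s *\<^sub>R x0) - x0)"
          using low[OF sc[of "- s"]] by simp
        also have "(1 / (- s)) *\<^sub>R (x - s *\<^sub>R x0) - x0 = (1 / (- s)) *\<^sub>R x"
          using 3 by (simp add: scaleR_diff_right)
        also have "p \<dots> = p x / (- s)" using hom[of "1 / (- s)" x] 3 by simp
        finally have "- (t / s) \<le> - (p x / s)"
          using 3 by (simp add: diff_divide_distrib)
        then show ?thesis using 3 by (simp add: field_simps)
      qed
    qed
    then have "span (insert (x0, c) M) \<in> \<G>"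
      using GM span_superset[of "insert (x0, c) M"] by (auto simp: \<G>_def)
    then have "span (insert (x0, c) M) = M"
      using max span_superset[of "insert (x0, c) M"] by blast
    then show ?thesis using span_superset[of "insert (x0, c) M"] by blast
  qed
  define F where "F x = (THE t. (x, t) \<in> M)" for x
  have F: "(x, F x) \<in> M" for x
    unfolding F_def using total[of x] uniq by (metis theI)
  have Feq: "F x = t" if "(x, t) \<in> M" for x t
    using uniq F that by blast
  have "linear F"
  proof (rule linearI)
    fix x y :: 'a and r :: real
    show "F (x + y) = F x + F y"
      using subspace_add[OF sM F[of x] F[of y]] by (intro Feq) simp
    show "F (r *\<^sub>R x) = r *\<^sub>R F x"
      using subspace_scale[OF sM F[of x], of r] by (intro Feq) simp
  qed
  moreover have "F x = f x" if "x \<in> V" for x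
    using that GM by (intro Feq) (auto simp: G0_def)
  moreover have "F x \<le> p x" for x
    using Mle F by blast
  ultimately show ?thesis by blast
qed

section \<open>Separability of dual spaces\<close>

lemma bdd_functionalI_linear:
  assumes "linear f" and "\<And>x. \<bar>f x\<bar> \<le> C * norm x"
  shows "bdd_functional X f"
  unfolding bdd_functional_def
  using assms by (auto simp: linear_add linear_scale intro!: exI[of _ C])

lemma bdd_functional_linear:
  "bdd_functional UNIV f \<Longrightarrow> linear f"
  unfolding bdd_functional_def
  by (rule linearI) (metis UNIV_I mult_1 scaleR_one, metis UNIV_I add.right_neutral mult_zero_left real_scaleR_def scaleR_zero_left)

definition seq_single :: "nat \<Rightarrow> 'b \<Rightarrow> nat \<Rightarrow>\<^sub>C 'b::real_normed_vector" where
  "seq_single m x = Bcontfun (\<lambda>k. if k = m then x else 0)"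

lemma bounded_seq_bcontfun:
  fixes v :: "nat \<Rightarrow> 'b::real_normed_vector"
  assumes "\<And>m. norm (v m) \<le> B"
  shows "v \<in> bcontfun"
  by (rule bcontfun_normI[OF _ assms]) auto

lemma apply_seq_single: "seq_single m x k = (if k = m then x else 0)"
  unfolding seq_single_def
  by (subst Bcontfun_inverse) (auto intro!: bounded_seq_bcontfun[of _ "norm x"])

lemma apply_bcontfun_sum: "apply_bcontfun (\<Sum>i\<in>I. f i) x = (\<Sum>i\<in>I. apply_bcontfun (f i) x)"
  by (induction I rule: infinite_finite_induct) auto

lemma norm_bcontfun_le_iff:
  fixes v :: "'a::topological_space \<Rightarrow>\<^sub>C 'b::real_normed_vector"
  shows "norm v \<le> B \<longleftrightarrow> (\<forall>x. norm (v x) \<le> B)"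
  using norm_bound norm_bounded order_trans by metis

text \<open>The summands \<open>h\<^sub>m\<close> are the coordinates of an extension of \<open>f\<close> to the space of
  bounded sequences, into which \<open>E\<close> embeds by \<open>z \<mapsto> (R\<^sub>m z)\<^sub>m\<close>: on convergent sequences
  a functional is determined by its values on constant and on finitely supported sequences.
  The tail estimate is what \<open>\<Sum>\<parallel>h\<^sub>m\<parallel> < \<infinity>\<close> means without mentioning norms of functionals.\<close>
lemma functional_on_convergent_sequences:
  fixes R :: "nat \<Rightarrow> 'e::real_normed_vector \<Rightarrow> 'b::real_normed_vector"
  assumes f: "bdd_functional UNIV f"
    and lin: "\<And>m. linear (R m)"
    and lim: "\<And>z. (\<lambda>m. R m z) \<longlonglongrightarrow> Rlim z"
    and le: "\<And>m z. norm (R m z) \<le> norm z"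
    and norming: "\<And>z B. (\<And>m. norm (R m z) \<le> B) \<Longrightarrow> norm z \<le> B"
  obtains g :: "'b \<Rightarrow> real" and h :: "nat \<Rightarrow> 'b \<Rightarrow> real"
    where "\<And>X. bdd_functional X g" "\<And>m X. bdd_functional X (h m)"
      "\<And>z. (\<lambda>m. h m (R m z - Rlim z)) sums (f z - g (Rlim z))"
      "\<And>\<eta>. \<eta> > 0 \<Longrightarrow> \<exists>M. \<forall>N v. (\<forall>m. norm (v m) \<le> 1) \<longrightarrow> (\<Sum>m\<in>{M..<N}. h m (v m)) \<le> \<eta>"
proof -
  obtain C where C0: "\<And>x. \<bar>f x\<bar> \<le> C * norm x"
    using f by (auto simp: bdd_functional_def)
  define K where "K = \<bar>C\<bar>"
  have K: "\<bar>f x\<bar> \<le> K * norm x" "K \<ge> 0" for x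
    using C0[of x] mult_right_mono[OF abs_ge_self[of C] norm_ge_zero[of x]] by (auto simp: K_def)
  have fl: "linear f" using f by (rule bdd_functional_linear)
  define J where "J z = Bcontfun (\<lambda>m. R m z)" for z
  have J: "apply_bcontfun (J z) m = R m z" for z m
    unfolding J_def using le by (subst Bcontfun_inverse) (auto intro!: bounded_seq_bcontfun)
  have Jlin: "linear J"
    by (rule linearI; rule bcontfun_eqI) (auto simp: J linear_add[OF lin] linear_scale[OF lin])
  have nJ: "norm z \<le> norm (J z)" for z
    using norm_bounded[of "J z"] by (intro norming) (simp add: J)
  have Jinj: "inj J"
  proof (rule injI)
    fix x y assume "J x = J y"
    then have "J (x - y) = 0" using linear_diff[OF Jlin] by simp
    then show "x = y" using nJ[of "x - y"] by simp
  qed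
  have "\<exists>F. linear F \<and> (\<forall>v\<in>range J. F v = f (inv J v)) \<and> (\<forall>v. F v \<le> K * norm v)"
  proof (rule hahn_banach_sublinear)
    show "subspace (range J)" using linear_subspace_image[OF Jlin subspace_UNIV] .
    show "K * norm (x + y) \<le> K * norm x + K * norm y" for x y :: "nat \<Rightarrow>\<^sub>C 'b"
      using mult_left_mono[OF norm_triangle_ineq K(2), of x y] by (simp add: algebra_simps)
    show "f (inv J v) \<le> K * norm v" if "v \<in> range J" for v
    proof -
      obtain z where z: "v = J z" using \<open>v \<in> range J\<close> by blast
      have "f z \<le> K * norm z" using K(1)[of z] by simp
      also have "\<dots> \<le> K * norm (J z)" using nJ K(2) by (intro mult_left_mono) auto
      finally show ?thesis using z Jinj by simp
    qed
    show "f (inv J (a *\<^sub>R v + b *\<^sub>R w)) = a * f (inv J v) + b * f (inv J w)"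
      if vw: "v \<in> range J" "w \<in> range J" for v w a b
    proof -
      obtain x y where xy: "v = J x" "w = J y" using vw by blast
      then have "a *\<^sub>R v + b *\<^sub>R w = J (a *\<^sub>R x + b *\<^sub>R y)"
        by (simp add: linear_add[OF Jlin] linear_scale[OF Jlin])
      then show ?thesis using xy Jinj by (simp add: linear_add[OF fl] linear_scale[OF fl])
    qed
  qed auto
  then obtain F where Fl: "linear F" and FJ: "\<And>z. F (J z) = f z" and Fle: "\<And>v. F v \<le> K * norm v"
    using Jinj by auto
  have Fabs: "\<bar>F v\<bar> \<le> K * norm v" for v
    using Fle[of v] Fle[of "- v"] linear_neg[OF Fl, of v] by (simp add: abs_le_iff)
  define g where "g x = F (const_bcontfun x)" for x
  define h where "h m x = F (seq_single m x)" for m x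
  have single_lin: "linear (seq_single m :: 'b \<Rightarrow> _)" for m
    by (rule linearI; rule bcontfun_eqI) (auto simp: apply_seq_single)
  have const_lin: "linear (const_bcontfun :: 'b \<Rightarrow> nat \<Rightarrow>\<^sub>C 'b)"
    by (rule linearI; rule bcontfun_eqI) (auto simp: const_bcontfun.rep_eq)
  have bdd_g: "bdd_functional X g" for X
  proof (rule bdd_functionalI_linear)
    show "linear g" unfolding g_def
      using linear_compose[OF const_lin Fl] by (simp add: o_def)
    show "\<bar>g x\<bar> \<le> K * norm x" for x
    proof -
      have "norm (const_bcontfun x :: nat \<Rightarrow>\<^sub>C 'b) \<le> norm x"
        by (simp add: norm_bcontfun_le_iff const_bcontfun.rep_eq)
      then show ?thesis
        using Fabs[of "const_bcontfun x"] K(2) unfolding g_def by (meson mult_left_mono order_trans)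
    qed
  qed
  have h_lin: "linear (h m)" for m
    unfolding h_def using linear_compose[OF single_lin Fl] by (simp add: o_def)
  have bdd_h: "bdd_functional X (h m)" for X m
  proof (rule bdd_functionalI_linear[OF h_lin])
    show "\<bar>h m x\<bar> \<le> K * norm x" for x
    proof -
      have "norm (seq_single m x) \<le> norm x"
        by (simp add: norm_bcontfun_le_iff apply_seq_single)
      then show ?thesis
        using Fabs[of "seq_single m x"] K(2) unfolding h_def by (meson mult_left_mono order_trans)
    qed
  qed
  have Fsum: "(\<Sum>m\<in>I. h m (v m)) = F (\<Sum>m\<in>I. seq_single m (v m))" for I v
    unfolding h_def by (simp add: linear_sum[OF Fl])
  have app: "apply_bcontfun (\<Sum>m\<in>I. seq_single m (v m)) k = (if k \<in> I then v k else 0)"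
    if "finite I" for I :: "nat set" and v :: "nat \<Rightarrow> 'b" and k
    using that by (simp add: apply_bcontfun_sum apply_seq_single)
  have sums: "(\<lambda>m. h m (R m z - Rlim z)) sums (f z - g (Rlim z))" for z
  proof -
    define v where "v = J z - const_bcontfun (Rlim z)"
    have v: "apply_bcontfun v m = R m z - Rlim z" for m
      by (simp add: v_def J const_bcontfun.rep_eq)
    have v0: "(\<lambda>m. apply_bcontfun v m) \<longlonglongrightarrow> 0"
      unfolding v using lim[of z] by (simp add: LIM_zero)
    have "(\<lambda>N. (\<Sum>m<N. seq_single m (apply_bcontfun v m))) \<longlonglongrightarrow> v"
    proof (rule LIMSEQ_I)
      fix r :: real assume "r > 0"
      then obtain N0 where N0: "\<And>m. m \<ge> N0 \<Longrightarrow> norm (apply_bcontfun v m) < r / 2"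
        using LIMSEQ_D[OF v0, of "r / 2"] by auto
      have "norm ((\<Sum>m<N. seq_single m (apply_bcontfun v m)) - v) < r" if "N \<ge> N0" for N
      proof -
        have "norm ((\<Sum>m<N. seq_single m (apply_bcontfun v m)) - v) \<le> r / 2"
          unfolding norm_bcontfun_le_iff
          using N0 that \<open>r > 0\<close> by (auto simp: app intro!: less_imp_le)
        then show ?thesis using \<open>r > 0\<close> by simp
      qed
      then show "\<exists>N0. \<forall>N\<ge>N0. norm ((\<Sum>m<N. seq_single m (apply_bcontfun v m)) - v) < r"
        by blast
    qed
    moreover have "bounded_linear F"
      using Fl Fabs by (intro bounded_linear_intro[of F K])
        (auto simp: linear_add linear_scale mult.commute)
    ultimately have "(\<lambda>N. F (\<Sum>m<N. seq_single m (apply_bcontfun v m))) \<longlonglongrightarrow> F v"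
      by (rule bounded_linear.tendsto[rotated])
    moreover have "F v = f z - g (Rlim z)"
      unfolding v_def g_def by (simp add: linear_diff[OF Fl] FJ)
    ultimately show ?thesis
      unfolding sums_def Fsum[symmetric] v by simp
  qed
  have tail: "\<exists>M. \<forall>N v. (\<forall>m. norm (v m) \<le> 1) \<longrightarrow> (\<Sum>m\<in>{M..<N}. h m (v m)) \<le> \<eta>"
    if "\<eta> > 0" for \<eta>
  proof -
    define A where "A = {\<Sum>m<N. h m (v m) | N v. \<forall>m. norm (v m) \<le> 1}"
    have "a \<le> K" if a: "a \<in> A" for a
    proof -
      obtain N v where v: "\<And>m. norm (v m) \<le> 1" and a: "a = (\<Sum>m<N. h m (v m))"
        using a by (auto simp: A_def)
      have "norm (\<Sum>m<N. seq_single m (v m)) \<le> 1"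
        unfolding norm_bcontfun_le_iff using v by (simp add: app)
      then have "K * norm (\<Sum>m<N. seq_single m (v m)) \<le> K"
        using K(2) mult_left_mono by fastforce
      then show ?thesis
        unfolding a Fsum using Fle order_trans by blast
    qed
    then have bdd: "bdd_above A" by (auto simp: bdd_above_def)
    have "(\<Sum>m<0. h m 0) \<in> A" unfolding A_def by (intro CollectI exI[of _ 0] exI[of _ "\<lambda>_. 0"]) auto
    then have "A \<noteq> {}" by blast
    moreover have "Sup A - \<eta> < Sup A" using that by simp
    ultimately obtain a where "a \<in> A" "Sup A - \<eta> < a"
      using less_cSup_iff[OF _ bdd] by blast
    then obtain M v0 where v0: "\<And>m. norm (v0 m) \<le> 1" and M: "Sup A - \<eta> < (\<Sum>m<M. h m (v0 m))"
      by (auto simp: A_def)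
    have "(\<Sum>m\<in>{M..<N}. h m (v m)) \<le> \<eta>" if v: "\<forall>m. norm (v m) \<le> 1" for N v
    proof (cases "M \<le> N")
      case True
      define w where "w m = (if m < M then v0 m else v m)" for m
      have "(\<Sum>m<N. h m (w m)) \<in> A"
        unfolding A_def using v v0 by (intro CollectI exI[of _ N] exI[of _ w]) (auto simp: w_def)
      then have "(\<Sum>m<N. h m (w m)) \<le> Sup A" using bdd by (rule cSup_upper)
      moreover have "(\<Sum>m<N. h m (w m)) = (\<Sum>m<M. h m (w m)) + (\<Sum>m\<in>{M..<N}. h m (w m))"
        using True by (simp add: lessThan_atLeast0 sum.atLeastLessThan_concat)
      ultimately show ?thesis using M by (simp add: w_def)
    qed (use \<open>\<eta> > 0\<close> in auto)
    then show ?thesis by blast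
  qed
  show thesis using that[OF bdd_g bdd_h sums tail] by blast
qed

lemma dual_separable_seq_embedding:
  fixes R :: "nat \<Rightarrow> 'e::real_normed_vector \<Rightarrow> 'b::real_normed_vector"
  assumes X: "subspace X" "dual_separable X"
    and lin: "\<And>m. linear (R m)"
    and inX: "\<And>m z. R m z \<in> X" "\<And>z. Rlim z \<in> X"
    and lim: "\<And>z. (\<lambda>m. R m z) \<longlonglongrightarrow> Rlim z"
    and le: "\<And>m z. norm (R m z) \<le> norm z"
    and norming: "\<And>z B. (\<And>m. norm (R m z) \<le> B) \<Longrightarrow> norm z \<le> B"
  shows "dual_separable (UNIV :: 'e set)"
proof -
  obtain D where D: "countable D" "\<And>d. d \<in> D \<Longrightarrow> bdd_functional X d"
    and Dd: "\<And>f \<epsilon>. bdd_functional X f \<Longrightarrow> \<epsilon> > 0 \<Longrightarrow> \<exists>d\<in>D. \<forall>x\<in>X. \<bar>f x - d x\<bar> \<le> \<epsilon> * norm x"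
    using X(2) by (auto simp: dual_separable_def)
  have le_lim: "norm (Rlim z) \<le> norm z" for z
    using LIMSEQ_le_const2[OF tendsto_norm[OF lim[of z]]] le by blast
  have lin_lim: "linear Rlim"
  proof (rule linearI)
    fix x y :: 'e and r :: real
    show "Rlim (x + y) = Rlim x + Rlim y"
      using tendsto_add[OF lim[of x] lim[of y]] lim[of "x + y"]
      by (simp add: linear_add[OF lin] LIMSEQ_unique)
    show "Rlim (r *\<^sub>R x) = r *\<^sub>R Rlim x"
      using tendsto_scaleR[OF tendsto_const lim[of x], of r] lim[of "r *\<^sub>R x"]
      by (simp add: linear_scale[OF lin] LIMSEQ_unique)
  qed
  define \<Phi> where "\<Phi> g hs z = g (Rlim z) + (\<Sum>m<length hs. (hs ! m) (R m z - Rlim z))"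
    for g :: "'b \<Rightarrow> real" and hs z
  have diffX: "R m z - Rlim z \<in> X" for m z
    using subspace_diff[OF X(1) inX(1) inX(2)] .
  have diff_le: "norm (R m z - Rlim z) \<le> 2 * norm z" for m z
    using norm_triangle_ineq4[of "R m z" "Rlim z"] le[of m z] le_lim[of z] by simp
  have comp: "bdd_functional UNIV (\<lambda>z. d (T z))"
    if d: "bdd_functional X d" and T: "linear T" "\<And>z. T z \<in> X" "\<And>z. norm (T z) \<le> c * norm z"
    for d T and c :: real
  proof -
    obtain C where C: "\<And>x. x \<in> X \<Longrightarrow> \<bar>d x\<bar> \<le> C * norm x"
      using d unfolding bdd_functional_def by blast
    have "\<bar>d (T z)\<bar> \<le> (\<bar>C\<bar> * c) * norm z" for z
    proof -
      have "\<bar>d (T z)\<bar> \<le> \<bar>C\<bar> * norm (T z)"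
        using C[OF T(2)[of z]] by (meson abs_ge_self mult_right_mono norm_ge_zero order_trans)
      also have "\<dots> \<le> \<bar>C\<bar> * (c * norm z)" using T(3) by (intro mult_left_mono) auto
      finally show ?thesis by simp
    qed
    moreover have "d (T (a *\<^sub>R x + b *\<^sub>R y)) = a * d (T x) + b * d (T y)" for x y a b
      using d T(2) by (simp add: bdd_functional_def linear_add[OF T(1)] linear_scale[OF T(1)])
    ultimately show ?thesis unfolding bdd_functional_def by blast
  qed
  have add: "bdd_functional UNIV (\<lambda>z. f z + g z)"
    if fg: "bdd_functional UNIV f" "bdd_functional UNIV g" for f g :: "'e \<Rightarrow> real"
  proof -
    obtain C C' where C: "\<And>x. \<bar>f x\<bar> \<le> C * norm x" "\<And>x. \<bar>g x\<bar> \<le> C' * norm x"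
      using fg by (auto simp: bdd_functional_def)
    have "\<bar>f x + g x\<bar> \<le> (C + C') * norm x" for x
      using C(1)[of x] C(2)[of x] unfolding distrib_right by linarith
    moreover have "f (a *\<^sub>R x + b *\<^sub>R y) + g (a *\<^sub>R x + b *\<^sub>R y) = a * (f x + g x) + b * (f y + g y)" for a b x y
      using fg by (simp add: bdd_functional_def algebra_simps)
    ultimately show ?thesis unfolding bdd_functional_def by blast
  qed
  have sum: "bdd_functional UNIV (\<lambda>z. \<Sum>i\<in>I. f i z)"
    if "finite I" "\<And>i. i \<in> I \<Longrightarrow> bdd_functional UNIV (f i)" for I and f :: "nat \<Rightarrow> 'e \<Rightarrow> real"
    using that
  proof (induction I rule: finite_induct)
    case empty
    then show ?case by (auto simp: bdd_functional_def intro!: exI[of _ 0])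
  next
    case (insert i I)
    then show ?case using add by simp
  qed
  have \<Phi>_bdd: "bdd_functional UNIV (\<Phi> d hs)" if d: "d \<in> D" "hs \<in> lists D" for d hs
  proof -
    have "bdd_functional UNIV (\<lambda>z. (hs ! m) (R m z - Rlim z))" if "m < length hs" for m
      by (rule comp[of _ _ 2, OF D(2)])
        (use that d in \<open>auto intro: diffX diff_le linear_compose_sub lin lin_lim\<close>)
    moreover have "bdd_functional UNIV (\<lambda>z. d (Rlim z))"
      by (rule comp[of _ _ 1, OF D(2)]) (use d le_lim lin_lim inX in auto)
    ultimately show ?thesis
      unfolding \<Phi>_def by (intro add sum) auto
  qed
  define D' where "D' = (\<lambda>(d, hs). \<Phi> d hs) ` (D \<times> lists D)"
  have D'_countable: "countable D'"
    unfolding D'_def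
    using D(1) by (intro countable_image countable_SIGMA countable_lists)
  have D'_dense: "\<exists>d\<in>D'. \<forall>z. \<bar>f z - d z\<bar> \<le> \<epsilon> * norm z"
    if f: "bdd_functional UNIV f" and \<epsilon>: "\<epsilon> > 0" for f :: "'e \<Rightarrow> real" and \<epsilon>
  proof -
    obtain g h where bdd: "\<And>X. bdd_functional X g" "\<And>m X. bdd_functional X (h m)"
      and sums: "\<And>z. (\<lambda>m. h m (R m z - Rlim z)) sums (f z - g (Rlim z))"
      and tail: "\<And>\<eta>. \<eta> > 0 \<Longrightarrow> \<exists>M. \<forall>N v. (\<forall>m. norm (v m) \<le> 1) \<longrightarrow> (\<Sum>m\<in>{M..<N}. h m (v m)) \<le> \<eta>"
      by (rule functional_on_convergent_sequences[OF f lin lim le], rule norming, blast) (rule that)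
    note g = bdd(1)[of X] and h = bdd(2)[of X]
    define \<eta> where "\<eta> = \<epsilon> / 5"
    have \<eta>: "\<eta> > 0" using \<epsilon> by (simp add: \<eta>_def)
    obtain M where M: "\<And>N v. (\<And>m. norm (v m) \<le> 1) \<Longrightarrow> (\<Sum>m\<in>{M..<N}. h m (v m)) \<le> \<eta>"
      using tail[OF \<eta>] by blast
    have tail_le: "\<bar>\<Sum>m\<in>{M..<N}. h m (v m)\<bar> \<le> \<eta> * c" 
      if v: "\<And>m. norm (v m) \<le> c" "\<And>m. v m \<in> X" and c: "c > 0" for N v c
    proof -
      have scale: "h m (s *\<^sub>R v m) = s * h m (v m)" for m s
        using h[of m] v(2)[of m] X(1) unfolding bdd_functional_def
        by (metis add.right_neutral mult_zero_left scaleR_zero_left)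
      have "(\<Sum>m\<in>{M..<N}. h m (s *\<^sub>R v m)) \<le> \<eta>" if "\<bar>s\<bar> = 1 / c" for s
      proof (rule M)
        show "norm (s *\<^sub>R v m) \<le> 1" for m
          using v(1)[of m] c that by simp
      qed
      then have "s * (\<Sum>m\<in>{M..<N}. h m (v m)) \<le> \<eta>" if "\<bar>s\<bar> = 1 / c" for s
        using that by (simp add: scale sum_distrib_left)
      from this[of "1 / c"] this[of "- (1 / c)"] c show ?thesis
        by (simp add: field_simps abs_le_iff)
    qed
    obtain d where d: "d \<in> D" "\<And>x. x \<in> X \<Longrightarrow> \<bar>g x - d x\<bar> \<le> \<eta> * norm x"
      using Dd[OF g \<eta>] by blast
    have "\<exists>d\<in>D. \<forall>x\<in>X. \<bar>h m x - d x\<bar> \<le> \<eta> / Suc M * norm x" for m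
      by (rule Dd[OF h]) (use \<eta> in simp)
    then obtain k where k: "\<And>m. k m \<in> D" "\<And>m x. x \<in> X \<Longrightarrow> \<bar>h m x - k m x\<bar> \<le> \<eta> / Suc M * norm x"
      by metis
    define hs where "hs = map k [0..<M]"
    have hs: "hs \<in> lists D" using k(1) by (auto simp: hs_def)
    have le: "\<bar>f z - \<Phi> d hs z\<bar> \<le> \<epsilon> * norm z" for z
    proof (cases "z = 0")
      case True
      have "f 0 = 0" "\<Phi> d hs 0 = 0"
        using f \<Phi>_bdd[OF d(1) hs] by (auto intro: linear_0 bdd_functional_linear)
      then show ?thesis using True by simp
    next
      case False
      define v where "v m = R m z - Rlim z" for m
      have v: "v m \<in> X" "norm (v m) \<le> 2 * norm z" for m
        using diffX diff_le by (auto simp: v_def)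
      have "\<bar>f z - g (Rlim z) - (\<Sum>m<M. h m (v m))\<bar> \<le> \<eta> * (2 * norm z)"
      proof (rule LIMSEQ_le_const2)
        have "(\<lambda>N. \<Sum>m<N. h m (v m)) \<longlonglongrightarrow> f z - g (Rlim z)"
          using sums[of z] by (simp add: sums_def v_def)
        then show "(\<lambda>N. \<bar>(\<Sum>m<N. h m (v m)) - (\<Sum>m<M. h m (v m))\<bar>)
            \<longlonglongrightarrow> \<bar>f z - g (Rlim z) - (\<Sum>m<M. h m (v m))\<bar>"
          by (intro tendsto_intros)
        have "(\<Sum>m<N. h m (v m)) - (\<Sum>m<M. h m (v m)) = (\<Sum>m\<in>{M..<N}. h m (v m))"
          if "M \<le> N" for N
          using that sum_diff_nat_ivl[of 0 M N "\<lambda>m. h m (v m)"] by (simp add: lessThan_atLeast0)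
        then show "\<exists>N0. \<forall>N\<ge>N0. \<bar>(\<Sum>m<N. h m (v m)) - (\<Sum>m<M. h m (v m))\<bar> \<le> \<eta> * (2 * norm z)"
          using tail_le[OF v(2) v(1)] False by (intro exI[of _ M] allI impI) simp
      qed
      moreover have "\<bar>g (Rlim z) - d (Rlim z)\<bar> \<le> \<eta> * norm z"
        using d(2)[OF inX(2)] le_lim[of z] \<eta> by (meson less_imp_le mult_left_mono order_trans)
      moreover have "\<bar>(\<Sum>m<M. h m (v m)) - (\<Sum>m<M. k m (v m))\<bar> \<le> \<eta> * (2 * norm z)"
      proof -
        have "\<bar>(\<Sum>m<M. h m (v m)) - (\<Sum>m<M. k m (v m))\<bar> \<le> (\<Sum>m<M. \<bar>h m (v m) - k m (v m)\<bar>)"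
          by (simp add: sum_subtractf[symmetric] sum_abs)
        also have "\<dots> \<le> (\<Sum>m<M. \<eta> / Suc M * (2 * norm z))"
          using k(2)[OF v(1)] v(2) \<eta>
          by (intro sum_mono) (meson divide_nonneg_nonneg less_imp_le mult_left_mono of_nat_0_le_iff order_trans)
        also have "\<dots> \<le> \<eta> * (2 * norm z)"
          using \<eta> by (simp add: field_simps)
        finally show ?thesis .
      qed
      moreover have "\<Phi> d hs z = d (Rlim z) + (\<Sum>m<M. k m (v m))"
        by (simp add: \<Phi>_def hs_def v_def)
      ultimately show ?thesis unfolding \<eta>_def by argo
    qed
    from hs have "\<Phi> d hs \<in> D'"
      unfolding D'_def using d(1) by (intro image_eqI[of _ _ "(d, hs)"]) auto
    then show ?thesis using le by blast
  qed
  show ?thesis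
    unfolding dual_separable_def
  proof (intro exI[of _ D'] conjI ballI)
    show "bdd_functional UNIV d" if "d \<in> D'" for d
      using that \<Phi>_bdd by (auto simp: D'_def)
  qed (use D'_countable D'_dense in auto)
qed

lemma dual_separable_real: "dual_separable (UNIV :: real set)"
  unfolding dual_separable_def
proof (intro exI conjI ballI allI impI)
  show "countable ((\<lambda>q x. q * x) ` \<rat> :: (real \<Rightarrow> real) set)"
    by (simp add: countable_rat)
  show "bdd_functional UNIV d" if d: "d \<in> (\<lambda>q x. q * x) ` \<rat>" for d :: "real \<Rightarrow> real"
  proof -
    obtain q where "d = (\<lambda>x. q * x)" using d by blast
    then show ?thesis
      by (auto simp: bdd_functional_def algebra_simps abs_mult intro!: exI[of _ "\<bar>q\<bar>"])
  qed
  fix f :: "real \<Rightarrow> real" and \<epsilon> :: real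
  assume f: "bdd_functional UNIV f" and "\<epsilon> > 0"
  have f1: "f x = f 1 * x" for x
    using linear_scale[OF bdd_functional_linear[OF f], of x 1] by simp
  obtain q where q: "q \<in> \<rat>" "f 1 - \<epsilon> < q" "q < f 1 + \<epsilon>"
    using Rats_dense_in_real[of "f 1 - \<epsilon>" "f 1 + \<epsilon>"] \<open>\<epsilon> > 0\<close> by auto
  have "\<bar>f x - q * x\<bar> \<le> \<epsilon> * norm x" for x
  proof -
    have "f x - q * x = (f 1 - q) * x" by (subst f1) (simp add: algebra_simps)
    then have "\<bar>f x - q * x\<bar> = \<bar>f 1 - q\<bar> * \<bar>x\<bar>" by (simp add: abs_mult)
    also have "\<dots> \<le> \<epsilon> * \<bar>x\<bar>" using q by (intro mult_right_mono) auto
    finally show ?thesis by simp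
  qed
  then show "\<exists>d\<in>(\<lambda>q x. q * x) ` \<rat>. \<forall>x\<in>UNIV. \<bar>f x - d x\<bar> \<le> \<epsilon> * norm x"
    using q(1) by blast
qed

lemma dual_separable_quotient:
  fixes Q :: "'e::real_normed_vector \<Rightarrow> 'b::real_normed_vector"
  assumes Q: "bounded_linear Q"
    and lift: "\<And>x. x \<in> X \<Longrightarrow> \<exists>z. Q z = x \<and> norm z \<le> K * norm x"
    and inX: "\<And>z. Q z \<in> X"
    and sep: "dual_separable (UNIV :: 'e set)"
  shows "dual_separable X"
proof -
  obtain D where D: "countable D"
    and Dd: "\<And>f \<epsilon>. bdd_functional UNIV f \<Longrightarrow> \<epsilon> > 0 \<Longrightarrow> \<exists>d\<in>D. \<forall>x::'e. \<bar>f x - d x\<bar> \<le> \<epsilon> * norm x"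
    using sep by (auto simp: dual_separable_def)
  define P where "P d k h \<longleftrightarrow> bdd_functional X h \<and> (\<forall>z. \<bar>h (Q z) - d z\<bar> \<le> norm z / Suc k)"
    for d and k :: nat and h
  define D' where "D' = (\<lambda>(d, k). SOME h. P d k h) ` {(d, k). d \<in> D \<and> (\<exists>h. P d k h)}"
  have "countable (D \<times> (UNIV :: nat set))" using D by simp
  then have "countable D'"
    unfolding D'_def by (intro countable_image) (auto elim: countable_subset[rotated])
  moreover have "bdd_functional X h" if "h \<in> D'" for h
    using that someI_ex[of "P _ _"] unfolding D'_def P_def by fastforce
  moreover have "\<exists>d\<in>D'. \<forall>x\<in>X. \<bar>f x - d x\<bar> \<le> \<epsilon> * norm x"
    if f: "bdd_functional X f" and "\<epsilon> > 0" for f \<epsilon>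
  proof -
    obtain C where C: "\<And>x. x \<in> X \<Longrightarrow> \<bar>f x\<bar> \<le> C * norm x"
      using f unfolding bdd_functional_def by blast
    have fQ: "bdd_functional UNIV (\<lambda>z. f (Q z))"
    proof -
      obtain B where B: "\<And>z. norm (Q z) \<le> norm z * B" "B \<ge> 0"
        using bounded_linear.nonneg_bounded[OF Q] by blast
      have "\<bar>f (Q z)\<bar> \<le> (\<bar>C\<bar> * B) * norm z" for z
      proof -
        have "\<bar>f (Q z)\<bar> \<le> \<bar>C\<bar> * norm (Q z)"
          using C[OF inX[of z]] by (meson abs_ge_self mult_right_mono norm_ge_zero order_trans)
        also have "\<dots> \<le> \<bar>C\<bar> * (norm z * B)" using B by (intro mult_left_mono) auto
        finally show ?thesis by (simp add: mult_ac)
      qed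
      moreover have "f (Q (a *\<^sub>R x + b *\<^sub>R y)) = a * f (Q x) + b * f (Q y)" for x y a b
        using f inX by (simp add: bdd_functional_def bounded_linear.linear[OF Q, THEN linear_add]
          bounded_linear.linear[OF Q, THEN linear_scale])
      ultimately show ?thesis unfolding bdd_functional_def by blast
    qed
    obtain k :: nat where k: "2 * \<bar>K\<bar> / \<epsilon> < Suc k" using reals_Archimedean2 less_trans
      by (metis of_nat_less_iff lessI)
    obtain d where d: "d \<in> D" "\<And>z. \<bar>f (Q z) - d z\<bar> \<le> (1 / Suc k) * norm z"
      using Dd[OF fQ, of "1 / Suc k"] by auto
    then have "P d k f" using f by (simp add: P_def)
    define h where "h = (SOME h. P d k h)"
    have "P d k h" unfolding h_def using \<open>P d k f\<close> by (rule someI[of "P d k"])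
    have "h \<in> D'"
      unfolding D'_def h_def using \<open>d \<in> D\<close> \<open>P d k f\<close> by (intro image_eqI[of _ _ "(d, k)"]) auto
    moreover have "\<bar>f x - h x\<bar> \<le> \<epsilon> * norm x" if "x \<in> X" for x
    proof -
      obtain z where z: "Q z = x" "norm z \<le> K * norm x" using lift \<open>x \<in> X\<close> by blast
      have "\<bar>h (Q z) - d z\<bar> \<le> norm z / Suc k" using \<open>P d k h\<close> unfolding P_def by blast
      then have "\<bar>f x - h x\<bar> \<le> 2 * norm z / Suc k" using d(2)[of z] z(1) by simp
      also have "\<dots> \<le> 2 * (\<bar>K\<bar> * norm x) / Suc k"
        using z(2) mult_right_mono[OF abs_ge_self[of K] norm_ge_zero[of x]]
        by (intro divide_right_mono mult_left_mono) auto
      also have "\<dots> = (2 * \<bar>K\<bar> / Suc k) * norm x" by simp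
      also have "\<dots> \<le> \<epsilon> * norm x"
        using k \<open>\<epsilon> > 0\<close> by (intro mult_right_mono) (simp_all add: field_simps)
      finally show ?thesis .
    qed
    ultimately show ?thesis by blast
  qed
  ultimately show ?thesis unfolding dual_separable_def by blast
qed

section \<open>Monotone bases\<close>

lemma sum_in_span_image: "(\<Sum>n\<in>I. a n *\<^sub>R e n) \<in> span (e ` I)"
  by (intro span_sum span_scale span_base) auto

lemma span_image_lessThanE:
  assumes "u \<in> span (e ` {..<k::nat})"
  obtains a where "u = (\<Sum>n<k. a n *\<^sub>R e n)"
proof -
  have "\<exists>a. u = (\<Sum>n<k. a n *\<^sub>R e n)"
    using assms
  proof (induction rule: span_induct_alt)
    case base
    show ?case by (intro exI[of _ "\<lambda>_. 0"]) simp
  next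
    case (step c x y)
    then obtain m a where m: "m < k" "x = e m" and a: "y = (\<Sum>n<k. a n *\<^sub>R e n)" by blast
    have "(\<Sum>n<k. (a n + (if n = m then c else 0)) *\<^sub>R e n)
        = (\<Sum>n<k. a n *\<^sub>R e n + (if n = m then c *\<^sub>R e n else 0))"
      by (intro sum.cong) (auto simp: scaleR_add_left)
    also have "\<dots> = c *\<^sub>R x + y"
      using m a by (simp add: sum.distrib)
    finally show ?case by metis
  qed
  then show thesis using that by blast
qed

lemma span_range_eq_UN_nat: "span (range e) = (\<Union>k::nat. span (e ` {..<k}))"
proof
  show "span (range e) \<subseteq> (\<Union>k. span (e ` {..<k}))"
  proof
    fix x assume "x \<in> span (range e)"
    then show "x \<in> (\<Union>k. span (e ` {..<k}))"
    proof (induction rule: span_induct_alt)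
      case base
      show ?case by (auto simp: span_zero)
    next
      case (step c x y)
      then obtain m k where m: "x = e m" and k: "y \<in> span (e ` {..<k})" by blast
      have "y \<in> span (e ` {..<max k (Suc m)})"
        using k by (rule span_mono[THEN subsetD, rotated]) (auto intro!: image_mono)
      moreover have "x \<in> span (e ` {..<max k (Suc m)})"
        unfolding m by (intro span_base) auto
      ultimately show ?case
        by (intro UN_I[of "max k (Suc m)"]) (auto intro: span_add span_scale)
    qed
  qed
  show "(\<Union>k. span (e ` {..<k})) \<subseteq> span (range e)"
    by (intro UN_least span_mono) auto
qed

locale monotone_normalized_basis =
  fixes e :: "nat \<Rightarrow> 'e::banach"
  assumes mono: "monotone_seq e" and nrm: "normalized e"
    and dense: "closure (span (range e)) = UNIV"
begin

lemma norm_e [simp]: "norm (e n) = 1"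
  using nrm by (simp add: normalized_def)

lemma partial_sum_mono: "m \<le> k \<Longrightarrow> norm (\<Sum>n<m. a n *\<^sub>R e n) \<le> norm (\<Sum>n<k. a n *\<^sub>R e n)"
  using mono by (simp add: monotone_seq_def)

lemma coefficient_le:
  assumes "n < k"
  shows "\<bar>a n\<bar> \<le> 2 * norm (\<Sum>n<k. a n *\<^sub>R e n)"
proof -
  have "\<bar>a n\<bar> = norm ((\<Sum>n<Suc n. a n *\<^sub>R e n) - (\<Sum>n<n. a n *\<^sub>R e n))"
    by simp
  also have "\<dots> \<le> norm (\<Sum>n<Suc n. a n *\<^sub>R e n) + norm (\<Sum>n<n. a n *\<^sub>R e n)"
    by (rule norm_triangle_ineq4)
  also have "\<dots> \<le> 2 * norm (\<Sum>n<k. a n *\<^sub>R e n)"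
    using partial_sum_mono[of "Suc n" k a] partial_sum_mono[of n k a] assms by linarith
  finally show ?thesis .
qed

lemma partial_sum_le_sums:
  assumes "(\<lambda>n. a n *\<^sub>R e n) sums x"
  shows "norm (\<Sum>n<m. a n *\<^sub>R e n) \<le> norm x"
proof (rule LIMSEQ_le_const)
  show "(\<lambda>k. norm (\<Sum>n<k. a n *\<^sub>R e n)) \<longlonglongrightarrow> norm x"
    using assms unfolding sums_def by (rule tendsto_norm)
  show "\<exists>N. \<forall>k\<ge>N. norm (\<Sum>n<m. a n *\<^sub>R e n) \<le> norm (\<Sum>n<k. a n *\<^sub>R e n)"
    using partial_sum_mono by blast
qed

lemma coefficient_le_sums:
  assumes "(\<lambda>n. a n *\<^sub>R e n) sums x"
  shows "\<bar>a n\<bar> \<le> 2 * norm x"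
  using coefficient_le[of n "Suc n" a] partial_sum_le_sums[OF assms, of "Suc n"] by linarith

lemma expansion_unique:
  assumes "(\<lambda>n. a n *\<^sub>R e n) sums x" "(\<lambda>n. b n *\<^sub>R e n) sums x"
  shows "a = b"
proof
  fix n
  have "(\<lambda>n. (a n - b n) *\<^sub>R e n) sums 0"
    using sums_diff[OF assms] by (simp add: scaleR_diff_left)
  from coefficient_le_sums[OF this, of n] show "a n = b n" by simp
qed

lemma expansion_exists: "\<exists>a. (\<lambda>n. a n *\<^sub>R e n) sums x"
proof -
  have "\<exists>k a. norm ((\<Sum>n<k. a n *\<^sub>R e n) - x) < \<epsilon>" if "\<epsilon> > 0" for \<epsilon>
  proof -
    have "x \<in> closure (span (range e))" using dense by simp
    then obtain y where y: "y \<in> span (range e)" "dist y x < \<epsilon>"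
      using \<open>\<epsilon> > 0\<close> by (auto simp: closure_approachable)
    then obtain k where "y \<in> span (e ` {..<k})" by (auto simp: span_range_eq_UN_nat)
    then show ?thesis using y(2) by (metis dist_norm span_image_lessThanE)
  qed
  then have "\<forall>i. \<exists>k a. norm ((\<Sum>n<k. a n *\<^sub>R e n) - x) < inverse (Suc i)" by simp
  then obtain k b where b: "\<And>i. norm ((\<Sum>n<k i. b i n *\<^sub>R e n) - x) < inverse (Suc i)"
    by metis
  define c where "c i n = (if n < k i then b i n else 0)" for i n
  have c: "(\<Sum>n<m. c i n *\<^sub>R e n) = (\<Sum>n<k i. b i n *\<^sub>R e n)" if "m \<ge> k i" for i m
    using that by (intro sum.mono_neutral_cong_right) (auto simp: c_def)
  have cx: "norm ((\<Sum>n<m. c i n *\<^sub>R e n) - x) < inverse (Suc i)" if "m \<ge> k i" for i m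
    using b[of i] c[OF that] by simp
  have diff: "norm (\<Sum>n<m. (c i n - c l n) *\<^sub>R e n) \<le> inverse (Suc i) + inverse (Suc l)" for i l m
  proof -
    define m' where "m' = max m (max (k i) (k l))"
    have "norm (\<Sum>n<m. (c i n - c l n) *\<^sub>R e n) \<le> norm (\<Sum>n<m'. (c i n - c l n) *\<^sub>R e n)"
      by (rule partial_sum_mono) (simp add: m'_def)
    also have "\<dots> = norm (((\<Sum>n<m'. c i n *\<^sub>R e n) - x) - ((\<Sum>n<m'. c l n *\<^sub>R e n) - x))"
      by (simp add: scaleR_diff_left sum_subtractf)
    also have "\<dots> \<le> norm ((\<Sum>n<m'. c i n *\<^sub>R e n) - x) + norm ((\<Sum>n<m'. c l n *\<^sub>R e n) - x)"
      by (rule norm_triangle_ineq4)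
    also have "\<dots> \<le> inverse (Suc i) + inverse (Suc l)"
    proof (intro add_mono less_imp_le)
      show "norm ((\<Sum>n<m'. c i n *\<^sub>R e n) - x) < inverse (Suc i)"
        by (rule cx) (simp add: m'_def)
      show "norm ((\<Sum>n<m'. c l n *\<^sub>R e n) - x) < inverse (Suc l)"
        by (rule cx) (simp add: m'_def)
    qed
    finally show ?thesis .
  qed
  have "Cauchy (\<lambda>i. c i n)" for n
  proof (rule metric_CauchyI)
    fix \<epsilon> :: real assume "\<epsilon> > 0"
    then obtain N where N: "inverse (real (Suc N)) < \<epsilon> / 4"
      using reals_Archimedean[of "\<epsilon> / 4"] by auto
    have "dist (c i n) (c l n) < \<epsilon>" if "i \<ge> N" "l \<ge> N" for i l
    proof -
      have "\<bar>c i n - c l n\<bar> \<le> 2 * (inverse (Suc i) + inverse (Suc l))"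
        using coefficient_le[of n "Suc n" "\<lambda>n. c i n - c l n"] diff[where m = "Suc n" and i = i and l = l] by simp
      moreover have "inverse (real (Suc i)) \<le> inverse (Suc N)" "inverse (real (Suc l)) \<le> inverse (Suc N)"
        using that by (auto intro: le_imp_inverse_le)
      ultimately show ?thesis using N unfolding dist_real_def by argo
    qed
    then show "\<exists>M. \<forall>i\<ge>M. \<forall>l\<ge>M. dist (c i n) (c l n) < \<epsilon>" by blast
  qed
  then have "\<forall>n. \<exists>a. (\<lambda>i. c i n) \<longlonglongrightarrow> a"
    by (simp add: Cauchy_convergent_iff convergent_def)
  then obtain a where a: "\<And>n. (\<lambda>i. c i n) \<longlonglongrightarrow> a n" by metis
  have ca: "norm (\<Sum>n<m. (c i n - a n) *\<^sub>R e n) \<le> inverse (Suc i)" for i m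
  proof (rule LIMSEQ_le)
    show "(\<lambda>l. norm (\<Sum>n<m. (c i n - c l n) *\<^sub>R e n)) \<longlonglongrightarrow> norm (\<Sum>n<m. (c i n - a n) *\<^sub>R e n)"
      by (intro tendsto_intros a)
    show "(\<lambda>l. inverse (real (Suc i)) + inverse (real (Suc l))) \<longlonglongrightarrow> inverse (Suc i)"
      using tendsto_add[OF tendsto_const LIMSEQ_inverse_real_of_nat] by simp
  qed (use diff in blast)
  have "(\<lambda>m. \<Sum>n<m. a n *\<^sub>R e n) \<longlonglongrightarrow> x"
  proof (rule LIMSEQ_I)
    fix \<epsilon> :: real assume "\<epsilon> > 0"
    then obtain i where i: "inverse (real (Suc i)) < \<epsilon> / 2"
      using reals_Archimedean[of "\<epsilon> / 2"] by auto
    have "norm ((\<Sum>n<m. a n *\<^sub>R e n) - x) < \<epsilon>" if "m \<ge> k i" for m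
    proof -
      have "(\<Sum>n<m. a n *\<^sub>R e n) - x
          = ((\<Sum>n<m. c i n *\<^sub>R e n) - x) - (\<Sum>n<m. (c i n - a n) *\<^sub>R e n)"
        by (simp add: scaleR_diff_left sum_subtractf)
      also have "norm \<dots> \<le> norm ((\<Sum>n<m. c i n *\<^sub>R e n) - x) + norm (\<Sum>n<m. (c i n - a n) *\<^sub>R e n)"
        by (rule norm_triangle_ineq4)
      also have "\<dots> < inverse (Suc i) + inverse (Suc i)"
        using cx[OF that] ca[of i m] by (rule add_less_le_mono)
      finally show ?thesis using i by simp
    qed
    then show "\<exists>N. \<forall>m\<ge>N. norm ((\<Sum>n<m. a n *\<^sub>R e n) - x) < \<epsilon>" by blast
  qed
  then show ?thesis unfolding sums_def by blast
qed

lemma schauder_basis: "schauder_basis e UNIV"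
  unfolding schauder_basis_def using expansion_exists expansion_unique by blast

definition coef :: "'e \<Rightarrow> nat \<Rightarrow> real" where
  "coef x = (THE a. (\<lambda>n. a n *\<^sub>R e n) sums x)"

lemma coef_sums: "(\<lambda>n. coef x n *\<^sub>R e n) sums x"
proof -
  have "\<exists>!a. (\<lambda>n. a n *\<^sub>R e n) sums x"
    using expansion_exists expansion_unique by blast
  then show ?thesis unfolding coef_def by (rule theI')
qed

lemma coef_eqI: "(\<lambda>n. a n *\<^sub>R e n) sums x \<Longrightarrow> coef x = a"
  using coef_sums expansion_unique by blast

lemma coef_add: "coef (x + y) n = coef x n + coef y n"
  using coef_eqI[of "\<lambda>n. coef x n + coef y n" "x + y"] sums_add[OF coef_sums[of x] coef_sums[of y]]
  by (simp add: scaleR_add_left)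

lemma coef_scale: "coef (c *\<^sub>R x) n = c * coef x n"
  using coef_eqI[of "\<lambda>n. c * coef x n" "c *\<^sub>R x"] sums_scaleR_right[OF coef_sums[of x], of c]
  by simp

lemma coef_bounded_linear: "bounded_linear (\<lambda>x. coef x n)"
  using coefficient_le_sums[OF coef_sums, of _ n]
  by (intro bounded_linear_intro[of _ 2]) (auto simp: coef_add coef_scale mult.commute)

lemma coef_partial_sum: "coef (\<Sum>n<k. a n *\<^sub>R e n) = (\<lambda>n. if n < k then a n else 0)"
proof (rule coef_eqI)
  have "(\<lambda>n. (if n < k then a n else 0) *\<^sub>R e n) sums (\<Sum>n<k. (if n < k then a n else 0) *\<^sub>R e n)"
    by (rule sums_finite) auto
  then show "(\<lambda>n. (if n < k then a n else 0) *\<^sub>R e n) sums (\<Sum>n<k. a n *\<^sub>R e n)" by simp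
qed

lemma coef_e: "coef (e m) n = (if n = m then 1 else 0)"
proof -
  have "e m = (\<Sum>n<Suc m. (if n = m then 1 else 0) *\<^sub>R e n)"
    by (simp add: if_distrib[of "\<lambda>t. t *\<^sub>R _"] cong: if_cong)
  then show ?thesis using coef_partial_sum[of "\<lambda>n. if n = m then 1 else 0" "Suc m"] by auto
qed

lemma linear_eq_on_basis:
  fixes T T' :: "'e \<Rightarrow> 'b::real_normed_vector"
  assumes "bounded_linear T" "bounded_linear T'" "\<And>n. T (e n) = T' (e n)"
  shows "T = T'"
proof
  fix x
  have "(\<lambda>n. coef x n *\<^sub>R T (e n)) sums T x" if "bounded_linear T" for T :: "'e \<Rightarrow> 'b"
    using bounded_linear.sums[OF that coef_sums[of x]]
    by (simp add: linear_scale[OF bounded_linear.linear[OF that]])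
  from this[OF assms(1)] this[OF assms(2)] show "T x = T' x"
    unfolding assms(3) by (rule sums_unique2)
qed

lemma coef_span_ge:
  assumes "v \<in> span (e ` {p..})" "n < p"
  shows "coef v n = 0"
  using assms(1)
proof (induction rule: span_induct_alt)
  case base
  then show ?case using coef_scale[of 0 0] by simp
next
  case (step c x y)
  then show ?case using assms(2) by (auto simp: coef_add coef_scale coef_e)
qed

lemma coef_span_less:
  assumes "u \<in> span (e ` {..<p})" "p \<le> n"
  shows "coef u n = 0"
  using assms(1)
proof (induction rule: span_induct_alt)
  case base
  then show ?case using coef_scale[of 0 0] by simp
next
  case (step c x y)
  then show ?case using assms(2) by (auto simp: coef_add coef_scale coef_e)
qed

lemma norm_prefix_le:
  assumes "u \<in> span (e ` {..<p})" "v \<in> span (e ` {p..})"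
  shows "norm u \<le> norm (u + v)"
proof -
  have "coef v n = 0" if "n < p" for n
    using assms(2) that by (rule coef_span_ge)
  moreover obtain a where a: "u = (\<Sum>n<p. a n *\<^sub>R e n)"
    using assms(1) by (rule span_image_lessThanE)
  ultimately have "(\<Sum>n<p. coef (u + v) n *\<^sub>R e n) = u"
    unfolding a by (simp add: coef_add coef_partial_sum)
  then show ?thesis using partial_sum_le_sums[OF coef_sums[of "u + v"], of p] by simp
qed

end

section \<open>Copies of \<open>c\<^sub>0\<close> spanned by blocks\<close>

lemma infinite_dimensional_kernel:
  fixes f :: "'a::real_normed_vector \<Rightarrow> real"
  assumes Z: "subspace Z" "infinite_dimensional Z" and f: "linear f"
  shows "infinite_dimensional {y \<in> Z. f y = 0}"
  unfolding infinite_dimensional_def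
proof
  assume "\<exists>B. finite B \<and> {y \<in> Z. f y = 0} \<subseteq> span B"
  then obtain B where B: "finite B" "{y \<in> Z. f y = 0} \<subseteq> span B" by blast
  have "\<exists>B'. finite B' \<and> Z \<subseteq> span B'"
  proof (cases "\<exists>y\<in>Z. f y \<noteq> 0")
    case True
    then obtain y where y: "y \<in> Z" "f y \<noteq> 0" by blast
    have "Z \<subseteq> span (insert y B)"
    proof
      fix z assume "z \<in> Z"
      then have "z - (f z / f y) *\<^sub>R y \<in> {y \<in> Z. f y = 0}"
        using Z y by (simp add: subspace_diff subspace_scale linear_diff[OF f] linear_scale[OF f])
      then show "z \<in> span (insert y B)"
        using B(2) unfolding span_breakdown_eq by blast
    qed
    then show ?thesis using B(1) by blast
  qed (use B in blast)
  then show False using Z(2) by (simp add: infinite_dimensional_def)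
qed

lemma c0_bounded: "a \<in> c0 \<Longrightarrow> bdd_above (range (\<lambda>n. \<bar>a n\<bar>))"
proof -
  assume "a \<in> c0"
  then have "Bseq a" by (auto simp: c0_def intro: convergent_imp_Bseq convergentI)
  then show ?thesis unfolding Bseq_def bdd_above_def by auto
qed

lemma abs_le_supnorm: "a \<in> c0 \<Longrightarrow> \<bar>a n\<bar> \<le> supnorm a"
  unfolding supnorm_def by (rule cSUP_upper[OF UNIV_I c0_bounded])

lemma sum_geometric_half: "(\<Sum>i<K. (1/2::real) ^ i) \<le> 2"
  using geometric_sum_less[of "1/2::real" "{..<K}"] by simp

text \<open>In both cases of the construction of \<open>E\<close> the norm satisfies the hypothesis
  \<open>split\<close>; for \<open>X = {0}\<close> it is the ultrametric-type estimate in \<open>c\<^sub>0\<close> with \<open>Q = 0\<close>.\<close>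
locale block_basis_setting = monotone_normalized_basis e
  for e :: "nat \<Rightarrow> 'e::banach" +
  fixes Q :: "'e \<Rightarrow> 'b::real_normed_vector"
  assumes Q: "bounded_linear Q"
    and split: "\<And>p u v. u \<in> span (e ` {..<p}) \<Longrightarrow> v \<in> span (e ` {p..}) \<Longrightarrow>
      norm (u + v) \<le> max (norm u) (norm (Q u) + norm v)"
begin

lemma small_image_vector:
  assumes Y: "closed_subspace Y" "infinite_dimensional Y" "strictly_singular_on Q Y" and "\<epsilon> > 0"
  shows "\<exists>y\<in>Y. norm y = 1 \<and> (\<forall>n<p. coef y n = 0) \<and> norm (Q y) < \<epsilon>"
proof -
  define Z where "Z q = {y \<in> Y. \<forall>n<q. coef y n = 0}" for q :: nat
  have ZSuc: "Z (Suc q) = {y \<in> Z q. coef y q = 0}" for q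
    by (auto simp: Z_def less_Suc_eq)
  have Z: "closed (Z q) \<and> subspace (Z q) \<and> infinite_dimensional (Z q)" for q
  proof (induction q)
    case 0
    show ?case using Y by (simp add: Z_def closed_subspace_def)
  next
    case (Suc q)
    have bl: "bounded_linear (\<lambda>y. coef y q)" by (rule coef_bounded_linear)
    have "closed ({y. coef y q = 0})"
      by (intro closed_Collect_eq linear_continuous_on bl continuous_on_const)
    then have "closed (Z (Suc q))"
      unfolding ZSuc using Suc closed_Int[of "Z q" "{y. coef y q = 0}"] by (simp add: Int_def)
    moreover have "subspace (Z (Suc q))"
      unfolding ZSuc using Suc coef_scale[of 0 0 q]
      by (auto simp: subspace_def coef_add coef_scale)
    moreover have "infinite_dimensional (Z (Suc q))"
      unfolding ZSuc using Suc infinite_dimensional_kernel bounded_linear.linear[OF bl] by blast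
    ultimately show ?case by blast
  qed
  have "Z p \<subseteq> Y" by (auto simp: Z_def)
  then have "\<not> iso_on Q (Z p)"
    using Y(3) Z by (auto simp: strictly_singular_on_def closed_subspace_def)
  then obtain y where y: "y \<in> Z p" "norm (Q y) < \<epsilon> * norm y"
    using \<open>\<epsilon> > 0\<close> unfolding iso_on_def by (meson not_le)
  then have y0: "norm y > 0"
    using \<open>\<epsilon> > 0\<close> by (metis mult_zero_right norm_ge_zero not_less zero_less_norm_iff norm_zero)
  define y' where "y' = (1 / norm y) *\<^sub>R y"
  have "y' \<in> Z p" unfolding y'_def using y(1) Z subspace_scale by blast
  moreover have "norm y' = 1" using y0 by (simp add: y'_def)
  moreover have "norm (Q y') < \<epsilon>"
    using y(2) y0 by (simp add: y'_def linear_scale[OF bounded_linear.linear[OF Q]] field_simps)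
  ultimately show ?thesis by (auto simp: Z_def)
qed

lemma almost_block:
  assumes Y: "closed_subspace Y" "infinite_dimensional Y" "strictly_singular_on Q Y" and \<epsilon>: "\<epsilon> > 0"
  shows "\<exists>y u q. y \<in> Y \<and> norm y = 1 \<and> p < q \<and> u \<in> span (e ` {p..<q}) \<and> norm u \<le> 1 \<and> norm (y - u) < \<epsilon> \<and> norm (Q u) < \<epsilon>"
proof -
  obtain y where y: "y \<in> Y" "norm y = 1" "\<And>n. n < p \<Longrightarrow> coef y n = 0" "norm (Q y) < \<epsilon>"
    using small_image_vector[OF Y \<epsilon>] by blast
  define s where "s q = (\<Sum>n<q. coef y n *\<^sub>R e n)" for q
  have s: "s \<longlonglongrightarrow> y" using coef_sums[of y] by (simp add: sums_def s_def[abs_def])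
  have "(\<lambda>q. norm (y - s q)) \<longlonglongrightarrow> norm (y - y)" by (intro tendsto_intros s)
  then have "\<forall>\<^sub>F q in sequentially. norm (y - s q) < \<epsilon>"
    using \<epsilon> by (intro order_tendstoD(2)) auto
  moreover have "(\<lambda>q. norm (Q (s q))) \<longlonglongrightarrow> norm (Q y)"
    by (intro tendsto_norm bounded_linear.tendsto[OF Q] s)
  then have "\<forall>\<^sub>F q in sequentially. norm (Q (s q)) < \<epsilon>"
    using y(4) by (rule order_tendstoD(2))
  ultimately have "\<forall>\<^sub>F q in sequentially. norm (y - s q) < \<epsilon> \<and> norm (Q (s q)) < \<epsilon> \<and> p < q"
    using eventually_gt_at_top[of p] by eventually_elim auto
  then obtain q where q: "norm (y - s q) < \<epsilon>" "norm (Q (s q)) < \<epsilon>" "p < q"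
    by (auto dest: eventually_happens'[OF sequentially_bot])
  have "s q = (\<Sum>n\<in>{p..<q}. coef y n *\<^sub>R e n)"
    unfolding s_def using y(3) by (intro sum.mono_neutral_right) auto
  then have "s q \<in> span (e ` {p..<q})" by (simp add: sum_in_span_image)
  moreover have "norm (s q) \<le> 1"
    using partial_sum_le_sums[OF coef_sums[of y], of q] y(2) by (simp add: s_def)
  ultimately show ?thesis using y(1,2) q by blast
qed

lemma contains_c0:
  assumes Y: "closed_subspace Y" "infinite_dimensional Y" "strictly_singular_on Q Y"
  shows "contains_c0 Y"
proof -
  define \<delta> where "\<delta> k = (1/2) ^ k / (16::real)" for k :: nat
  have \<delta>: "\<delta> k > 0" for k by (simp add: \<delta>_def)
  have \<delta>_sum: "(\<Sum>i<K. \<delta> i) \<le> 1 / 8" for K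
    using sum_geometric_half[of K] by (simp add: \<delta>_def sum_divide_distrib[symmetric])
  define P where "P k p y u q \<longleftrightarrow> y \<in> Y \<and> norm y = 1 \<and> p < q \<and> u \<in> span (e ` {p..<q}) \<and> norm u \<le> 1 \<and>
      norm (y - u) < \<delta> k \<and> norm (Q u) < \<delta> k" for k p y u q
  have "\<forall>k p. \<exists>y u q. P k p y u q"
    unfolding P_def using almost_block[OF Y \<delta>] by blast
  then obtain fy fu fq where fP: "\<And>k p. P k p (fy k p) (fu k p) (fq k p)"
    unfolding choice_iff by blast
  define p where "p = rec_nat 0 fq"
  have pSuc: "p (Suc k) = fq k (p k)" for k by (simp add: p_def)
  define y where "y k = fy k (p k)" for k
  define u where "u k = fu k (p k)" for k
  have yu: "P k (p k) (y k) (u k) (p (Suc k))" for k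
    unfolding y_def u_def pSuc by (rule fP)
  have yY: "y k \<in> Y" and y1: "norm (y k) = 1" and pS: "p k < p (Suc k)" and us: "u k \<in> span (e ` {p k..<p (Suc k)})"
    and u1: "norm (u k) \<le> 1" and yu_le: "norm (y k - u k) < \<delta> k" and Qu: "norm (Q (u k)) < \<delta> k"
    for k
    using yu[of k] by (auto simp: P_def)
  have u_tail: "a k *\<^sub>R u k \<in> span (e ` {p k..})" for k a
    using us[of k] by (intro span_scale) (rule span_mono[THEN subsetD, rotated], assumption, auto)
  define s where "s a K = (\<Sum>k<K. a k *\<^sub>R u k)" for a K
  have s_span: "s a K \<in> span (e ` {..<p K})" for a K
  proof (induction K)
    case 0
    show ?case by (simp add: s_def span_zero)
  next
    case (Suc K)
    have "s a K \<in> span (e ` {..<p (Suc K)})"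
      using Suc pS[of K] by (rule_tac span_mono[THEN subsetD, rotated]) (auto intro!: image_mono)
    moreover have "u K \<in> span (e ` {..<p (Suc K)})"
      using us[of K] by (rule span_mono[THEN subsetD, rotated]) auto
    ultimately show ?case by (simp add: s_def span_add span_scale)
  qed
  have Qlin: "linear Q" using Q by (rule bounded_linear.linear)
  have upper: "norm (s a K) \<le> 2 * M" if aM: "\<And>k. \<bar>a k\<bar> \<le> M" for a M K
  proof -
    have M0: "M \<ge> 0" using aM[of 0] by linarith
    have QK: "norm (Q (s a K)) \<le> M" for K
    proof -
      have "norm (Q (s a K)) \<le> (\<Sum>k<K. norm (a k *\<^sub>R Q (u k)))"
        unfolding s_def linear_sum[OF Qlin] linear_scale[OF Qlin] by (rule norm_sum)
      also have "\<dots> \<le> (\<Sum>k<K. M * \<delta> k)"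
        using aM Qu by (intro sum_mono) (simp add: mult_mono M0 less_imp_le)
      also have "\<dots> \<le> M * (1 / 8)"
        unfolding sum_distrib_left[symmetric] using \<delta>_sum M0 by (intro mult_left_mono) auto
      finally show ?thesis using M0 by simp
    qed
    show ?thesis
    proof (induction K)
      case 0
      show ?case using M0 by (simp add: s_def)
    next
      case (Suc K)
      have "norm (s a (Suc K)) \<le> max (norm (s a K)) (norm (Q (s a K)) + norm (a K *\<^sub>R u K))"
        using split[OF s_span u_tail, of a K a] by (simp add: s_def)
      moreover have "norm (a K *\<^sub>R u K) \<le> M"
        using mult_mono[OF aM[of K] u1[of K] M0] by simp
      ultimately show ?case using Suc QK[of K] by linarith
    qed
  qed
  have s_mono: "norm (s a K) \<le> norm (s a K')" if "K \<le> K'" for a K K'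
    using that
  proof (induction K' rule: dec_induct)
    case (step K')
    then show ?case
      using norm_prefix_le[OF s_span u_tail, of a K' a] by (simp add: s_def)
  qed simp
  have lower: "(15/32) * \<bar>a k\<bar> \<le> norm (s a K)" if "k < K" for a k K
  proof -
    have "15/16 \<le> norm (u k)"
    proof -
      have "\<delta> k \<le> 1 / 16" by (simp add: \<delta>_def power_le_one)
      then show ?thesis
        using norm_triangle_sub[of "y k" "u k"] y1[of k] yu_le[of k] by linarith
    qed
    then have "15/16 * \<bar>a k\<bar> \<le> norm (a k *\<^sub>R u k)"
      using mult_right_mono[of "15/16" "norm (u k)" "\<bar>a k\<bar>"] by (simp add: mult.commute)
    also have "a k *\<^sub>R u k = s a (Suc k) - s a k" by (simp add: s_def)
    also have "norm \<dots> \<le> norm (s a (Suc k)) + norm (s a k)" by (rule norm_triangle_ineq4)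
    also have "\<dots> \<le> 2 * norm (s a K)"
      using s_mono[of "Suc k" K a] s_mono[of k K a] that by linarith
    finally show ?thesis by simp
  qed
  have diff: "norm ((\<Sum>k<K. a k *\<^sub>R y k) - s a K) \<le> M / 8" if aM: "\<And>k. \<bar>a k\<bar> \<le> M" for a M K
  proof -
    have M0: "M \<ge> 0" using aM[of 0] by linarith
    have "norm ((\<Sum>k<K. a k *\<^sub>R y k) - s a K) = norm (\<Sum>k<K. a k *\<^sub>R (y k - u k))"
      by (simp add: s_def sum_subtractf scaleR_diff_right)
    also have "\<dots> \<le> (\<Sum>k<K. norm (a k *\<^sub>R (y k - u k)))" by (rule norm_sum)
    also have "\<dots> \<le> (\<Sum>k<K. M * \<delta> k)"
      using aM yu_le by (intro sum_mono) (simp add: mult_mono M0 less_imp_le)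
    also have "\<dots> \<le> M * (1 / 8)"
      unfolding sum_distrib_left[symmetric] using \<delta>_sum M0 by (intro mult_left_mono) auto
    finally show ?thesis by simp
  qed
  have upper_y: "norm (\<Sum>k<K. a k *\<^sub>R y k) \<le> 3 * M" if aM: "\<And>k. \<bar>a k\<bar> \<le> M" for a M K
    using diff[of a M K, OF aM] upper[of a M K, OF aM] aM[of 0]
      norm_triangle_sub[of "\<Sum>k<K. a k *\<^sub>R y k" "s a K"] by linarith
  have summ: "summable (\<lambda>k. a k *\<^sub>R y k)" if a: "a \<in> c0" for a
    unfolding summable_Cauchy
  proof (intro allI impI)
    fix \<epsilon> :: real assume "\<epsilon> > 0"
    then obtain N where N: "\<And>n. n \<ge> N \<Longrightarrow> \<bar>a n\<bar> < \<epsilon> / 4"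
      using a LIMSEQ_D[of a 0 "\<epsilon> / 4"] by (auto simp: c0_def)
    have "norm (\<Sum>k\<in>{m..<n}. a k *\<^sub>R y k) < \<epsilon>" if "m \<ge> N" for m n
    proof -
      define b where "b k = (if m \<le> k then a k else 0)" for k
      have "(\<Sum>k\<in>{m..<n}. a k *\<^sub>R y k) = (\<Sum>k<n. b k *\<^sub>R y k)"
        unfolding b_def by (intro sum.mono_neutral_cong_left) auto
      also have "norm \<dots> \<le> 3 * (\<epsilon> / 4)"
      proof (rule upper_y)
        show "\<bar>b k\<bar> \<le> \<epsilon> / 4" for k
          using N[of k] that \<open>\<epsilon> > 0\<close> by (auto simp: b_def)
      qed
      finally show ?thesis using \<open>\<epsilon> > 0\<close> by simp
    qed
    then show "\<exists>N. \<forall>m\<ge>N. \<forall>n. norm (\<Sum>k\<in>{m..<n}. a k *\<^sub>R y k) < \<epsilon>" by blast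
  qed
  define T where "T a = (\<Sum>k. a k *\<^sub>R y k)" for a
  have T: "(\<lambda>K. \<Sum>k<K. a k *\<^sub>R y k) \<longlonglongrightarrow> T a" if "a \<in> c0" for a
    unfolding T_def using summable_LIMSEQ[OF summ[OF that]] .
  have sY: "subspace Y" and cY: "closed Y" using Y(1) by (auto simp: closed_subspace_def)
  show ?thesis
    unfolding contains_c0_def
  proof (intro exI[of _ T] conjI ballI allI)
    show "T a \<in> Y" if "a \<in> c0" for a
    proof (rule closed_sequentially[OF cY _ T[OF that]])
      show "(\<Sum>k<K. a k *\<^sub>R y k) \<in> Y" for K
        using yY sY by (intro subspace_sum subspace_scale)
    qed
    show "T (\<lambda>n. s * a n + t * b n) = s *\<^sub>R T a + t *\<^sub>R T b" if "a \<in> c0" "b \<in> c0" for a b s t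
    proof -
      have "(\<lambda>k. s *\<^sub>R a k *\<^sub>R y k + t *\<^sub>R b k *\<^sub>R y k) sums (s *\<^sub>R T a + t *\<^sub>R T b)"
        using T that by (intro sums_add sums_scaleR_right) (auto simp: sums_def)
      then show ?thesis
        unfolding T_def by (simp add: sums_iff scaleR_add_left)
    qed
    show "\<exists>c C. 0 < c \<and> (\<forall>a\<in>c0. c * supnorm a \<le> norm (T a) \<and> norm (T a) \<le> C * supnorm a)"
    proof (rule exI[of _ "1/4"], rule exI[of _ 3], intro conjI ballI)
      fix a assume a: "a \<in> c0"
      note aM = abs_le_supnorm[OF a]
      show "norm (T a) \<le> 3 * supnorm a"
        using upper_y[of a "supnorm a", OF aM] by (intro LIMSEQ_le_const2[OF tendsto_norm[OF T[OF a]]]) auto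
      have low: "(15/32) * \<bar>a k\<bar> - supnorm a / 8 \<le> norm (T a)" for k
      proof (rule LIMSEQ_le_const[OF tendsto_norm[OF T[OF a]]])
        have "(15/32) * \<bar>a k\<bar> - supnorm a / 8 \<le> norm (\<Sum>k<K. a k *\<^sub>R y k)" if "K \<ge> Suc k" for K
          using lower[where a = a and k = k and K = K] that diff[of a "supnorm a" K, OF aM]
            norm_triangle_sub[of "s a K" "\<Sum>k<K. a k *\<^sub>R y k"] norm_minus_commute[of "s a K" "\<Sum>k<K. a k *\<^sub>R y k"]
          by linarith
        then show "\<exists>N. \<forall>K\<ge>N. (15/32) * \<bar>a k\<bar> - supnorm a / 8 \<le> norm (\<Sum>k<K. a k *\<^sub>R y k)" by blast
      qed
      have "\<bar>a k\<bar> \<le> (32/15) * (norm (T a) + supnorm a / 8)" for k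
        using low[of k] by argo
      then have "supnorm a \<le> (32/15) * (norm (T a) + supnorm a / 8)"
        unfolding supnorm_def by (intro cSUP_least) auto
      moreover have "supnorm a \<ge> 0" using aM[of 0] by linarith
      ultimately show "1/4 * supnorm a \<le> norm (T a)" by argo
    qed simp
  qed
qed

end

section \<open>The Cantor space and the Baire space\<close>

definition cyl :: "nat \<Rightarrow> (nat \<Rightarrow> 'a) \<Rightarrow> (nat \<Rightarrow> 'a) set" where
  "cyl N x = {y. \<forall>i<N. y i = x i}"

lemma open_cyl: "open (cyl N (x :: nat \<Rightarrow> 'a::discrete_topology))"
  using product_topology_basis'[of "{..<N}" "\<lambda>i. {x i}" "\<lambda>i. i"]
  unfolding cyl_def by (simp add: open_discrete Ball_def)

lemma self_in_cyl: "x \<in> cyl N x"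
  by (simp add: cyl_def)

lemma open_contains_cyl:
  fixes x :: "nat \<Rightarrow> 'a::discrete_topology"
  assumes "open U" "x \<in> U"
  obtains N where "cyl N x \<subseteq> U"
proof -
  have "openin (product_topology (\<lambda>i. euclidean) UNIV) U"
    using assms(1) by (simp add: euclidean_product_topology)
  then obtain X where X: "x \<in> Pi\<^sub>E UNIV X" "finite {i. X i \<noteq> UNIV}" "Pi\<^sub>E UNIV X \<subseteq> U"
    using product_topology_open_contains_basis[of "\<lambda>i. euclidean" UNIV U x] assms(2) by auto
  define N where "N = Suc (Max (insert 0 {i. X i \<noteq> UNIV}))"
  have "i < N" if "X i \<noteq> UNIV" for i
    using that X(2) by (auto simp: N_def less_Suc_eq_le intro: Max_ge)
  then have "cyl N x \<subseteq> Pi\<^sub>E UNIV X"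
    using X(1) by (auto simp: cyl_def PiE_iff) (metis UNIV_I)
  then show thesis using that X(3) by blast
qed

lemma compact_Cantor: "compact (UNIV :: (nat \<Rightarrow> bool) set)"
proof -
  have bool: "compact_space (euclidean :: bool topology)"
    by (simp add: compact_space_def compactin_euclidean_iff finite_imp_compact)
  have "compact_space (product_topology (\<lambda>i::nat. (euclidean :: bool topology)) UNIV)"
    unfolding compact_space_product_topology using bool by blast
  then show ?thesis
    unfolding euclidean_product_topology compact_space_def by (simp only: topspace_euclidean compactin_euclidean_iff)
qed

lemma locally_constant_continuous:
  assumes "\<And>x. \<exists>U. open U \<and> x \<in> U \<and> (\<forall>y\<in>U. f y = f x)"
  shows "continuous_on UNIV f"
  unfolding continuous_on_def
proof
  fix x
  obtain U where "open U" "x \<in> U" "\<forall>y\<in>U. f y = f x" using assms by blast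
  then have "\<forall>\<^sub>F y in at x. f y = f x"
    unfolding eventually_at_topological by blast
  then show "(f \<longlongrightarrow> f x) (at x)" by (rule tendsto_eventually)
qed

lemma truncation_uniform:
  fixes f :: "(nat \<Rightarrow> bool) \<Rightarrow>\<^sub>C real"
  assumes "\<epsilon> > 0"
  obtains N where "\<And>y. \<bar>f y - f (\<lambda>i. i < N \<and> y i)\<bar> < \<epsilon>"
proof -
  have "\<exists>N. \<forall>y\<in>cyl N x. \<bar>f y - f x\<bar> < \<epsilon> / 2" for x
  proof -
    have "open (apply_bcontfun f -` ball (f x) (\<epsilon> / 2))"
      by (intro open_vimage continuous_on_apply_bcontfun) auto
    moreover have "x \<in> apply_bcontfun f -` ball (f x) (\<epsilon> / 2)" using assms by simp
    ultimately obtain N where "cyl N x \<subseteq> apply_bcontfun f -` ball (f x) (\<epsilon> / 2)"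
      by (rule open_contains_cyl)
    then show ?thesis by (intro exI[of _ N]) (auto simp: dist_real_def abs_minus_commute)
  qed
  then obtain N where N: "\<And>x y. y \<in> cyl (N x) x \<Longrightarrow> \<bar>f y - f x\<bar> < \<epsilon> / 2" by metis
  obtain F where F: "finite F" "UNIV \<subseteq> (\<Union>x\<in>F. cyl (N x) x)"
    using compactE_image[OF compact_Cantor, of UNIV "\<lambda>x. cyl (N x) x"] open_cyl self_in_cyl
    by (metis (no_types, lifting) UNIV_I UN_iff subsetI)
  define M where "M = Max (N ` F)"
  have "\<bar>f y - f (\<lambda>i. i < M \<and> y i)\<bar> < \<epsilon>" for y
  proof -
    obtain x where x: "x \<in> F" "y \<in> cyl (N x) x" using F(2) by blast
    have "N x \<le> M" unfolding M_def using F(1) x(1) by simp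
    then have "(\<lambda>i. i < M \<and> y i) \<in> cyl (N x) x"
      using x(2) by (auto simp: cyl_def)
    from N[OF this] N[OF x(2)] show ?thesis by linarith
  qed
  then show thesis using that by blast
qed

lemma C2N_separable:
  obtains D :: "C2N set" where "countable D" "closure D = UNIV"
proof -
  define \<phi> where "\<phi> N h = (\<lambda>y::nat \<Rightarrow> bool. h {i \<in> {..<N}. y i} :: real)" for N :: nat and h
  have \<phi>: "\<phi> N h \<in> bcontfun" for N h
  proof -
    have "continuous_on UNIV (\<phi> N h)"
    proof (rule locally_constant_continuous)
      fix x
      have "\<phi> N h y = \<phi> N h x" if "y \<in> cyl N x" for y
        using that unfolding \<phi>_def cyl_def by (intro arg_cong[of _ _ h]) auto
      then show "\<exists>U. open U \<and> x \<in> U \<and> (\<forall>y\<in>U. \<phi> N h y = \<phi> N h x)"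
        by (intro exI[of _ "cyl N x"] conjI ballI open_cyl self_in_cyl)
    qed
    moreover have "range (\<phi> N h) \<subseteq> h ` Pow {..<N}" by (auto simp: \<phi>_def)
    then have "finite (range (\<phi> N h))" by (rule finite_subset) simp
    ultimately show ?thesis by (simp add: bcontfun_def finite_imp_bounded)
  qed
  define D where "D = (\<Union>N. (\<lambda>h. Bcontfun (\<phi> N h)) ` PiE (Pow {..<N}) (\<lambda>_. \<rat>))"
  have "countable D"
    unfolding D_def by (intro countable_UN countable_image countable_PiE) (auto simp: countable_rat)
  moreover have "f \<in> closure D" for f
    unfolding closure_approachable
  proof (intro allI impI)
    fix \<epsilon> :: real assume \<epsilon>: "\<epsilon> > 0"
    obtain N where N: "\<And>y. \<bar>f y - f (\<lambda>i. i < N \<and> y i)\<bar> < \<epsilon> / 4"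
      using truncation_uniform[of "\<epsilon> / 4"] \<epsilon> by auto
    have "\<exists>q\<in>\<rat>. \<bar>q - f (\<lambda>i. i \<in> s)\<bar> < \<epsilon> / 4" for s
    proof -
      obtain q where "q \<in> \<rat>" "f (\<lambda>i. i \<in> s) - \<epsilon> / 4 < q" "q < f (\<lambda>i. i \<in> s) + \<epsilon> / 4"
        using Rats_dense_in_real[of "f (\<lambda>i. i \<in> s) - \<epsilon> / 4" "f (\<lambda>i. i \<in> s) + \<epsilon> / 4"] \<epsilon> by auto
      moreover from this have "\<bar>q - f (\<lambda>i. i \<in> s)\<bar> < \<epsilon> / 4" by linarith
      ultimately show ?thesis by blast
    qed
    then obtain q where q: "\<And>s. q s \<in> \<rat>" "\<And>s. \<bar>q s - f (\<lambda>i. i \<in> s)\<bar> < \<epsilon> / 4" by metis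
    define h where "h = restrict q (Pow {..<N})"
    have "Bcontfun (\<phi> N h) \<in> D"
      unfolding D_def h_def using q(1) by (intro UN_I[of N] imageI) (auto simp: PiE_def extensional_def)
    moreover have "dist (Bcontfun (\<phi> N h)) f \<le> \<epsilon> / 2"
    proof (rule dist_bound)
      fix y
      define s where "s = {i \<in> {..<N}. y i}"
      have "\<phi> N h y = q s" by (auto simp: \<phi>_def h_def s_def)
      moreover have s: "(\<lambda>i. i \<in> s) = (\<lambda>i. i < N \<and> y i)" by (auto simp: s_def)
      have "\<bar>q s - f y\<bar> \<le> \<epsilon> / 2"
        using q(2)[of s] N[of y] unfolding s by linarith
      ultimately have "\<bar>\<phi> N h y - f y\<bar> \<le> \<epsilon> / 2" by simp
      then show "dist (Bcontfun (\<phi> N h) y) (f y) \<le> \<epsilon> / 2"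
        by (simp add: Bcontfun_inverse[OF \<phi>] dist_real_def)
    qed
    ultimately show "\<exists>y\<in>D. dist y f < \<epsilon>" using \<epsilon> by force
  qed
  ultimately show thesis using that by blast
qed

lemma sum_power_half_le: "(\<Sum>i\<in>{m..<n}. (1/2::real) ^ i) \<le> 2 * (1/2) ^ m"
proof (cases "m \<le> n")
  case True
  then have "(\<Sum>i\<in>{m..<n}. (1/2::real) ^ i) = 2 * (1/2) ^ m - 2 * (1/2) ^ n"
    by (induction n rule: dec_induct) simp_all
  then show ?thesis by simp
qed auto

lemma Baire_space_continuous_surjection:
  fixes D :: "'b::real_normed_vector set"
  assumes complete: "complete (UNIV :: 'b set)" and D: "countable D" "closure D = UNIV"
  obtains \<phi> :: "(nat \<Rightarrow> nat) \<Rightarrow> 'b" where "continuous_on UNIV \<phi>" "surj \<phi>"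
proof -
  have "D \<noteq> {}" using D(2) by auto
  define d where "d = from_nat_into D"
  have d: "\<exists>k. norm (x - d k) < \<epsilon>" if \<epsilon>: "\<epsilon> > 0" for x \<epsilon>
  proof -
    have "x \<in> closure D" using D(2) by simp
    then obtain y where y: "y \<in> D" "dist y x < \<epsilon>" using \<epsilon> unfolding closure_approachable by blast
    then obtain k where "y = d k"
      using range_from_nat_into[OF \<open>D \<noteq> {}\<close> D(1)] by (auto simp: d_def)
    then show ?thesis using y(2) by (auto simp: dist_norm norm_minus_commute)
  qed
  define c where "c i k = (if i = 0 \<or> norm (d k) \<le> 2 * (1/2) ^ i then d k else 0)" for i k :: nat
  have c_le: "norm (c i k) \<le> 2 * (1/2) ^ i" if "i > 0" for i k
    using that by (simp add: c_def)
  define s where "s m \<alpha> = (\<Sum>i<m. c i (\<alpha> i))" for m and \<alpha> :: "nat \<Rightarrow> nat"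
  have s_diff: "norm (s n \<alpha> - s m \<alpha>) \<le> 4 * (1/2) ^ m" if "0 < m" "m \<le> n" for m n \<alpha>
  proof -
    have "s n \<alpha> - s m \<alpha> = (\<Sum>i\<in>{m..<n}. c i (\<alpha> i))"
      unfolding s_def using that sum_diff_nat_ivl[of 0 m n "\<lambda>i. c i (\<alpha> i)"] by (simp add: lessThan_atLeast0)
    also have "norm \<dots> \<le> (\<Sum>i\<in>{m..<n}. 2 * (1/2) ^ i)"
      using c_le that by (intro sum_norm_le) auto
    also have "\<dots> \<le> 4 * (1/2) ^ m"
      using sum_power_half_le[of m n] by (simp add: sum_distrib_left[symmetric])
    finally show ?thesis .
  qed
  have small: "\<exists>m>0. 4 * (1/2) ^ m < \<epsilon>" if \<epsilon>: "\<epsilon> > 0" for \<epsilon> :: real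
  proof -
    obtain m where m: "(1/2) ^ m < \<epsilon> / 4"
      using real_arch_pow_inv[of "\<epsilon> / 4" "1/2"] \<epsilon> by auto
    have "(0::real) < (1/2) ^ m" by simp
    then show ?thesis using m by (intro exI[of _ "Suc m"] conjI) (simp, unfold power_Suc, linarith)
  qed
  have "\<exists>l. (\<lambda>m. s m \<alpha>) \<longlonglongrightarrow> l" for \<alpha>
  proof -
    have "Cauchy (\<lambda>m. s m \<alpha>)"
    proof (rule CauchyI')
      fix \<epsilon> :: real assume "\<epsilon> > 0"
      then obtain m where m: "m > 0" "4 * (1/2) ^ m < \<epsilon> / 2" using small[of "\<epsilon> / 2"] by auto
      have "norm (s k \<alpha> - s n \<alpha>) < \<epsilon>" if "k \<ge> m" "n > k" for k n
        using norm_triangle_ineq4[of "s k \<alpha> - s m \<alpha>" "s n \<alpha> - s m \<alpha>"]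
          s_diff[of m k \<alpha>] s_diff[of m n \<alpha>] m that by simp
      then show "\<exists>M. \<forall>k\<ge>M. \<forall>n>k. dist (s k \<alpha>) (s n \<alpha>) < \<epsilon>"
        unfolding dist_norm by blast
    qed
    then show ?thesis using complete unfolding complete_def by blast
  qed
  then obtain \<phi> where \<phi>: "\<And>\<alpha>. (\<lambda>m. s m \<alpha>) \<longlonglongrightarrow> \<phi> \<alpha>" by metis
  have \<phi>_le: "norm (\<phi> \<alpha> - s m \<alpha>) \<le> 4 * (1/2) ^ m" if "m > 0" for m \<alpha>
  proof (rule LIMSEQ_le_const2)
    show "(\<lambda>n. norm (s n \<alpha> - s m \<alpha>)) \<longlonglongrightarrow> norm (\<phi> \<alpha> - s m \<alpha>)"
      by (intro tendsto_intros \<phi>)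
  qed (use s_diff that in blast)
  have "continuous_on UNIV \<phi>"
  proof (rule uniform_limit_theorem)
    show "\<forall>\<^sub>F m in sequentially. continuous_on UNIV (s m)"
    proof (intro always_eventually allI locally_constant_continuous)
      fix m \<alpha>
      have "s m \<beta> = s m \<alpha>" if "\<beta> \<in> cyl m \<alpha>" for \<beta>
        using that by (auto simp: s_def cyl_def intro!: sum.cong)
      then show "\<exists>U. open U \<and> \<alpha> \<in> U \<and> (\<forall>\<beta>\<in>U. s m \<beta> = s m \<alpha>)"
        by (intro exI[of _ "cyl m \<alpha>"] conjI ballI open_cyl self_in_cyl)
    qed
    show "uniform_limit UNIV s \<phi> sequentially"
    proof (rule uniform_limitI)
      fix \<epsilon> :: real assume "\<epsilon> > 0"
      then obtain m where m: "m > 0" "4 * (1/2) ^ m < \<epsilon>" using small by auto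
      have "dist (s n \<alpha>) (\<phi> \<alpha>) < \<epsilon>" if "n \<ge> m" for n \<alpha>
      proof -
        have "(1/2::real) ^ n \<le> (1/2) ^ m" using that by (intro power_decreasing) auto
        moreover have "norm (\<phi> \<alpha> - s n \<alpha>) \<le> 4 * (1/2) ^ n" using \<phi>_le that m(1) by simp
        ultimately show ?thesis using m(2) unfolding dist_norm norm_minus_commute[of "s n \<alpha>"] by linarith
      qed
      then show "\<forall>\<^sub>F n in sequentially. \<forall>\<alpha>\<in>UNIV. dist (s n \<alpha>) (\<phi> \<alpha>) < \<epsilon>"
        unfolding eventually_sequentially by blast
    qed
  qed simp
  moreover have "\<exists>\<alpha>. x = \<phi> \<alpha>" for x
  proof -
    have "\<forall>m y. \<exists>k. norm (y - d k) < (1/2) ^ Suc m"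
      by (intro allI d zero_less_power) simp
    then obtain k where k: "\<And>m y. norm (y - d (k m y)) < (1/2) ^ Suc m" by metis
    define r where "r = rec_nat x (\<lambda>m y. y - d (k m y))"
    have r0: "r 0 = x" and rS: "r (Suc m) = r m - d (k m (r m))" for m
      by (simp_all add: r_def)
    define \<alpha> where "\<alpha> m = k m (r m)" for m
    have r_le: "norm (r (Suc m)) < (1/2) ^ Suc m" for m
      unfolding rS by (rule k)
    have "c m (\<alpha> m) = d (\<alpha> m)" for m
    proof (cases m)
      case (Suc n)
      have "d (\<alpha> m) = r m - r (Suc m)" by (simp add: rS \<alpha>_def)
      then have "norm (d (\<alpha> m)) \<le> norm (r m) + norm (r (Suc m))" by (metis norm_triangle_ineq4)
      also have "\<dots> \<le> (1/2) ^ m + (1/2) ^ Suc m"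
        using r_le[of n] r_le[of m] Suc by (intro add_mono) auto
      also have "\<dots> \<le> 2 * (1/2) ^ m" by simp
      finally show ?thesis by (simp add: c_def)
    qed (simp add: c_def)
    then have s_eq: "s m \<alpha> = x - r m" for m
      by (induction m) (simp_all add: s_def r0 rS \<alpha>_def)
    have "r \<longlonglongrightarrow> 0"
    proof (rule LIMSEQ_imp_Suc, rule Lim_null_comparison)
      show "\<forall>\<^sub>F m in sequentially. norm (r (Suc m)) \<le> (1/2) ^ Suc m"
        by (intro always_eventually allI less_imp_le r_le)
      show "(\<lambda>m. (1/2::real) ^ Suc m) \<longlonglongrightarrow> 0"
        using LIMSEQ_power_zero[of "1/2::real"] by (intro LIMSEQ_Suc) auto
    qed
    then have "(\<lambda>m. s m \<alpha>) \<longlonglongrightarrow> x - 0"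
      unfolding s_eq by (intro tendsto_diff tendsto_const)
    then have "x = \<phi> \<alpha>"
      using LIMSEQ_unique[OF \<phi>[of \<alpha>]] by simp
    then show ?thesis by blast
  qed
  then have "surj \<phi>" unfolding surj_def by blast
  ultimately show thesis by (rule that)
qed

section \<open>The norm of \<open>E\<^sub>X\<close>\<close>

definition trunc :: "nat \<Rightarrow> (nat \<Rightarrow> real) \<Rightarrow> nat \<Rightarrow> real" where
  "trunc k a = (\<lambda>n. if n < k then a n else 0)"

lemma trunc_c00: "trunc k a \<in> c00"
  by (auto simp: c00_def trunc_def intro: finite_subset[of _ "{..<k}"])

lemma c00_eq_trunc:
  assumes "z \<in> c00"
  obtains k where "z = trunc k z"
proof -
  obtain k where "{n. z n \<noteq> 0} \<subseteq> {..<k}"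
    using assms finite_nat_bounded by (auto simp: c00_def)
  then have "z = trunc k z" by (auto simp: trunc_def fun_eq_iff)
  then show thesis by (rule that)
qed

definition EX_part :: "(nat \<Rightarrow> C2N set \<Rightarrow> C2N) \<Rightarrow> C2N set \<Rightarrow> (nat \<Rightarrow> real) \<Rightarrow> nat \<Rightarrow> real" where
  "EX_part S Z z m = (if Z = {0} then \<bar>z m\<bar> else norm (\<Sum>n\<le>m. z n *\<^sub>R S n Z))"

lemma EX_norm_eq_SUP: "EX_norm S Z z = (SUP m. EX_part S Z z m)"
  by (simp add: EX_norm_def EX_part_def)

lemma EX_part_lipschitz:
  assumes S: "\<And>n. Z \<noteq> {0} \<Longrightarrow> norm (S n Z) = 1"
    and I: "finite I" "\<And>n. n \<notin> I \<Longrightarrow> z n = w n"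
  shows "EX_part S Z z m \<le> EX_part S Z w m + (\<Sum>n\<in>I. \<bar>z n - w n\<bar>)"
proof (cases "Z = {0}")
  case True
  have "\<bar>z m - w m\<bar> \<le> (\<Sum>n\<in>I. \<bar>z n - w n\<bar>)"
  proof (cases "m \<in> I")
    case True
    then show ?thesis using I(1) by (intro member_le_sum) auto
  qed (simp add: I(2) sum_nonneg)
  then show ?thesis using True by (simp add: EX_part_def)
next
  case False
  have "norm ((\<Sum>n\<le>m. z n *\<^sub>R S n Z) - (\<Sum>n\<le>m. w n *\<^sub>R S n Z))
      = norm (\<Sum>n\<le>m. (z n - w n) *\<^sub>R S n Z)"
    by (simp add: sum_subtractf scaleR_diff_left)
  also have "\<dots> \<le> (\<Sum>n\<le>m. norm ((z n - w n) *\<^sub>R S n Z))" by (rule norm_sum)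
  also have "\<dots> = (\<Sum>n\<le>m. \<bar>z n - w n\<bar>)" using S False by simp
  also have "\<dots> = (\<Sum>n\<in>{..m} \<inter> I. \<bar>z n - w n\<bar>)"
    using I(2) by (intro sum.mono_neutral_right) auto
  also have "\<dots> \<le> (\<Sum>n\<in>I. \<bar>z n - w n\<bar>)" using I(1) by (intro sum_mono2) auto
  finally show ?thesis
    using False norm_triangle_sub[of "\<Sum>n\<le>m. z n *\<^sub>R S n Z" "\<Sum>n\<le>m. w n *\<^sub>R S n Z"]
    by (simp add: EX_part_def)
qed

lemma EX_part_zero: "EX_part S Z (\<lambda>_. 0) m = 0"
  by (simp add: EX_part_def)

lemma EX_part_nonneg: "0 \<le> EX_part S Z z m"
  by (simp add: EX_part_def)

lemma EX_part_bounded: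
  assumes "\<And>n. Z \<noteq> {0} \<Longrightarrow> norm (S n Z) = 1" "z \<in> c00"
  shows "bdd_above (range (EX_part S Z z))"
proof -
  obtain I where I: "finite I" "\<And>n. n \<notin> I \<Longrightarrow> z n = 0"
    using assms(2) by (auto simp: c00_def)
  then have "EX_part S Z z m \<le> (\<Sum>n\<in>I. \<bar>z n\<bar>)" for m
    using EX_part_lipschitz[of Z S I z "\<lambda>_. 0" m] assms(1) by (simp add: EX_part_zero)
  then show ?thesis by (auto simp: bdd_above_def)
qed

lemma EX_part_le_EX_norm:
  assumes "\<And>n. Z \<noteq> {0} \<Longrightarrow> norm (S n Z) = 1" "z \<in> c00"
  shows "EX_part S Z z m \<le> EX_norm S Z z"
  unfolding EX_norm_eq_SUP by (rule cSUP_upper[OF UNIV_I EX_part_bounded]) (use assms in auto)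

lemma EX_norm_least: "(\<And>m. EX_part S Z z m \<le> B) \<Longrightarrow> EX_norm S Z z \<le> B"
  unfolding EX_norm_eq_SUP by (rule cSUP_least) auto

lemma EX_norm_lipschitz:
  assumes S: "\<And>n. Z \<noteq> {0} \<Longrightarrow> norm (S n Z) = 1" and c00: "z \<in> c00" "w \<in> c00"
    and I: "finite I" "\<And>n. n \<notin> I \<Longrightarrow> z n = w n"
  shows "\<bar>EX_norm S Z z - EX_norm S Z w\<bar> \<le> (\<Sum>n\<in>I. \<bar>z n - w n\<bar>)"
proof -
  have *: "EX_norm S Z z \<le> EX_norm S Z w + (\<Sum>n\<in>I. \<bar>z n - w n\<bar>)"
    if zw: "\<And>n. n \<notin> I \<Longrightarrow> z n = w n" and w: "w \<in> c00" for z w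
  proof (rule EX_norm_least)
    show "EX_part S Z z m \<le> EX_norm S Z w + (\<Sum>n\<in>I. \<bar>z n - w n\<bar>)" for m
      using EX_part_lipschitz[of Z S I z w m] EX_part_le_EX_norm[of Z S w m] S I(1) zw w by fastforce
  qed
  have "(\<Sum>n\<in>I. \<bar>w n - z n\<bar>) = (\<Sum>n\<in>I. \<bar>z n - w n\<bar>)"
    by (simp add: abs_minus_commute)
  moreover have "EX_norm S Z z \<le> EX_norm S Z w + (\<Sum>n\<in>I. \<bar>z n - w n\<bar>)"
    using I(2) c00(2) by (rule *)
  moreover have "EX_norm S Z w \<le> EX_norm S Z z + (\<Sum>n\<in>I. \<bar>w n - z n\<bar>)"
    using I(2)[symmetric] c00(1) by (rule *)
  ultimately show ?thesis by linarith
qed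

lemma EX_part_trunc:
  "EX_part S Z (trunc k a) m = 0 \<or> (\<exists>l. EX_part S Z (trunc k a) m = EX_part S Z a l)"
proof (cases "Z = {0}")
  case Z: True
  show ?thesis
  proof (cases "m < k")
    case True
    then show ?thesis by (intro disjI2 exI[of _ m]) (simp add: EX_part_def trunc_def)
  next
    case False
    then show ?thesis using Z by (simp add: EX_part_def trunc_def)
  qed
next
  case Z: False
  show ?thesis
  proof (cases k)
    case 0
    then show ?thesis by (simp add: EX_part_def trunc_def)
  next
    case (Suc k')
    have "(\<Sum>n\<le>m. trunc k a n *\<^sub>R S n Z) = (\<Sum>n\<le>min m k'. a n *\<^sub>R S n Z)"
      using Suc by (intro sum.mono_neutral_cong_right) (auto simp: trunc_def)
    then show ?thesis using Z by (auto simp: EX_part_def)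
  qed
qed

lemma completion_linear:
  assumes "is_completion N i E" "z \<in> c00" "w \<in> c00"
  shows "i (\<lambda>n. s * z n + t * w n) = s *\<^sub>R i z + t *\<^sub>R i w"
  using assms unfolding is_completion_def by blast

lemma completion_trunc:
  assumes "is_completion N i E"
  shows "i (trunc k a) = (\<Sum>n<k. a n *\<^sub>R i (unitvec n))"
proof (induction k)
  case 0
  have "(\<lambda>_. 0) \<in> c00" by (simp add: c00_def)
  from completion_linear[OF assms this this, of 0 0] have "i (\<lambda>_. 0) = 0" by simp
  then show ?case by (simp add: trunc_def)
next
  case (Suc k)
  have "unitvec k \<in> c00" by (auto simp: c00_def unitvec_def)
  note completion_linear[OF assms trunc_c00[of k a] this, of 1 "a k"]
  moreover have "(\<lambda>n. 1 * trunc k a n + a k * unitvec k n) = trunc (Suc k) a"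
    by (auto simp: trunc_def unitvec_def fun_eq_iff less_Suc_eq)
  ultimately show ?case using Suc by simp
qed

lemma completion_norm:
  assumes "is_completion N i E"
  shows "norm (\<Sum>n<k. a n *\<^sub>R i (unitvec n)) = N (trunc k a)"
  using assms trunc_c00[of k a] unfolding completion_trunc[OF assms, of k a, symmetric] is_completion_def by blast

lemma completion_image_c00:
  assumes "is_completion N i E"
  shows "i ` c00 = span (range (\<lambda>n. i (unitvec n)))"
proof
  show "i ` c00 \<subseteq> span (range (\<lambda>n. i (unitvec n)))"
  proof
    fix x assume "x \<in> i ` c00"
    then obtain z where z: "z \<in> c00" "x = i z" by blast
    obtain k where "z = trunc k z" using z(1) by (rule c00_eq_trunc)
    then have "x = (\<Sum>n<k. z n *\<^sub>R i (unitvec n))"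
      using z(2) completion_trunc[OF assms, of k z] by simp
    then show "x \<in> span (range (\<lambda>n. i (unitvec n)))"
      by (simp add: span_sum span_scale span_base)
  qed
  have "subspace (i ` c00)"
  proof -
    note lin = completion_linear[OF assms]
    have mem: "(\<lambda>n. s * z n + t * w n) \<in> c00" if "z \<in> c00" "w \<in> c00" for z w and s t :: real
    proof -
      have "{n. s * z n + t * w n \<noteq> 0} \<subseteq> {n. z n \<noteq> 0} \<union> {n. w n \<noteq> 0}" by auto
      then show ?thesis using that by (auto simp: c00_def intro: finite_subset)
    qed
    have comb: "s *\<^sub>R x + t *\<^sub>R y \<in> i ` c00" if xy: "x \<in> i ` c00" "y \<in> i ` c00" for x y s t
    proof -
      obtain z w where zw: "z \<in> c00" "w \<in> c00" "x = i z" "y = i w" using xy by blast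
      have "s *\<^sub>R x + t *\<^sub>R y = i (\<lambda>n. s * z n + t * w n)"
        unfolding zw by (rule lin[OF zw(1,2), symmetric])
      then show ?thesis using mem[OF zw(1,2)] by (rule image_eqI)
    qed
    have "unitvec 0 \<in> c00" by (auto simp: c00_def unitvec_def)
    then have "i (unitvec 0) \<in> i ` c00" by (rule imageI)
    from comb[OF this this, of 0 0] have "0 \<in> i ` c00" by simp
    moreover have "x + y \<in> i ` c00" if "x \<in> i ` c00" "y \<in> i ` c00" for x y
      using comb[OF that, of 1 1] by simp
    moreover have "c *\<^sub>R x \<in> i ` c00" if "x \<in> i ` c00" for x c
      using comb[OF that that, of c 0] by simp
    ultimately show ?thesis by (simp add: subspace_def)
  qed
  moreover have "range (\<lambda>n. i (unitvec n)) \<subseteq> i ` c00"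
    by (auto simp: c00_def unitvec_def)
  ultimately show "span (range (\<lambda>n. i (unitvec n))) \<subseteq> i ` c00"
    by (simp add: span_minimal)
qed

section \<open>The quotient map\<close>

lemma complete_bcontfun:
  "complete (UNIV :: ('a::topological_space \<Rightarrow>\<^sub>C 'b::banach) set)"
proof (rule completeI)
  fix f :: "nat \<Rightarrow> 'a \<Rightarrow>\<^sub>C 'b"
  assume C: "Cauchy f"
  have "uniformly_Cauchy_on UNIV (\<lambda>n. apply_bcontfun (f n))"
  proof (rule uniformly_Cauchy_onI)
    fix e :: real assume "e > 0"
    then obtain M where "\<And>m n. m \<ge> M \<Longrightarrow> n \<ge> M \<Longrightarrow> dist (f m) (f n) < e"
      using C by (meson Cauchy_def)
    then show "\<exists>M. \<forall>x\<in>UNIV. \<forall>m\<ge>M. \<forall>n\<ge>M. dist (f m x) (f n x) < e"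
      using dist_fun_lt_imp_dist_val_lt by blast
  qed
  then obtain g where g: "uniform_limit UNIV (\<lambda>n. apply_bcontfun (f n)) g sequentially"
    by (metis Cauchy_uniformly_convergent uniformly_convergent_on_def)
  then obtain l where "g = apply_bcontfun l" "f \<longlonglongrightarrow> l"
    using uniform_limit_bcontfunE[OF g] by (metis sequentially_bot)
  then show "\<exists>l\<in>UNIV. f \<longlonglongrightarrow> l" by blast
qed

lemma summable_of_norm_complete:
  fixes f :: "nat \<Rightarrow> 'b::real_normed_vector"
  assumes complete: "complete (UNIV :: 'b set)" and f: "summable (\<lambda>n. norm (f n))"
  shows "summable f"
proof -
  have "Cauchy (\<lambda>n. \<Sum>k<n. f k)"
  proof (rule metric_CauchyI)
    fix \<epsilon> :: real assume "\<epsilon> > 0"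
    then obtain N where N: "\<And>m n. m \<ge> N \<Longrightarrow> norm (\<Sum>k\<in>{m..<n}. norm (f k)) < \<epsilon>"
      using f unfolding summable_Cauchy by blast
    have le: "dist (\<Sum>k<m. f k) (\<Sum>k<n. f k) < \<epsilon>" if "N \<le> m" "m \<le> n" for m n
    proof -
      have "dist (\<Sum>k<m. f k) (\<Sum>k<n. f k) = norm (\<Sum>k\<in>{m..<n}. f k)"
        using that sum_diff_nat_ivl[of 0 m n f]
        by (simp add: lessThan_atLeast0 dist_norm norm_minus_commute[of "sum f {0..<m}"])
      also have "\<dots> \<le> (\<Sum>k\<in>{m..<n}. norm (f k))" by (rule norm_sum)
      also have "\<dots> < \<epsilon>" using N[of m n] that by simp
      finally show ?thesis .
    qed
    show "\<exists>M. \<forall>m\<ge>M. \<forall>n\<ge>M. dist (\<Sum>k<m. f k) (\<Sum>k<n. f k) < \<epsilon>"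
    proof (intro exI[of _ N] allI impI)
      fix m n assume "N \<le> m" "N \<le> n"
      then show "dist (\<Sum>k<m. f k) (\<Sum>k<n. f k) < \<epsilon>"
        using le[of m n] le[of n m] by (cases "m \<le> n") (auto simp: dist_commute)
    qed
  qed
  then show ?thesis
    using complete unfolding complete_def summable_iff_convergent convergent_def by blast
qed

text \<open>The maps \<open>R m\<close> stand for the partial sum operators \<open>z \<mapsto> \<Sum>n\<le>m. z(n) x\<^sub>n\<close> if
  \<open>X \<noteq> {0}\<close> and for the coordinate functionals if \<open>X = {0}\<close>; their limit \<open>Rlim\<close> is \<open>Q\<close>,
  respectively \<open>0\<close>.\<close>
locale norming_maps = monotone_normalized_basis e
  for e :: "nat \<Rightarrow> 'e::banach" +
  fixes R :: "nat \<Rightarrow> 'e \<Rightarrow> 'b::real_normed_vector" and Rlim :: "'e \<Rightarrow> 'b"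
  assumes R_linear: "\<And>m. linear (R m)"
    and R_le: "\<And>m z. norm (R m z) \<le> norm z"
    and R_lim: "\<And>z. (\<lambda>m. R m z) \<longlonglongrightarrow> Rlim z"
    and norming: "\<And>z B. (\<And>m. norm (R m z) \<le> B) \<Longrightarrow> norm z \<le> B"
    and R_low: "\<And>m z. (\<And>n. n \<le> m \<Longrightarrow> coef z n = 0) \<Longrightarrow> R m z = 0"
    and R_high: "\<And>m z. (\<And>n. n > m \<Longrightarrow> coef z n = 0) \<Longrightarrow> n > m \<Longrightarrow> R n z = Rlim z"
begin

lemma split_norm:
  assumes u: "u \<in> span (e ` {..<p})" and v: "v \<in> span (e ` {p..})"
  shows "norm (u + v) \<le> max (norm u) (norm (Rlim u) + norm v)"
proof (rule norming)
  fix m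
  show "norm (R m (u + v)) \<le> max (norm u) (norm (Rlim u) + norm v)"
  proof (cases "m < p")
    case True
    then have "R m v = 0" using coef_span_ge[OF v] by (intro R_low) auto
    then show ?thesis using R_le[of m u] by (simp add: linear_add[OF R_linear])
  next
    case False
    have "R m u = Rlim u"
    proof (cases "p = 0")
      case True
      then have "u = 0" using u by simp
      then have "R m u = 0" "Rlim u = 0"
        using R_lim[of 0] linear_0[OF R_linear] by (simp_all add: LIMSEQ_const_iff)
      then show ?thesis by simp
    next
      case p: False
      show ?thesis
      proof (rule R_high)
        show "coef u n = 0" if "n > p - 1" for n
          using that p by (intro coef_span_less[OF u]) auto
        show "p - 1 < m" using p \<open>\<not> m < p\<close> by auto
      qed
    qed
    then show ?thesis
      using R_le[of m v] norm_triangle_ineq[of "R m u" "R m v"] by (simp add: linear_add[OF R_linear])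
  qed
qed

end

lemma approx_by_multiple:
  assumes X: "subspace X" "unit_sphere X \<subseteq> closure (range s)" and x: "x \<in> X" and \<epsilon>: "\<epsilon> > 0"
  shows "\<exists>n. norm (x - norm x *\<^sub>R s n) < \<epsilon>"
proof (cases "x = 0")
  case False
  have "(1 / norm x) *\<^sub>R x \<in> unit_sphere X"
    using False x X(1) by (auto simp: unit_sphere_def subspace_scale)
  then have "(1 / norm x) *\<^sub>R x \<in> closure (range s)" using X(2) by blast
  moreover have "\<epsilon> / norm x > 0" using False \<epsilon> by simp
  ultimately obtain n where n: "dist (s n) ((1 / norm x) *\<^sub>R x) < \<epsilon> / norm x"
    unfolding closure_approachable by blast
  have "x - norm x *\<^sub>R s n = norm x *\<^sub>R ((1 / norm x) *\<^sub>R x - s n)"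
    using False by (simp add: scaleR_diff_right)
  then have "norm (x - norm x *\<^sub>R s n) = norm x * dist (s n) ((1 / norm x) *\<^sub>R x)"
    by (simp add: dist_norm norm_minus_commute)
  also have "\<dots> < \<epsilon>" using n False by (simp add: field_simps)
  finally show ?thesis by blast
qed (use \<epsilon> in auto)

context
  fixes S :: "nat \<Rightarrow> C2N set \<Rightarrow> C2N" and X :: "C2N set" and j :: "(nat \<Rightarrow> real) \<Rightarrow> 'e::banach"
  assumes S: "\<And>n. X \<noteq> {0} \<Longrightarrow> S n X \<in> unit_sphere X"
    and j: "is_completion (EX_norm S X) j UNIV"
begin

lemma norm_S: "X \<noteq> {0} \<Longrightarrow> norm (S n X) = 1"
  using S[of n] by (simp add: unit_sphere_def)

lemma basis_norm: "norm (\<Sum>n<k. a n *\<^sub>R j (unitvec n)) = EX_norm S X (trunc k a)"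
  using j by (rule completion_norm)

lemma EX_part_le_norm: "EX_part S X (trunc k a) m \<le> norm (\<Sum>n<k. a n *\<^sub>R j (unitvec n))"
  unfolding basis_norm using norm_S trunc_c00 by (rule EX_part_le_EX_norm)

lemma EX_basis: "monotone_normalized_basis (\<lambda>n. j (unitvec n))"
proof
  show "monotone_seq (\<lambda>n. j (unitvec n))"
    unfolding monotone_seq_def
  proof (intro allI impI)
    fix a :: "nat \<Rightarrow> real" and m k :: nat assume mk: "m \<le> k"
    show "norm (\<Sum>n<m. a n *\<^sub>R j (unitvec n)) \<le> norm (\<Sum>n<k. a n *\<^sub>R j (unitvec n))"
      unfolding basis_norm[of _ m]
    proof (rule EX_norm_least)
      show "EX_part S X (trunc m a) l \<le> norm (\<Sum>n<k. a n *\<^sub>R j (unitvec n))" for l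
      proof -
        have "trunc m (trunc k a) = trunc m a" using mk by (auto simp: trunc_def)
        then show ?thesis
          using EX_part_trunc[of S X m "trunc k a" l] EX_part_le_norm[of k a] by auto
      qed
    qed
  qed
  show "normalized (\<lambda>n. j (unitvec n))"
    unfolding normalized_def
  proof
    fix n
    have u: "unitvec n \<in> c00" by (auto simp: c00_def unitvec_def)
    have "EX_norm S X (unitvec n) = 1"
    proof (rule antisym)
      show "EX_norm S X (unitvec n) \<le> 1"
      proof (rule EX_norm_least)
        show "EX_part S X (unitvec n) m \<le> 1" for m
          using EX_part_lipschitz[of X S "{n}" "unitvec n" "\<lambda>_. 0" m] norm_S
          by (simp add: EX_part_zero unitvec_def)
      qed
      have "EX_part S X (unitvec n) n = 1"
        using norm_S[of n] by (simp add: EX_part_def unitvec_def if_distrib[of "\<lambda>t. t *\<^sub>R _"] cong: if_cong)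
      then show "1 \<le> EX_norm S X (unitvec n)"
        using EX_part_le_EX_norm[of X S "unitvec n" n] norm_S u by simp
    qed
    then show "norm (j (unitvec n)) = 1"
      using j u by (simp add: is_completion_def)
  qed
  show "closure (span (range (\<lambda>n. j (unitvec n)))) = UNIV"
    using j completion_image_c00[OF j] by (simp add: is_completion_def)
qed

interpretation B: monotone_normalized_basis "\<lambda>n. j (unitvec n)"
  by (rule EX_basis)

lemma EX_part_coef_le: "EX_part S X (B.coef x) m \<le> norm x"
proof -
  have "EX_part S X (B.coef x) m = EX_part S X (trunc (Suc m) (B.coef x)) m"
    by (auto simp: EX_part_def trunc_def intro!: arg_cong[of _ _ norm] sum.cong)
  also have "\<dots> \<le> norm x"
    using EX_part_le_norm[of "Suc m" "B.coef x" m] B.partial_sum_le_sums[OF B.coef_sums[of x], of "Suc m"]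
    by linarith
  finally show ?thesis .
qed

lemma norm_le_EX_part:
  assumes le: "\<And>m. EX_part S X (B.coef x) m \<le> b"
  shows "norm x \<le> b"
proof -
  have "0 \<le> b" using le[of 0] EX_part_nonneg[of S X "B.coef x" 0] by linarith
  have "norm (\<Sum>n<k. B.coef x n *\<^sub>R j (unitvec n)) \<le> b" for k
    unfolding basis_norm
  proof (rule EX_norm_least)
    fix m
    show "EX_part S X (trunc k (B.coef x)) m \<le> b"
      using EX_part_trunc[of S X k "B.coef x" m] le \<open>0 \<le> b\<close> by auto
  qed
  moreover have "(\<lambda>k. norm (\<Sum>n<k. B.coef x n *\<^sub>R j (unitvec n))) \<longlonglongrightarrow> norm x"
    using B.coef_sums[of x] unfolding sums_def by (rule tendsto_norm)
  ultimately show ?thesis by (intro LIMSEQ_le_const2) auto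
qed

lemma norming_maps_trivial:
  assumes "X = {0}"
  shows "norming_maps (\<lambda>n. j (unitvec n)) (\<lambda>m x. B.coef x m) (\<lambda>_. 0 :: real)"
proof (intro norming_maps.intro norming_maps_axioms.intro EX_basis)
  have part: "EX_part S X z m = \<bar>z m\<bar>" for z m by (simp add: EX_part_def assms)
  show "linear (\<lambda>x. B.coef x m)" for m
    by (rule bounded_linear.linear[OF B.coef_bounded_linear])
  show "norm (B.coef z m) \<le> norm z" for m z
    using EX_part_coef_le[of z m] by (simp add: part)
  show "norm z \<le> b" if "\<And>m. norm (B.coef z m) \<le> b" for z b
    using that by (intro norm_le_EX_part) (simp add: part)
  show "(\<lambda>m. B.coef z m) \<longlonglongrightarrow> 0" for z
  proof -
    have "(\<lambda>n. B.coef z n *\<^sub>R j (unitvec n)) \<longlonglongrightarrow> 0"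
      using B.coef_sums[of z] by (intro summable_LIMSEQ_zero sums_summable)
    from tendsto_norm[OF this] show ?thesis by (simp add: tendsto_rabs_zero_iff)
  qed
qed auto

definition R_part :: "nat \<Rightarrow> 'e \<Rightarrow> C2N" where
  "R_part m x = (\<Sum>n\<le>m. B.coef x n *\<^sub>R S n X)"

definition Q_map :: "'e \<Rightarrow> C2N" where
  "Q_map x = lim (\<lambda>m. R_part m x)"

context
  assumes X: "X \<noteq> {0}"
begin

lemma EX_part_R: "EX_part S X (B.coef x) m = norm (R_part m x)"
  using X by (simp add: EX_part_def R_part_def)

lemma R_part_le: "norm (R_part m x) \<le> norm x"
  using EX_part_coef_le by (simp add: EX_part_R)

lemma R_part_linear: "linear (R_part m)"
  unfolding R_part_def
  by (rule linearI) (simp_all add: B.coef_add B.coef_scale scaleR_add_left sum.distrib scaleR_sum_right)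

lemma R_part_high:
  assumes "\<And>n. n > m \<Longrightarrow> B.coef x n = 0" "k \<ge> m"
  shows "R_part k x = R_part m x"
  unfolding R_part_def using assms by (intro sum.mono_neutral_right) auto

lemma R_part_tendsto: "(\<lambda>m. R_part m x) \<longlonglongrightarrow> Q_map x"
proof -
  have "Cauchy (\<lambda>m. R_part m x)"
  proof (rule metric_CauchyI)
    fix \<epsilon> :: real assume "\<epsilon> > 0"
    define s where "s k = (\<Sum>n<k. B.coef x n *\<^sub>R j (unitvec n))" for k
    have "s \<longlonglongrightarrow> x" using B.coef_sums[of x] by (simp add: sums_def s_def[abs_def])
    then obtain k where k: "norm (s k - x) < \<epsilon> / 2"
      using LIMSEQ_D[of s x "\<epsilon> / 2"] \<open>\<epsilon> > 0\<close> by auto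
    have near: "dist (R_part m x) (R_part k (s k)) < \<epsilon> / 2" if "m \<ge> k" for m
    proof -
      have "R_part k (s k) = R_part m (s k)"
        using that by (intro R_part_high[symmetric]) (simp_all add: s_def B.coef_partial_sum)
      then have "dist (R_part m x) (R_part k (s k)) = norm (R_part m (x - s k))"
        by (simp add: dist_norm linear_diff[OF R_part_linear])
      then show ?thesis using R_part_le[of m "x - s k"] k by (simp add: norm_minus_commute)
    qed
    show "\<exists>M. \<forall>m\<ge>M. \<forall>n\<ge>M. dist (R_part m x) (R_part n x) < \<epsilon>"
      using near by (intro exI[of _ k] allI impI) (rule dist_triangle_half_l)
  qed
  then obtain l where "(\<lambda>m. R_part m x) \<longlonglongrightarrow> l"
    using complete_bcontfun unfolding complete_def by blast
  then show ?thesis unfolding Q_map_def by (metis limI)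
qed

lemma Q_map_high:
  assumes "\<And>n. n > m \<Longrightarrow> B.coef x n = 0"
  shows "Q_map x = R_part m x"
proof (rule LIMSEQ_unique[OF R_part_tendsto tendsto_eventually])
  show "\<forall>\<^sub>F k in sequentially. R_part k x = R_part m x"
    using R_part_high[OF assms] unfolding eventually_sequentially by blast
qed

lemma norming_maps_partial_sums: "norming_maps (\<lambda>n. j (unitvec n)) R_part Q_map"
proof (intro norming_maps.intro norming_maps_axioms.intro EX_basis)
  show "linear (R_part m)" for m by (rule R_part_linear)
  show "norm (R_part m z) \<le> norm z" for m z by (rule R_part_le)
  show "(\<lambda>m. R_part m z) \<longlonglongrightarrow> Q_map z" for z by (rule R_part_tendsto)
  show "norm z \<le> b" if "\<And>m. norm (R_part m z) \<le> b" for z b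
    using that by (intro norm_le_EX_part) (simp add: EX_part_R)
  show "R_part m z = 0" if "\<And>n. n \<le> m \<Longrightarrow> B.coef z n = 0" for m z
    using that by (simp add: R_part_def)
  show "R_part n z = Q_map z" if "\<And>n. n > m \<Longrightarrow> B.coef z n = 0" "n > m" for m n z
    using R_part_high[of m z n] Q_map_high[of m z] that by simp
qed

lemma Q_map_bounded_linear: "bounded_linear Q_map"
proof (rule bounded_linear_intro[of _ 1])
  fix x y :: 'e and r :: real
  show "Q_map (x + y) = Q_map x + Q_map y"
    using tendsto_add[OF R_part_tendsto[of x] R_part_tendsto[of y]] R_part_tendsto[of "x + y"]
    by (simp add: linear_add[OF R_part_linear] LIMSEQ_unique)
  show "Q_map (r *\<^sub>R x) = r *\<^sub>R Q_map x"
    using tendsto_scaleR[OF tendsto_const R_part_tendsto[of x], of r] R_part_tendsto[of "r *\<^sub>R x"]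
    by (simp add: linear_scale[OF R_part_linear] LIMSEQ_unique)
  show "norm (Q_map x) \<le> norm x * 1"
    using R_part_le by (intro LIMSEQ_le_const2[OF tendsto_norm[OF R_part_tendsto]]) auto
qed

lemma Q_map_e: "Q_map (j (unitvec n)) = S n X"
proof -
  have "Q_map (j (unitvec n)) = R_part n (j (unitvec n))"
    by (rule Q_map_high) (simp add: B.coef_e)
  also have "\<dots> = S n X"
    by (simp add: R_part_def B.coef_e if_distrib[of "\<lambda>t. t *\<^sub>R _"] cong: if_cong)
  finally show ?thesis .
qed

lemma norm_Q_map_le: "norm (Q_map x) \<le> norm x"
  using R_part_le by (intro LIMSEQ_le_const2[OF tendsto_norm[OF R_part_tendsto]]) auto

lemma onorm_Q_map: "onorm Q_map = 1"
proof (rule antisym)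
  show "onorm Q_map \<le> 1" using norm_Q_map_le by (intro onorm_bound) simp_all
  show "1 \<le> onorm Q_map"
    using onorm[OF Q_map_bounded_linear, of "j (unitvec 0)"] norm_S[OF X, of 0]
    by (simp add: Q_map_e)
qed

context
  assumes sub: "subspace X" and closed: "closed X"
    and dense: "unit_sphere X \<subseteq> closure (range (\<lambda>n. S n X))"
begin

lemma Q_map_in: "Q_map z \<in> X"
proof (rule closed_sequentially[OF closed _ R_part_tendsto])
  show "R_part m z \<in> X" for m
    unfolding R_part_def using S[OF X] sub
    by (intro subspace_sum subspace_scale) (auto simp: unit_sphere_def)
qed

lemma Q_map_lift:
  assumes "x \<in> X"
  shows "\<exists>z. Q_map z = x \<and> norm z \<le> 2 * norm x"
proof (cases "x = 0")
  case True
  then show ?thesis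
    using linear_0[OF bounded_linear.linear[OF Q_map_bounded_linear]] by (intro exI[of _ 0]) simp
next
  case False
  define \<delta> where "\<delta> i = norm x * (1/2) ^ Suc i" for i
  have "\<forall>i y. \<exists>n. y \<in> X \<longrightarrow> norm (y - norm y *\<^sub>R S n X) < \<delta> i"
  proof (intro allI)
    fix i y
    have "\<delta> i > 0" using False by (simp add: \<delta>_def)
    then show "\<exists>n. y \<in> X \<longrightarrow> norm (y - norm y *\<^sub>R S n X) < \<delta> i"
      using approx_by_multiple[OF sub dense] by blast
  qed
  then obtain N where N: "\<And>i y. y \<in> X \<Longrightarrow> norm (y - norm y *\<^sub>R S (N i y) X) < \<delta> i"
    unfolding choice_iff by blast
  define r where "r = rec_nat x (\<lambda>i y. y - norm y *\<^sub>R S (N i y) X)"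
  have r0: "r 0 = x" and rS: "r (Suc i) = r i - norm (r i) *\<^sub>R S (N i (r i)) X" for i
    by (simp_all add: r_def)
  have rX: "r i \<in> X" for i
  proof (induction i)
    case (Suc i)
    then show ?case
      unfolding rS using S[OF X] sub by (intro subspace_diff subspace_scale) (auto simp: unit_sphere_def)
  qed (simp add: r0 assms)
  have r_le: "norm (r i) \<le> norm x * (1/2) ^ i" for i
  proof (cases i)
    case (Suc k)
    show ?thesis using N[OF rX[of k], of k] unfolding Suc rS \<delta>_def by simp
  qed (simp add: r0)
  define w where "w i = norm (r i) *\<^sub>R j (unitvec (N i (r i)))" for i
  have w_norm: "norm (w i) \<le> norm x * (1/2) ^ i" for i
    using r_le by (simp add: w_def)
  have geo: "(\<lambda>i. norm x * (1/2::real) ^ i) sums (norm x * 2)"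
    using sums_mult[OF geometric_sums[of "1/2::real"], of "norm x"] by simp
  have sw: "summable (\<lambda>i. norm (w i))"
    by (rule summable_comparison_test'[OF sums_summable[OF geo], of 0]) (use w_norm in auto)
  define z where "z = suminf w"
  have wz: "w sums z" unfolding z_def by (rule summable_sums[OF summable_norm_cancel[OF sw]])
  have "norm z \<le> (\<Sum>i. norm (w i))" unfolding z_def by (rule summable_norm[OF sw])
  also have "\<dots> \<le> (\<Sum>i. norm x * (1/2::real) ^ i)"
    by (rule suminf_le[OF w_norm sw sums_summable[OF geo]])
  also have "\<dots> = norm x * 2" using geo by (simp add: sums_iff)
  finally have "norm z \<le> 2 * norm x" by simp
  moreover have "Q_map z = x"
  proof (rule LIMSEQ_unique)
    have Qw: "Q_map (w i) = r i - r (Suc i)" for i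
      unfolding w_def linear_scale[OF bounded_linear.linear[OF Q_map_bounded_linear]] Q_map_e rS by simp
    show "(\<lambda>k. \<Sum>i<k. Q_map (w i)) \<longlonglongrightarrow> Q_map z"
      using bounded_linear.sums[OF Q_map_bounded_linear wz] by (simp add: sums_def)
    have "(\<Sum>i<k. Q_map (w i)) = x - r k" for k
      by (induction k) (simp_all add: Qw r0)
    moreover have "r \<longlonglongrightarrow> 0"
      by (rule Lim_null_comparison[OF _ sums_summable[OF geo, THEN summable_LIMSEQ_zero]])
        (use r_le in simp)
    then have "(\<lambda>k. x - r k) \<longlonglongrightarrow> x - 0" by (intro tendsto_diff tendsto_const)
    ultimately show "(\<lambda>k. \<Sum>i<k. Q_map (w i)) \<longlonglongrightarrow> x" by simp
  qed
  ultimately show ?thesis by blast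
qed

lemma range_Q_map: "range Q_map = X"
proof
  show "range Q_map \<subseteq> X" using Q_map_in by auto
  show "X \<subseteq> range Q_map"
  proof
    fix x assume "x \<in> X"
    then obtain z where "Q_map z = x" using Q_map_lift by blast
    then show "x \<in> range Q_map" by blast
  qed
qed

lemma dual_separable_iff_nontrivial: "dual_separable (UNIV :: 'e set) \<longleftrightarrow> dual_separable X"
proof
  interpret R: norming_maps "\<lambda>n. j (unitvec n)" R_part Q_map by (rule norming_maps_partial_sums)
  show "dual_separable X" if "dual_separable (UNIV :: 'e set)"
    by (rule dual_separable_quotient[OF Q_map_bounded_linear Q_map_lift Q_map_in that])
  show "dual_separable (UNIV :: 'e set)" if "dual_separable X"
  proof (rule dual_separable_seq_embedding[OF sub that, where R = R_part and Rlim = Q_map])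
    show "R_part m z \<in> X" for m z
      unfolding R_part_def using S[OF X] sub
      by (intro subspace_sum subspace_scale) (auto simp: unit_sphere_def)
  qed (fact R.R_linear Q_map_in R.R_lim R.R_le R.norming)+
qed

lemma infinitely_often_near:
  assumes w: "w \<in> unit_sphere X" and v: "v \<in> X"
    and indep: "\<And>s t. s *\<^sub>R w + t *\<^sub>R v = 0 \<Longrightarrow> s = 0 \<and> t = 0" and \<epsilon>: "\<epsilon> > 0"
  shows "\<exists>n\<ge>N. norm (S n X - w) < \<epsilon>"
proof (rule ccontr)
  assume neg: "\<not> ?thesis"
  have far: "(\<lambda>n. S n X) ` {N..} \<subseteq> {y. \<epsilon> \<le> norm (y - w)}"
    using neg by (auto simp: not_less)
  have "closed {y. \<epsilon> \<le> norm (y - w)}"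
    by (intro closed_Collect_le continuous_intros)
  then have far: "closure ((\<lambda>n. S n X) ` {N..}) \<subseteq> {y. \<epsilon> \<le> norm (y - w)}"
    using far by (rule closure_minimal[rotated])
  have "range (\<lambda>n. S n X) = (\<lambda>n. S n X) ` {..<N} \<union> (\<lambda>n. S n X) ` {N..}"
    by (auto simp: image_Un[symmetric])
  then have "closure (range (\<lambda>n. S n X)) = (\<lambda>n. S n X) ` {..<N} \<union> closure ((\<lambda>n. S n X) ` {N..})"
    by (simp add: closure_Un finite_imp_closed)
  then have near: "y \<in> (\<lambda>n. S n X) ` {..<N}" if "y \<in> unit_sphere X" "norm (y - w) < \<epsilon>" for y
  proof -
    have "y \<in> (\<lambda>n. S n X) ` {..<N} \<union> closure ((\<lambda>n. S n X) ` {N..})"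
      using that(1) dense \<open>closure (range (\<lambda>n. S n X)) = _\<close> by blast
    moreover have "y \<notin> closure ((\<lambda>n. S n X) ` {N..})"
      using far that(2) by (auto dest: subsetD)
    ultimately show ?thesis by blast
  qed
  have wX: "w \<in> X" "norm w = 1" using w by (auto simp: unit_sphere_def)
  define g where "g t = (1 / norm (w + t *\<^sub>R v)) *\<^sub>R (w + t *\<^sub>R v)" for t :: real
  have nz: "w + t *\<^sub>R v \<noteq> 0" for t
    using indep[of 1 t] by auto
  have g_sphere: "g t \<in> unit_sphere X" for t
    using nz[of t] wX v sub by (auto simp: g_def unit_sphere_def intro!: subspace_scale subspace_add)
  have "inj g"
  proof (rule injI)
    fix s t assume st: "g s = g t"
    define \<alpha> \<beta> where "\<alpha> = 1 / norm (w + s *\<^sub>R v)" and "\<beta> = 1 / norm (w + t *\<^sub>R v)"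
    have "(\<alpha> - \<beta>) *\<^sub>R w + (\<alpha> * s - \<beta> * t) *\<^sub>R v = g s - g t"
      by (simp add: g_def \<alpha>_def[symmetric] \<beta>_def[symmetric] algebra_simps)
    then have "\<alpha> - \<beta> = 0 \<and> \<alpha> * s - \<beta> * t = 0" using st by (intro indep) simp
    moreover have "\<alpha> \<noteq> 0" using nz[of s] by (simp add: \<alpha>_def)
    ultimately show "s = t" by auto
  qed
  have "(g \<longlongrightarrow> (1 / norm (w + 0 *\<^sub>R v)) *\<^sub>R (w + 0 *\<^sub>R v)) (at_right 0)"
    unfolding g_def by (intro tendsto_intros) (use wX in auto)
  then have "(g \<longlongrightarrow> w) (at_right 0)" using wX by simp
  then have "\<forall>\<^sub>F t in at_right 0. dist (g t) w < \<epsilon>" using \<epsilon> by (rule tendstoD)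
  then obtain \<delta> where \<delta>: "\<delta> > 0" "\<And>t. 0 < t \<Longrightarrow> t < \<delta> \<Longrightarrow> dist (g t) w < \<epsilon>"
    unfolding eventually_at_right_field by blast
  have "g ` {0<..<\<delta>} \<subseteq> (\<lambda>n. S n X) ` {..<N}"
    using \<delta>(2) near g_sphere by (auto simp: dist_norm)
  then have "finite (g ` {0<..<\<delta>})" by (rule finite_subset) simp
  then have "finite {0<..<\<delta>}"
    using \<open>inj g\<close> by (meson finite_imageD inj_on_subset subset_UNIV)
  then show False using \<delta>(1) infinite_Ioo[of 0 \<delta>] by blast
qed

lemma basic_sequence_near:
  assumes w: "\<And>k. w k \<in> X" "normalized w" "basic_sequence w" and \<epsilon>: "\<epsilon> > 0"
  shows "\<exists>n\<ge>N. norm (S n X - w k) < \<epsilon>"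
proof -
  define l :: nat where "l = Suc k"
  show ?thesis
  proof (rule infinitely_often_near[OF _ w(1)[of l] _ \<epsilon>])
    show "w k \<in> unit_sphere X" using w by (simp add: unit_sphere_def normalized_def)
    fix s t assume st: "s *\<^sub>R w k + t *\<^sub>R w l = 0"
    define a where "a n = (if n = k then s else if n = l then t else 0)" for n
    have "(\<lambda>n. a n *\<^sub>R w n) sums (\<Sum>n\<in>{k, l}. a n *\<^sub>R w n)"
      by (rule sums_finite) (auto simp: a_def)
    then have a0: "(\<lambda>n. a n *\<^sub>R w n) sums 0" using st by (simp add: a_def l_def)
    have z0: "(\<lambda>n. 0 *\<^sub>R w n) sums 0" by simp
    have "0 \<in> closure (span (range w))" using closure_subset span_zero by blast
    then have "\<exists>!a. (\<lambda>n. a n *\<^sub>R w n) sums 0"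
      using w(3) unfolding basic_sequence_def schauder_basis_def by blast
    then have "\<forall>a b. (\<lambda>n. a n *\<^sub>R w n) sums 0 \<and> (\<lambda>n. b n *\<^sub>R w n) sums 0 \<longrightarrow> a = b"
      by (rule alt_ex1E)
    from this[rule_format, of a "\<lambda>_. 0"] have "a = (\<lambda>_. 0)" using a0 z0 by simp
    then have "a k = 0" "a l = 0" by simp_all
    then show "s = 0 \<and> t = 0" by (simp add: a_def l_def)
  qed
qed

lemma summable_subsequence_iff:
  assumes "strict_mono \<nu>"
  shows "summable (\<lambda>k. a k *\<^sub>R j (unitvec (\<nu> k))) \<longleftrightarrow> summable (\<lambda>k. a k *\<^sub>R S (\<nu> k) X)"
proof
  assume "summable (\<lambda>k. a k *\<^sub>R j (unitvec (\<nu> k)))"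
  then show "summable (\<lambda>k. a k *\<^sub>R S (\<nu> k) X)"
    by (auto dest: bounded_linear.summable[OF Q_map_bounded_linear] simp: linear_scale[OF bounded_linear.linear[OF Q_map_bounded_linear]] Q_map_e)
next
  interpret R: norming_maps "\<lambda>n. j (unitvec n)" R_part Q_map by (rule norming_maps_partial_sums)
  assume "summable (\<lambda>k. a k *\<^sub>R S (\<nu> k) X)"
  then have C: "Cauchy (\<lambda>n. \<Sum>k<n. a k *\<^sub>R S (\<nu> k) X)"
    by (rule LIMSEQ_imp_Cauchy[OF summable_LIMSEQ])
  show "summable (\<lambda>k. a k *\<^sub>R j (unitvec (\<nu> k)))"
    unfolding summable_Cauchy
  proof (intro allI impI)
    fix \<epsilon> :: real assume \<epsilon>: "\<epsilon> > 0"
    then obtain M where M: "\<And>m n. m \<ge> M \<Longrightarrow> n \<ge> M \<Longrightarrow>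
        dist (\<Sum>k<m. a k *\<^sub>R S (\<nu> k) X) (\<Sum>k<n. a k *\<^sub>R S (\<nu> k) X) < \<epsilon> / 2"
      using metric_CauchyD[OF C, of "\<epsilon> / 2"] by auto
    have "norm (\<Sum>k\<in>{m..<n}. a k *\<^sub>R j (unitvec (\<nu> k))) \<le> \<epsilon> / 2" if "m \<ge> M" for m n
    proof (rule R.norming)
      fix l
      have R_e: "R_part l (j (unitvec i)) = (if i \<le> l then S i X else 0)" for i
        by (simp add: R_part_def B.coef_e if_distrib[of "\<lambda>t. t *\<^sub>R _"] cong: if_cong)
      obtain q where q: "\<And>k. \<nu> k \<le> l \<longleftrightarrow> k < q"
      proof
        fix k
        have "\<exists>k. l < \<nu> k" using assms by (metis seq_suble Suc_le_eq)
        then show "\<nu> k \<le> l \<longleftrightarrow> k < (LEAST k. l < \<nu> k)"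
          by (metis (mono_tags, lifting) LeastI_ex assms leD leI not_less_Least order_less_le_trans strict_mono_less_eq)
      qed
      have "R_part l (\<Sum>k\<in>{m..<n}. a k *\<^sub>R j (unitvec (\<nu> k)))
          = (\<Sum>k\<in>{m..<n}. a k *\<^sub>R (if k < q then S (\<nu> k) X else 0))"
        by (simp add: linear_sum[OF R_part_linear] linear_scale[OF R_part_linear] R_e q)
      also have "\<dots> = (\<Sum>k\<in>{m..<max m (min n q)}. a k *\<^sub>R S (\<nu> k) X)"
        by (intro sum.mono_neutral_cong_right) auto
      also have "\<dots> = (\<Sum>k<max m (min n q). a k *\<^sub>R S (\<nu> k) X) - (\<Sum>k<m. a k *\<^sub>R S (\<nu> k) X)"
        using sum_diff_nat_ivl[of 0 m "max m (min n q)" "\<lambda>k. a k *\<^sub>R S (\<nu> k) X"]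
        by (simp add: lessThan_atLeast0)
      also have "norm \<dots> < \<epsilon> / 2"
        using M[of "max m (min n q)" m] that by (simp add: dist_norm)
      finally show "norm (R_part l (\<Sum>k\<in>{m..<n}. a k *\<^sub>R j (unitvec (\<nu> k)))) \<le> \<epsilon> / 2" by simp
    qed
    moreover have "\<epsilon> / 2 < \<epsilon>" using \<epsilon> by simp
    ultimately show "\<exists>N. \<forall>m\<ge>N. \<forall>n. norm (\<Sum>k\<in>{m..<n}. a k *\<^sub>R j (unitvec (\<nu> k))) < \<epsilon>"
      using le_less_trans by blast
  qed
qed

lemma subsequence_equivalent:
  assumes w: "\<And>k. w k \<in> X" "normalized w" "basic_sequence w"
  shows "\<exists>\<nu>. strict_mono \<nu> \<and> equivalent_seqs (\<lambda>k. j (unitvec (\<nu> k))) w"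
proof -
  have near: "\<exists>n\<ge>N. norm (S n X - w k) < (1/2) ^ k" for N k
    by (rule basic_sequence_near[OF w]) auto
  have "\<exists>\<nu>. \<forall>k. norm (S (\<nu> k) X - w k) < (1/2) ^ k \<and> \<nu> k < \<nu> (Suc k)"
  proof (rule dependent_nat_choice)
    show "\<exists>n. norm (S n X - w 0) < (1/2) ^ 0" using near[of 0 0] by blast
    show "\<exists>n'. norm (S n' X - w (Suc k)) < (1/2) ^ Suc k \<and> n < n'" for n k
      using near[of "Suc n" "Suc k"] unfolding Suc_le_eq by blast
  qed
  then obtain \<nu> where \<nu>: "\<And>k. norm (S (\<nu> k) X - w k) < (1/2) ^ k" "\<And>k. \<nu> k < \<nu> (Suc k)"
    by blast
  have "strict_mono \<nu>" using \<nu>(2) by (simp add: strict_mono_Suc_iff)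
  have perturb: "summable (\<lambda>k. a k *\<^sub>R v k)"
    if u: "summable (\<lambda>k. a k *\<^sub>R u k)" "\<And>k. norm (u k) = 1"
      and uv: "\<And>k. norm (v k - u k) \<le> (1/2) ^ k" for a and u v :: "nat \<Rightarrow> C2N"
  proof -
    have "(\<lambda>k. norm (a k *\<^sub>R u k)) \<longlonglongrightarrow> norm (0 :: C2N)"
      by (intro tendsto_norm summable_LIMSEQ_zero u)
    then have "convergent a"
      unfolding convergent_def using u(2) by (auto simp: tendsto_rabs_zero_iff)
    then have "Bseq a" by (rule convergent_imp_Bseq)
    then obtain K where K: "\<And>k. \<bar>a k\<bar> \<le> K" unfolding Bseq_def by auto
    have "summable (\<lambda>k. K * (1/2::real) ^ k)"
      by (intro summable_mult summable_geometric) simp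
    then have "summable (\<lambda>k. norm (a k *\<^sub>R (v k - u k)))"
      by (rule summable_comparison_test'[of _ 0]) (simp add: mult_mono K uv order_trans[OF abs_ge_zero K])
    then have "summable (\<lambda>k. a k *\<^sub>R (v k - u k))"
      by (rule summable_of_norm_complete[OF complete_bcontfun])
    from summable_add[OF u(1) this] show ?thesis by (simp add: scaleR_diff_right)
  qed
  have "summable (\<lambda>k. a k *\<^sub>R S (\<nu> k) X) \<longleftrightarrow> summable (\<lambda>k. a k *\<^sub>R w k)" for a
  proof
    show "summable (\<lambda>k. a k *\<^sub>R w k)" if "summable (\<lambda>k. a k *\<^sub>R S (\<nu> k) X)"
      using that norm_S[OF X] \<nu>(1) by (rule_tac perturb) (auto intro: less_imp_le simp: norm_minus_commute)
    show "summable (\<lambda>k. a k *\<^sub>R S (\<nu> k) X)" if "summable (\<lambda>k. a k *\<^sub>R w k)"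
      using that w(2) \<nu>(1) by (rule_tac perturb) (auto intro: less_imp_le simp: normalized_def)
  qed
  then have "equivalent_seqs (\<lambda>k. j (unitvec (\<nu> k))) w"
    unfolding equivalent_seqs_def summable_subsequence_iff[OF \<open>strict_mono \<nu>\<close>] by blast
  then show ?thesis using \<open>strict_mono \<nu>\<close> by blast
qed

end

end

lemma contains_c0_of_strictly_singular:
  fixes Q :: "'e \<Rightarrow> C2N"
  assumes Q: "bounded_linear Q" "\<And>n. Q (j (unitvec n)) = xseq S X n"
    and Y: "closed_subspace Y" "infinite_dimensional Y" "strictly_singular_on Q Y"
  shows "contains_c0 Y"
proof (cases "X = {0}")
  case True
  interpret R: norming_maps "\<lambda>n. j (unitvec n)" "\<lambda>m x. B.coef x m" "\<lambda>_. 0 :: real"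
    using True by (rule norming_maps_trivial)
  have Q0: "Q = (\<lambda>_. 0)"
    using Q True by (intro B.linear_eq_on_basis bounded_linear_zero) (simp_all add: xseq_def)
  interpret block_basis_setting "\<lambda>n. j (unitvec n)" Q
  proof (intro block_basis_setting.intro block_basis_setting_axioms.intro EX_basis)
    show "bounded_linear Q" by (rule Q)
    show "norm (u + v) \<le> max (norm u) (norm (Q u) + norm v)"
      if "u \<in> span ((\<lambda>n. j (unitvec n)) ` {..<p})" "v \<in> span ((\<lambda>n. j (unitvec n)) ` {p..})" for p u v
      using R.split_norm[OF that] by (simp add: Q0)
  qed
  show ?thesis by (rule contains_c0[OF Y])
next
  case False
  interpret R: norming_maps "\<lambda>n. j (unitvec n)" R_part Q_map
    using False by (rule norming_maps_partial_sums)
  have Q0: "Q = Q_map"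
    using Q False
    by (intro B.linear_eq_on_basis Q_map_bounded_linear) (simp_all add: xseq_def Q_map_e)
  interpret block_basis_setting "\<lambda>n. j (unitvec n)" Q
  proof (intro block_basis_setting.intro block_basis_setting_axioms.intro EX_basis)
    show "bounded_linear Q" by (rule Q)
    show "norm (u + v) \<le> max (norm u) (norm (Q u) + norm v)"
      if "u \<in> span ((\<lambda>n. j (unitvec n)) ` {..<p})" "v \<in> span ((\<lambda>n. j (unitvec n)) ` {p..})" for p u v
      using R.split_norm[OF that] by (simp add: Q0)
  qed
  show ?thesis by (rule contains_c0[OF Y])
qed

lemma dual_separable_trivial:
  assumes "X = {0}"
  shows "dual_separable (UNIV :: 'e set)"
proof -
  interpret R: norming_maps "\<lambda>n. j (unitvec n)" "\<lambda>m x. B.coef x m" "\<lambda>_. 0 :: real"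
    using assms by (rule norming_maps_trivial)
  show ?thesis
    by (rule dual_separable_seq_embedding[OF subspace_UNIV dual_separable_real,
          where R = "\<lambda>m x. B.coef x m" and Rlim = "\<lambda>_. 0"])
      (fact R.R_linear UNIV_I R.R_lim R.R_le R.norming)+
qed

end

lemma dual_separable_zero: "dual_separable {0 :: 'a::real_normed_vector}"
  unfolding dual_separable_def
proof (intro exI conjI ballI allI impI)
  show "countable {\<lambda>_ :: 'a. 0 :: real}" by simp
  show "bdd_functional {0} d" if "d \<in> {\<lambda>_. 0}" for d :: "'a \<Rightarrow> real"
    using that by (auto simp: bdd_functional_def)
  fix f :: "'a \<Rightarrow> real" and \<epsilon> :: real
  assume "bdd_functional {0} f"
  then have "\<bar>f 0\<bar> \<le> 0" unfolding bdd_functional_def by auto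
  then show "\<exists>d\<in>{\<lambda>_. 0}. \<forall>x\<in>{0}. \<bar>f x - d x\<bar> \<le> \<epsilon> * norm x" by simp
qed

section \<open>Analyticity\<close>

lemma Ex_completion_iff:
  fixes Y :: "'a::real_normed_vector set"
  assumes S: "\<And>n. Z \<noteq> {0} \<Longrightarrow> norm (S n Z) = 1"
  shows "(\<exists>i. is_completion (EX_norm S Z) i Y) \<longleftrightarrow>
    (\<exists>y. closure (span (range y)) = Y \<and>
      (\<forall>l :: rat list. norm (\<Sum>n<length l. of_rat (l ! n) *\<^sub>R y n)
        = EX_norm S Z (trunc (length l) (\<lambda>n. of_rat (l ! n)))))"
    (is "?L \<longleftrightarrow> ?R")
proof
  assume ?L
  then obtain i where i: "is_completion (EX_norm S Z) i Y" by blast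
  have "closure (span (range (\<lambda>n. i (unitvec n)))) = Y"
    using i completion_image_c00[OF i] by (simp add: is_completion_def)
  then show ?R
    by (intro exI[of _ "\<lambda>n. i (unitvec n)"] conjI allI completion_norm[OF i])
next
  assume ?R
  then obtain y where Y: "closure (span (range y)) = Y"
    and y: "\<And>l :: rat list. norm (\<Sum>n<length l. of_rat (l ! n) *\<^sub>R y n)
        = EX_norm S Z (trunc (length l) (\<lambda>n. of_rat (l ! n)))"
    by blast
  have norm_eq: "norm (\<Sum>n<k. a n *\<^sub>R y n) = EX_norm S Z (trunc k a)" for k a
  proof -
    have "\<forall>i n. \<exists>q. \<bar>of_rat q - a n\<bar> < inverse (real (Suc i))"
    proof (intro allI)
      fix i n
      have "a n - inverse (real (Suc i)) < a n + inverse (real (Suc i))" by simp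
      then obtain q where "a n - inverse (real (Suc i)) < of_rat q" "of_rat q < a n + inverse (real (Suc i))"
        using of_rat_dense by blast
      then have "\<bar>of_rat q - a n\<bar> < inverse (real (Suc i))" by (simp only: abs_less_iff) linarith
      then show "\<exists>q. \<bar>of_rat q - a n\<bar> < inverse (real (Suc i))" by blast
    qed
    then obtain q where q: "\<And>i n. \<bar>of_rat (q i n) - a n\<bar> < inverse (real (Suc i))"
      unfolding choice_iff by blast
    have q_lim: "(\<lambda>i. of_rat (q i n) :: real) \<longlonglongrightarrow> a n" for n
    proof (rule Lim_transform[OF tendsto_const], rule Lim_null_comparison)
      show "\<forall>\<^sub>F i in sequentially. norm (of_rat (q i n) - a n) \<le> inverse (real (Suc i))"
        using q unfolding real_norm_def by (intro always_eventually allI less_imp_le)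
      show "(\<lambda>i. inverse (real (Suc i))) \<longlonglongrightarrow> 0" by (rule LIMSEQ_inverse_real_of_nat)
    qed
    have lhs: "(\<lambda>i. norm (\<Sum>n<k. of_rat (q i n) *\<^sub>R y n)) \<longlonglongrightarrow> norm (\<Sum>n<k. a n *\<^sub>R y n)"
      by (intro tendsto_intros q_lim)
    have "norm (\<Sum>n<k. of_rat (q i n) *\<^sub>R y n) = EX_norm S Z (trunc k (\<lambda>n. of_rat (q i n)))" for i
    proof -
      have "(\<Sum>n<k. of_rat (map (q i) [0..<k] ! n) *\<^sub>R y n) = (\<Sum>n<k. of_rat (q i n) *\<^sub>R y n)"
        by (intro sum.cong) auto
      moreover have "trunc k (\<lambda>n. of_rat (map (q i) [0..<k] ! n)) = trunc k (\<lambda>n. of_rat (q i n))"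
        by (auto simp: trunc_def)
      ultimately show ?thesis using y[of "map (q i) [0..<k]"] by simp
    qed
    moreover have "(\<lambda>i. EX_norm S Z (trunc k (\<lambda>n. of_rat (q i n)))) \<longlonglongrightarrow> EX_norm S Z (trunc k a)"
    proof (rule LIM_zero_cancel, rule Lim_null_comparison)
      show "\<forall>\<^sub>F i in sequentially. norm (EX_norm S Z (trunc k (\<lambda>n. of_rat (q i n))) - EX_norm S Z (trunc k a))
          \<le> (\<Sum>n<k. \<bar>of_rat (q i n) - a n\<bar>)"
      proof (intro always_eventually allI)
        fix i
        have "\<bar>EX_norm S Z (trunc k (\<lambda>n. of_rat (q i n))) - EX_norm S Z (trunc k a)\<bar>
            \<le> (\<Sum>n<k. \<bar>trunc k (\<lambda>n. of_rat (q i n)) n - trunc k a n\<bar>)"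
          by (rule EX_norm_lipschitz) (use S trunc_c00 in \<open>auto simp: trunc_def\<close>)
        then show "norm (EX_norm S Z (trunc k (\<lambda>n. of_rat (q i n))) - EX_norm S Z (trunc k a))
            \<le> (\<Sum>n<k. \<bar>of_rat (q i n) - a n\<bar>)"
          by (simp add: trunc_def)
      qed
      have "(\<lambda>i. \<Sum>n<k. \<bar>of_rat (q i n) - a n\<bar>) \<longlonglongrightarrow> (\<Sum>n<k. \<bar>a n - a n\<bar>)"
        by (intro tendsto_intros q_lim)
      then show "(\<lambda>i. \<Sum>n<k. \<bar>of_rat (q i n) - a n\<bar>) \<longlonglongrightarrow> 0" by simp
    qed
    ultimately have "(\<lambda>i. norm (\<Sum>n<k. of_rat (q i n) *\<^sub>R y n)) \<longlonglongrightarrow> EX_norm S Z (trunc k a)"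
      by simp
    with lhs show ?thesis by (rule LIMSEQ_unique)
  qed
  define i where "i z = (\<Sum>n | z n \<noteq> 0. z n *\<^sub>R y n)" for z :: "nat \<Rightarrow> real"
  have i: "i z = (\<Sum>n<k. z n *\<^sub>R y n)" if "\<And>n. n \<ge> k \<Longrightarrow> z n = 0" for z k
    unfolding i_def using that by (intro sum.mono_neutral_left) (auto simp: not_less[symmetric])
  have bound: "\<exists>k. \<forall>n\<ge>k. z n = 0" if z: "z \<in> c00" for z :: "nat \<Rightarrow> real"
  proof -
    obtain k where "{n. z n \<noteq> 0} \<subseteq> {..<k}"
      using z finite_nat_bounded by (auto simp: c00_def)
    then show ?thesis by (intro exI[of _ k]) (auto simp: not_less[symmetric])
  qed
  have "is_completion (EX_norm S Z) i Y"
    unfolding is_completion_def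
  proof (intro conjI ballI allI)
    fix z w :: "nat \<Rightarrow> real" and s t assume "z \<in> c00" "w \<in> c00"
    then obtain k l where k: "\<And>n. n \<ge> k \<Longrightarrow> z n = 0" and l: "\<And>n. n \<ge> l \<Longrightarrow> w n = 0"
      using bound by metis
    have "i (\<lambda>n. s * z n + t * w n) = (\<Sum>n<max k l. (s * z n + t * w n) *\<^sub>R y n)"
      by (rule i) (simp add: k l)
    moreover have "i z = (\<Sum>n<max k l. z n *\<^sub>R y n)" by (rule i) (simp add: k)
    moreover have "i w = (\<Sum>n<max k l. w n *\<^sub>R y n)" by (rule i) (simp add: l)
    ultimately show "i (\<lambda>n. s * z n + t * w n) = s *\<^sub>R i z + t *\<^sub>R i w"
      by (simp add: scaleR_add_left sum.distrib scaleR_sum_right)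
  next
    fix z :: "nat \<Rightarrow> real" assume "z \<in> c00"
    then obtain k where k: "\<And>n. n \<ge> k \<Longrightarrow> z n = 0" using bound by blast
    then have "trunc k z = z" by (auto simp: trunc_def not_less)
    then show "norm (i z) = EX_norm S Z z" using norm_eq[where k = k and a = z] i[OF k] by simp
  next
    have "i ` c00 = span (range y)"
    proof
      show "i ` c00 \<subseteq> span (range y)"
        unfolding i_def by (intro image_subsetI span_sum span_scale span_base rangeI)
      show "span (range y) \<subseteq> i ` c00"
      proof
        fix x assume "x \<in> span (range y)"
        then obtain k where "x \<in> span (y ` {..<k})" by (auto simp: span_range_eq_UN_nat)
        then obtain a where a: "x = (\<Sum>n<k. a n *\<^sub>R y n)" by (rule span_image_lessThanE)
        have "i (trunc k a) = (\<Sum>n<k. trunc k a n *\<^sub>R y n)"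
          by (rule i) (simp add: trunc_def)
        also have "\<dots> = x" unfolding a by (intro sum.cong) (auto simp: trunc_def)
        finally show "x \<in> i ` c00" using trunc_c00[of k a] by blast
      qed
    qed
    then show "closure (i ` c00) = Y" using Y by simp
  qed
  then show ?L by blast
qed

lemma C2N_norm_SUP_dense:
  fixes f :: C2N
  shows "norm f = (SUP x\<in>{x. finite {i. x i}}. \<bar>f x\<bar>)"
proof -
  define D where "D = {x :: nat \<Rightarrow> bool. finite {i. x i}}"
  have ne: "D \<noteq> {}" unfolding D_def by (auto intro!: exI[of _ "\<lambda>_. False"])
  have bdd: "bdd_above ((\<lambda>x. \<bar>f x\<bar>) ` D)"
    using norm_bounded[of f] by (auto simp: bdd_above_def)
  have "norm f \<le> (SUP x\<in>D. \<bar>f x\<bar>)"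
  proof (rule norm_bound)
    fix y
    show "norm (f y) \<le> (SUP x\<in>D. \<bar>f x\<bar>)"
    proof (rule field_le_epsilon)
      fix \<epsilon> :: real assume "\<epsilon> > 0"
      then obtain N where "\<bar>f y - f (\<lambda>i. i < N \<and> y i)\<bar> < \<epsilon>"
        using truncation_uniform by blast
      moreover have "(\<lambda>i. i < N \<and> y i) \<in> D"
        unfolding D_def by (auto intro: finite_subset[of _ "{..<N}"])
      then have "\<bar>f (\<lambda>i. i < N \<and> y i)\<bar> \<le> (SUP x\<in>D. \<bar>f x\<bar>)"
        by (rule cSUP_upper[OF _ bdd])
      ultimately show "norm (f y) \<le> (SUP x\<in>D. \<bar>f x\<bar>) + \<epsilon>" unfolding real_norm_def by linarith
    qed
  qed
  moreover have "(SUP x\<in>D. \<bar>f x\<bar>) \<le> norm f"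
    using norm_bounded[of f] ne by (intro cSUP_least) auto
  ultimately show ?thesis by (simp add: D_def)
qed

lemma countable_finitely_true: "countable {x :: nat \<Rightarrow> bool. finite {i. x i}}"
proof -
  have "{x :: nat \<Rightarrow> bool. finite {i. x i}} \<subseteq> (\<lambda>A i. i \<in> A) ` Collect finite"
  proof
    fix x :: "nat \<Rightarrow> bool" assume "x \<in> {x. finite {i. x i}}"
    then show "x \<in> (\<lambda>A i. i \<in> A) ` Collect finite"
      by (intro image_eqI[of _ _ "{i. x i}"]) auto
  qed
  then show ?thesis using countable_Collect_finite countable_subset by blast
qed

text \<open>The type of continuous functions carries no second countability instance here, so
  measurability of linear combinations is reduced to that of their values at points.\<close>
lemma measurable_norm_C2N_sum:
  fixes f :: "nat \<Rightarrow> 'a \<Rightarrow> C2N"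
  assumes f: "\<And>n. f n \<in> borel_measurable M"
  shows "(\<lambda>\<omega>. norm (\<Sum>n\<in>I. a n *\<^sub>R f n \<omega>)) \<in> borel_measurable M"
proof -
  have "continuous_on UNIV (\<lambda>g :: C2N. g x)" for x
  proof (rule continuous_on_subset[OF linear_continuous_on])
    show "bounded_linear (\<lambda>g :: C2N. g x)"
    proof (rule bounded_linear_intro[of _ 1])
      show "norm (g x) \<le> norm g * 1" for g :: C2N using norm_bounded[of g x] by simp
    qed auto
  qed auto
  then have "(\<lambda>\<omega>. f n \<omega> x) \<in> borel_measurable M" for n x
    using measurable_compose[OF f borel_measurable_continuous_onI] by blast
  then have "(\<lambda>\<omega>. \<bar>\<Sum>n\<in>I. a n * f n \<omega> x\<bar>) \<in> borel_measurable M" for x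
    by measurable
  then have eval: "(\<lambda>\<omega>. \<bar>(\<Sum>n\<in>I. a n *\<^sub>R f n \<omega>) x\<bar>) \<in> borel_measurable M" for x
    by (simp add: apply_bcontfun_sum)
  show ?thesis
    unfolding C2N_norm_SUP_dense
  proof (rule borel_measurable_cSUP[OF countable_finitely_true eval])
    show "bdd_above ((\<lambda>x. \<bar>(\<Sum>n\<in>I. a n *\<^sub>R f n \<omega>) x\<bar>) ` {x. finite {i. x i}})" for \<omega>
      using norm_bounded[of "\<Sum>n\<in>I. a n *\<^sub>R f n \<omega>"] by (auto simp: bdd_above_def)
  qed
qed

lemma space_SB_M: "space SB_M = SB"
  unfolding SB_M_def by (rule space_measure_of) auto

lemma subspace_closure:
  fixes V :: "'a::real_normed_vector set"
  assumes V: "subspace V"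
  shows "subspace (closure V)"
  unfolding subspace_def
proof (intro conjI ballI allI)
  show "0 \<in> closure V" using subspace_0[OF V] closure_subset by blast
next
  fix x y assume "x \<in> closure V" "y \<in> closure V"
  then obtain f g where fg: "\<And>n. f n \<in> V" "f \<longlonglongrightarrow> x" "\<And>n. g n \<in> V" "g \<longlonglongrightarrow> y"
    unfolding closure_sequential by blast
  then have "(\<lambda>n. f n + g n) \<longlonglongrightarrow> x + y" by (intro tendsto_add)
  then show "x + y \<in> closure V"
    using fg subspace_add[OF V] unfolding closure_sequential by (intro exI[of _ "\<lambda>n. f n + g n"]) simp
next
  fix c x assume "x \<in> closure V"
  then obtain f where f: "\<And>n. f n \<in> V" "f \<longlonglongrightarrow> x" unfolding closure_sequential by blast
  then have "(\<lambda>n. c *\<^sub>R f n) \<longlonglongrightarrow> c *\<^sub>R x" by (intro tendsto_scaleR tendsto_const)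
  then show "c *\<^sub>R x \<in> closure V"
    using f subspace_scale[OF V] unfolding closure_sequential by (intro exI[of _ "\<lambda>n. c *\<^sub>R f n"]) simp
qed

lemma closed_span_SB: "closure (span A) \<in> SB"
  unfolding SB_def by (simp add: subspace_closure)

lemma measurable_closed_span:
  fixes q :: "nat \<Rightarrow> 'a::topological_space \<Rightarrow> C2N"
  assumes q: "\<And>n. continuous_on UNIV (q n)"
  shows "(\<lambda>\<alpha>. closure (span (range (\<lambda>n. q n \<alpha>)))) \<in> measurable borel SB_M"
  unfolding SB_M_def
proof (rule measurable_measure_of)
  fix A assume "A \<in> {{F \<in> SB. F \<inter> U \<noteq> {}} | U. open U}"
  then obtain U where U: "open U" "A = {F \<in> SB. F \<inter> U \<noteq> {}}" by blast
  have "closure (span (range (\<lambda>n. q n \<alpha>))) \<in> A \<longleftrightarrow> (\<exists>k a. (\<Sum>n<k. a n *\<^sub>R q n \<alpha>) \<in> U)" for \<alpha>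
  proof -
    have "closure (span (range (\<lambda>n. q n \<alpha>))) \<in> A \<longleftrightarrow> span (range (\<lambda>n. q n \<alpha>)) \<inter> U \<noteq> {}"
      using U closed_span_SB open_Int_closure_eq_empty[OF U(1)] by (auto simp: Int_commute)
    also have "\<dots> \<longleftrightarrow> (\<exists>k a. (\<Sum>n<k. a n *\<^sub>R q n \<alpha>) \<in> U)"
    proof
      assume "span (range (\<lambda>n. q n \<alpha>)) \<inter> U \<noteq> {}"
      then obtain x k where "x \<in> U" "x \<in> span ((\<lambda>n. q n \<alpha>) ` {..<k})"
        by (auto simp: span_range_eq_UN_nat)
      then obtain a where "x = (\<Sum>n<k. a n *\<^sub>R q n \<alpha>)" by (auto elim: span_image_lessThanE)
      then show "\<exists>k a. (\<Sum>n<k. a n *\<^sub>R q n \<alpha>) \<in> U" using \<open>x \<in> U\<close> by blast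
    next
      assume "\<exists>k a. (\<Sum>n<k. a n *\<^sub>R q n \<alpha>) \<in> U"
      moreover have "(\<Sum>n<k. a n *\<^sub>R q n \<alpha>) \<in> span (range (\<lambda>n. q n \<alpha>))" for k a
        by (intro span_sum span_scale span_base) auto
      ultimately show "span (range (\<lambda>n. q n \<alpha>)) \<inter> U \<noteq> {}" by blast
    qed
    finally show ?thesis .
  qed
  then have "(\<lambda>\<alpha>. closure (span (range (\<lambda>n. q n \<alpha>)))) -` A
      = (\<Union>k. \<Union>a. (\<lambda>\<alpha>. \<Sum>n<k. a n *\<^sub>R q n \<alpha>) -` U)"
    by auto
  moreover have "open ((\<lambda>\<alpha>. \<Sum>n<k. a n *\<^sub>R q n \<alpha>) -` U)" for k and a :: "nat \<Rightarrow> real"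
    using U(1) by (rule open_vimage) (intro continuous_intros q)
  ultimately show "(\<lambda>\<alpha>. closure (span (range (\<lambda>n. q n \<alpha>)))) -` A \<inter> space borel \<in> sets borel"
    by (simp add: open_UN)
qed (auto simp: closed_span_SB)

lemma sets_SB_M_zero: "{F \<in> SB. F = {0}} \<in> sets SB_M"
proof -
  have "{F \<in> SB. F \<inter> (- {0}) \<noteq> {}} \<in> sets SB_M"
    unfolding SB_M_def by (subst sets_measure_of) (auto intro!: sigma_sets.Basic)
  then have "SB - {F \<in> SB. F \<inter> (- {0}) \<noteq> {}} \<in> sets SB_M"
    using sets.compl_sets[of _ SB_M] by (simp add: space_SB_M)
  also have "SB - {F \<in> SB. F \<inter> (- {0}) \<noteq> {}} = {F \<in> SB. F = {0}}"
    by (auto simp: SB_def dest: subspace_0)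
  finally show ?thesis .
qed

lemma measurable_EX_norm:
  assumes S_borel: "\<And>n. S n \<in> measurable SB_M borel"
    and S_norm: "\<And>n Z. Z \<in> SB \<Longrightarrow> Z \<noteq> {0} \<Longrightarrow> norm (S n Z) = 1"
    and a: "a \<in> c00"
  shows "(\<lambda>Z. EX_norm S Z a) \<in> borel_measurable SB_M"
  unfolding EX_norm_eq_SUP
proof (rule borel_measurable_cSUP)
  show "(\<lambda>Z. EX_part S Z a m) \<in> borel_measurable SB_M" for m
    unfolding EX_part_def
  proof (rule measurable_If)
    show "(\<lambda>Z. norm (\<Sum>n\<le>m. a n *\<^sub>R S n Z)) \<in> borel_measurable SB_M"
      using S_borel by (rule measurable_norm_C2N_sum)
    show "{Z \<in> space SB_M. Z = {0}} \<in> sets SB_M"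
      using sets_SB_M_zero by (simp add: space_SB_M)
  qed simp
  show "bdd_above (range (EX_part S Z a))" if "Z \<in> space SB_M" for Z
    using that S_norm a by (intro EX_part_bounded) (auto simp: space_SB_M)
qed simp

lemma SB_eq_closed_span:
  fixes s :: "nat \<Rightarrow> C2N"
  assumes "Z \<in> SB" and dense: "Z \<noteq> {0} \<Longrightarrow> range s \<subseteq> Z \<and> unit_sphere Z \<subseteq> closure (range s)"
  shows "\<exists>y :: nat \<Rightarrow> C2N. closure (span (range y)) = Z"
proof (cases "Z = {0}")
  case True
  have "closure (span (range (\<lambda>_ :: nat. 0 :: C2N))) = Z"
    using True by simp
  then show ?thesis by (intro exI[of _ "\<lambda>_. 0"])
next
  case False
  have Z: "closed Z" "subspace Z" using assms(1) by (auto simp: SB_def)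
  have "closure (span (range s)) = Z"
  proof
    show "closure (span (range s)) \<subseteq> Z"
      using dense False Z by (intro closure_minimal span_minimal) auto
    show "Z \<subseteq> closure (span (range s))"
    proof
      fix x assume "x \<in> Z"
      have "\<exists>y\<in>span (range s). dist y x < \<epsilon>" if "\<epsilon> > 0" for \<epsilon>
      proof -
        obtain n where "norm (x - norm x *\<^sub>R s n) < \<epsilon>"
          using approx_by_multiple[OF Z(2) _ \<open>x \<in> Z\<close> \<open>\<epsilon> > 0\<close>] dense False by blast
        then show ?thesis
          by (intro bexI[of _ "norm x *\<^sub>R s n"] span_scale span_base rangeI)
            (simp add: dist_norm norm_minus_commute)
      qed
      then show "x \<in> closure (span (range s))" by (simp add: closure_approachable)
    qed
  qed
  then show ?thesis by blast
qed

lemma Baire_space_sequence_surjection: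
  obtains p :: "nat \<Rightarrow> (nat \<Rightarrow> nat) \<Rightarrow> C2N"
  where "\<And>n. continuous_on UNIV (p n)" "\<And>y. \<exists>\<alpha>. \<forall>n. p n \<alpha> = y n"
proof -
  obtain D :: "C2N set" where D: "countable D" "closure D = UNIV" by (rule C2N_separable)
  obtain \<phi> :: "(nat \<Rightarrow> nat) \<Rightarrow> C2N" where \<phi>: "continuous_on UNIV \<phi>" "surj \<phi>"
    by (rule Baire_space_continuous_surjection[OF complete_bcontfun D])
  define p where "p n \<alpha> = \<phi> (\<lambda>k. \<alpha> (prod_encode (n, k)))" for n and \<alpha> :: "nat \<Rightarrow> nat"
  have "continuous_on UNIV (p n)" for n
    unfolding p_def
    by (rule continuous_on_compose2[OF \<phi>(1)])
      (auto intro!: continuous_on_coordinatewise_then_product)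
  moreover have "\<exists>\<alpha>. \<forall>n. p n \<alpha> = y n" for y
  proof -
    have "\<forall>n. \<exists>\<beta>. y n = \<phi> \<beta>" using \<phi>(2) unfolding surj_def by blast
    then obtain \<beta> where \<beta>: "\<And>n. y n = \<phi> (\<beta> n)" unfolding choice_iff by blast
    have "p n (\<lambda>m. \<beta> (fst (prod_decode m)) (snd (prod_decode m))) = y n" for n
      by (simp add: p_def \<beta>)
    then show ?thesis by blast
  qed
  ultimately show thesis by (rule that)
qed

text \<open>Borel subsets of the Baire space are ranges of Borel maps for a trivial reason: map
  the complement to a point of the set.  It therefore suffices to exhibit the set as the
  image of a Borel set of parameters.\<close>
lemma analytic_in_image:
  assumes f: "f \<in> measurable (borel :: (nat \<Rightarrow> nat) measure) M" and B: "B \<in> sets borel"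
  shows "analytic_in M (f ` B)"
proof (cases "B = {}")
  case True
  then show ?thesis by (simp add: analytic_in_def)
next
  case False
  then obtain \<alpha>\<^sub>0 where \<alpha>\<^sub>0: "\<alpha>\<^sub>0 \<in> B" by blast
  have sp: "f \<alpha> \<in> space M" for \<alpha> using measurable_space[OF f] by simp
  have "(\<lambda>\<alpha>. if \<alpha> \<in> B then f \<alpha> else f \<alpha>\<^sub>0) \<in> measurable borel M"
    using f B sp by (intro measurable_If_set measurable_const) auto
  moreover have "range (\<lambda>\<alpha>. if \<alpha> \<in> B then f \<alpha> else f \<alpha>\<^sub>0) = f ` B"
    using \<alpha>\<^sub>0 by auto
  ultimately show ?thesis unfolding analytic_in_def using sp by blast
qed

lemma analytic_completions:
  assumes S_borel: "\<And>n. S n \<in> measurable SB_M borel"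
    and S_sphere: "\<And>n Z. Z \<in> SB \<Longrightarrow> Z \<noteq> {0} \<Longrightarrow> S n Z \<in> unit_sphere Z"
    and S_dense: "\<And>Z. Z \<in> SB \<Longrightarrow> Z \<noteq> {0} \<Longrightarrow> unit_sphere Z \<subseteq> closure (range (\<lambda>n. S n Z))"
  shows "analytic_in (SB_M \<Otimes>\<^sub>M SB_M)
    {(Z, Y). Z \<in> SB \<and> Y \<in> SB \<and> (\<exists>i. is_completion (EX_norm S Z) i Y)}"
    (is "analytic_in _ ?E")
proof -
  have S_norm: "norm (S n Z) = 1" if "Z \<in> SB" "Z \<noteq> {0}" for n Z
    using S_sphere[OF that] by (simp add: unit_sphere_def)
  obtain p :: "nat \<Rightarrow> (nat \<Rightarrow> nat) \<Rightarrow> C2N"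
    where p: "\<And>n. continuous_on UNIV (p n)" and p_surj: "\<And>y. \<exists>\<alpha>. \<forall>n. p n \<alpha> = y n"
    by (rule Baire_space_sequence_surjection) (rule that)
  define z where "z n = p (2 * n)" for n
  define y where "y n = p (2 * n + 1)" for n
  have z: "continuous_on UNIV (z n)" and y: "continuous_on UNIV (y n)" for n
    by (simp_all add: z_def y_def p)
  have zy_surj: "\<exists>\<alpha>. (\<forall>n. z n \<alpha> = z' n) \<and> (\<forall>n. y n \<alpha> = y' n)" for z' y'
  proof -
    obtain \<alpha> where "\<forall>n. p n \<alpha> = (if even n then z' (n div 2) else y' (n div 2))"
      using p_surj[of "\<lambda>n. if even n then z' (n div 2) else y' (n div 2)"] by blast
    then have "(\<forall>n. z n \<alpha> = z' n) \<and> (\<forall>n. y n \<alpha> = y' n)" by (simp add: z_def y_def)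
    then show ?thesis by blast
  qed
  define Zf where "Zf \<alpha> = closure (span (range (\<lambda>n. z n \<alpha>)))" for \<alpha>
  define Yf where "Yf \<alpha> = closure (span (range (\<lambda>n. y n \<alpha>)))" for \<alpha>
  have Zf: "Zf \<in> measurable borel SB_M" and Yf: "Yf \<in> measurable borel SB_M"
    unfolding Zf_def Yf_def using z y by (auto intro: measurable_closed_span)
  define B where "B = (\<Inter>l :: rat list. {\<alpha>. norm (\<Sum>n<length l. of_rat (l ! n) *\<^sub>R y n \<alpha>)
      = EX_norm S (Zf \<alpha>) (trunc (length l) (\<lambda>n. of_rat (l ! n)))})"
  have "{\<alpha>. norm (\<Sum>n<length l. of_rat (l ! n) *\<^sub>R y n \<alpha>)
      = EX_norm S (Zf \<alpha>) (trunc (length l) (\<lambda>n. of_rat (l ! n)))} \<in> sets borel" for l :: "rat list"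
  proof -
    have "(\<lambda>\<alpha>. norm (\<Sum>n<length l. of_rat (l ! n) *\<^sub>R y n \<alpha>)) \<in> borel_measurable borel"
      by (intro borel_measurable_continuous_onI continuous_intros y)
    moreover have "(\<lambda>\<alpha>. EX_norm S (Zf \<alpha>) (trunc (length l) (\<lambda>n. of_rat (l ! n)))) \<in> borel_measurable borel"
      by (rule measurable_compose[OF Zf measurable_EX_norm[OF S_borel S_norm trunc_c00]])
    ultimately have "{\<alpha> \<in> space borel. norm (\<Sum>n<length l. of_rat (l ! n) *\<^sub>R y n \<alpha>)
      = EX_norm S (Zf \<alpha>) (trunc (length l) (\<lambda>n. of_rat (l ! n)))} \<in> sets borel"
      by (rule borel_measurable_eq)
    then show ?thesis by simp
  qed
  then have B: "B \<in> sets borel"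
    unfolding B_def by (intro sets.countable_INT'' ) auto
  have f: "(\<lambda>\<alpha>. (Zf \<alpha>, Yf \<alpha>)) \<in> measurable borel (SB_M \<Otimes>\<^sub>M SB_M)"
    using Zf Yf by (rule measurable_Pair)
  have "(\<lambda>\<alpha>. (Zf \<alpha>, Yf \<alpha>)) ` B = ?E"
  proof
    show "(\<lambda>\<alpha>. (Zf \<alpha>, Yf \<alpha>)) ` B \<subseteq> ?E"
    proof (clarify, intro conjI)
      fix \<alpha> assume "\<alpha> \<in> B"
      show SB: "Zf \<alpha> \<in> SB" "Yf \<alpha> \<in> SB" by (simp_all add: Zf_def Yf_def closed_span_SB)
      show "\<exists>i. is_completion (EX_norm S (Zf \<alpha>)) i (Yf \<alpha>)"
        using \<open>\<alpha> \<in> B\<close> Ex_completion_iff[of "Zf \<alpha>" S "Yf \<alpha>"] S_norm[OF SB(1)]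
        by (auto simp: B_def Yf_def)
    qed
    show "?E \<subseteq> (\<lambda>\<alpha>. (Zf \<alpha>, Yf \<alpha>)) ` B"
    proof clarify
      fix Z Y i assume Z: "Z \<in> SB" and "Y \<in> SB" and i: "is_completion (EX_norm S Z) i Y"
      have "\<exists>z' :: nat \<Rightarrow> C2N. closure (span (range z')) = Z"
        by (rule SB_eq_closed_span[OF Z, where s = "\<lambda>n. S n Z"])
          (use S_sphere[OF Z] S_dense[OF Z] in \<open>auto simp: unit_sphere_def\<close>)
      then obtain z' :: "nat \<Rightarrow> C2N" where z': "closure (span (range z')) = Z" by blast
      obtain y' where y': "closure (span (range y')) = Y"
        "\<And>l :: rat list. norm (\<Sum>n<length l. of_rat (l ! n) *\<^sub>R y' n)
            = EX_norm S Z (trunc (length l) (\<lambda>n. of_rat (l ! n)))"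
        using Ex_completion_iff[of Z S Y] S_norm[OF Z] i by blast
      obtain \<alpha> where \<alpha>: "\<And>n. z n \<alpha> = z' n" "\<And>n. y n \<alpha> = y' n" using zy_surj by blast
      have ZY: "Zf \<alpha> = Z" "Yf \<alpha> = Y" using z' y'(1) by (simp_all add: Zf_def Yf_def \<alpha>)
      moreover have "\<alpha> \<in> B" using y'(2) by (simp add: B_def ZY \<alpha>)
      ultimately show "(Z, Y) \<in> (\<lambda>\<alpha>. (Zf \<alpha>, Yf \<alpha>)) ` B" by (intro image_eqI[of _ _ \<alpha>]) auto
    qed
  qed
  then show ?thesis using analytic_in_image[OF f B] by simp
qed

theorem theorem3:
  fixes S :: "nat \<Rightarrow> C2N set \<Rightarrow> C2N"
    and X :: "C2N set"
    and j :: "(nat \<Rightarrow> real) \<Rightarrow> 'e::banach"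
  assumes S_borel: "\<forall>n. S n \<in> measurable SB_M borel"
    and S_dense: "\<forall>Z\<in>SB. Z \<noteq> {0} \<longrightarrow>
         (\<forall>n. S n Z \<in> unit_sphere Z) \<and> unit_sphere Z \<subseteq> closure (range (\<lambda>n. S n Z))"
    and X_SB: "X \<in> SB"
    and E_X: "is_completion (EX_norm S X) j UNIV"
  shows
    "(schauder_basis (\<lambda>n. j (unitvec n)) UNIV \<and> normalized (\<lambda>n. j (unitvec n))
       \<and> monotone_seq (\<lambda>n. j (unitvec n)))
     \<and> (X \<noteq> {0} \<longrightarrow> (\<exists>Q::'e \<Rightarrow> C2N. bounded_linear Q \<and> (\<forall>n. Q (j (unitvec n)) = S n X)
          \<and> onorm Q = 1 \<and> range Q = X))
     \<and> (\<forall>Q::'e \<Rightarrow> C2N. bounded_linear Q \<and> (\<forall>n. Q (j (unitvec n)) = xseq S X n) \<longrightarrow>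
          (\<forall>Y. closed_subspace Y \<and> infinite_dimensional Y \<and> strictly_singular_on Q Y
               \<longrightarrow> contains_c0 Y))
     \<and> (\<forall>w. (\<forall>k. w k \<in> X) \<and> normalized w \<and> basic_sequence w \<longrightarrow>
          (\<exists>\<nu>. strict_mono \<nu> \<and> equivalent_seqs (\<lambda>k. j (unitvec (\<nu> k))) w))
     \<and> analytic_in (SB_M \<Otimes>\<^sub>M SB_M)
          {(Z, Y). Z \<in> SB \<and> Y \<in> SB \<and> (\<exists>i. is_completion (EX_norm S Z) i Y)}
     \<and> (dual_separable (UNIV :: 'e set) \<longleftrightarrow> dual_separable X)"
proof -
  have S_sphere: "S n Z \<in> unit_sphere Z" if "Z \<in> SB" "Z \<noteq> {0}" for n Z
    using S_dense that by blast
  have dense: "unit_sphere Z \<subseteq> closure (range (\<lambda>n. S n Z))" if "Z \<in> SB" "Z \<noteq> {0}" for Z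
    using S_dense that by blast
  have X: "closed X" "subspace X" using X_SB by (auto simp: SB_def)
  note S_X = S_sphere[OF X_SB]
  note dense_X = dense[OF X_SB]
  interpret B: monotone_normalized_basis "\<lambda>n. j (unitvec n)"
    using S_X E_X by (rule EX_basis)
  have "schauder_basis (\<lambda>n. j (unitvec n)) UNIV \<and> normalized (\<lambda>n. j (unitvec n))
      \<and> monotone_seq (\<lambda>n. j (unitvec n))"
    using B.schauder_basis B.nrm B.mono by blast
  moreover have "\<exists>Q::'e \<Rightarrow> C2N. bounded_linear Q \<and> (\<forall>n. Q (j (unitvec n)) = S n X)
      \<and> onorm Q = 1 \<and> range Q = X" if "X \<noteq> {0}"
    using Q_map_bounded_linear[OF S_X E_X that] Q_map_e[OF S_X E_X that] onorm_Q_map[OF S_X E_X that]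
      range_Q_map[OF S_X E_X that X(2,1) dense_X[OF that]]
    by blast
  moreover have "contains_c0 Y"
    if "bounded_linear Q" "\<And>n. Q (j (unitvec n)) = xseq S X n" "closed_subspace Y"
      "infinite_dimensional Y" "strictly_singular_on Q Y" for Q :: "'e \<Rightarrow> C2N" and Y
    using S_X E_X that by (rule contains_c0_of_strictly_singular)
  moreover have "\<exists>\<nu>. strict_mono \<nu> \<and> equivalent_seqs (\<lambda>k. j (unitvec (\<nu> k))) w"
    if w: "\<And>k. w k \<in> X" "normalized w" "basic_sequence w" for w
  proof -
    have "norm (w 0) = 1" using w(2) by (simp add: normalized_def)
    then have X0: "X \<noteq> {0}" using w(1)[of 0] by auto
    show ?thesis
      using S_X E_X X0 X(2,1) dense_X[OF X0] w by (rule subsequence_equivalent)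
  qed
  moreover have "analytic_in (SB_M \<Otimes>\<^sub>M SB_M)
      {(Z, Y). Z \<in> SB \<and> Y \<in> SB \<and> (\<exists>i. is_completion (EX_norm S Z) i Y)}"
    using S_borel S_sphere dense by (intro analytic_completions) auto
  moreover have "dual_separable (UNIV :: 'e set) \<longleftrightarrow> dual_separable X"
  proof (cases "X = {0}")
    case True
    then show ?thesis
      using dual_separable_trivial[OF S_X E_X True] dual_separable_zero[where 'a = C2N] by simp
  next
    case False
    show ?thesis
      using S_X E_X False X(2,1) dense_X[OF False] by (rule dual_separable_iff_nontrivial)
  qed
  ultimately show ?thesis by blast
qed

end
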